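(* Let $t\in(0,1)$, let $s_0,s_1,s_2,\ldots$ be complex parameters, let $\gamma\neq 0$ be an arbitrary complex number, let $n\ge 1$, and let $u_1,\dots,u_{2n}$ be complex variables satisfying, for some $\varepsilon>0$, $$\left|\frac{u_i-s_x}{1-s_xu_i}\right|\le 1-\varepsilon<1\qquad\text{for all } i=1,\dots,2n \text{ and all } x=0,1,2,\ldots.$$ Then $$ \sum_{\lambda:\ m_i(\lambda)\in 2\mathbb{Z}_{\ge0}\ \forall i\ge 0} \frac{1}{(t;t)_{m_0(\lambda)}}\prod_{j=1}^{m_0(\lambda)/2}\bigl(1-s_0^2\gamma^{-1}t^{2j-2}\bigr)\bigl(1-\gamma t^{2j-1}\bigr)\prod_{j=1}^{2n}(1-s_0u_j) \prod_{i=1}^{\infty}\prod_{j=1}^{m_i(\lambda)/2}\frac{1-s_i^2t^{2j-2}}{1-t^{2j}}\;F_\lambda(u_1,\dots,u_{2n}) $$ $$ =\prod_{1\le i<j\le 2n}\frac{1-tu_iu_j}{u_i-u_j}\; \mathop{\rm Pf}_{1\le i<j\le 2n}\left[\frac{(u_i-u_j)\Bigl((1-t)(1-s_0u_i)(1-s_0u_j)+(1-\gamma)(t-s_0^2\gamma^{-1})(1-u_iu_j)\Bigr)}{(1-u_iu_j)(1-tu_iu_j)}\right], $$ where the sum runs over all signatures $\lambda$ with exactly $2n$ parts all of whose multiplicities (including $m_0(\lambda)$) are even.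
   Context: A signature with $N$ parts is a sequence of integers $\lambda=(\lambda_1\ge\lambda_2\ge\dots\ge\lambda_N\ge 0)$; $m_i(\lambda)$ denotes the number of parts of $\lambda$ equal to $i$ (so $m_0(\lambda)$ is the number of zero parts). $(a;t)_k=(1-a)(1-at)\cdots(1-at^{k-1})$ is the $t$-Pochhammer symbol. The fully inhomogeneous spin Hall--Littlewood symmetric rational function is $$F_\lambda(u_1,\dots,u_N)=\sum_{\sigma\in S_N}\sigma\Biggl(\prod_{1\le i<j\le N}\frac{u_i-tu_j}{u_i-u_j}\prod_{i=1}^N\Bigl(\frac{1-t}{1-s_{\lambda_i}u_i}\prod_{j=0}^{\lambda_i-1}\frac{u_i-s_j}{1-s_ju_i}\Bigr)\Biggr),$$ where $\sigma\in S_N$ acts by permuting the variables $u_1,\dots,u_N$. $\mathrm{Pf}$ denotes the Pfaffian of the antisymmetric $2n\times 2n$ matrix whose entries above the diagonal are given. *)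

theory Defs
  imports "HOL-Analysis.Analysis"
begin

text \<open>
  Parts, variables and matrix entries are indexed from \<open>0\<close>: an \<open>N\<close>-tuple of variables
  \<open>(u\<^sub>1, \<dots>, u\<^sub>N)\<close> is a function \<open>u\<close> of which only \<open>u 0, \<dots>, u (N - 1)\<close> matter.
\<close>

definition signatures :: "nat \<Rightarrow> nat list set" where
  "signatures N = {lam. length lam = N \<and> sorted_wrt (\<ge>) lam}"

definition t_pochhammer :: "complex \<Rightarrow> complex \<Rightarrow> nat \<Rightarrow> complex" where
  "t_pochhammer a t k = (\<Prod>i<k. 1 - a * t ^ i)"

definition spin_HL_summand ::
    "complex \<Rightarrow> (nat \<Rightarrow> complex) \<Rightarrow> nat list \<Rightarrow> (nat \<Rightarrow> complex) \<Rightarrow> complex" where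
  "spin_HL_summand t s lam u =
     (\<Prod>j<length lam. \<Prod>i<j. (u i - t * u j) / (u i - u j)) *
     (\<Prod>i<length lam. (1 - t) / (1 - s (lam ! i) * u i) *
        (\<Prod>j<lam ! i. (u i - s j) / (1 - s j * u i)))"

definition spin_HL ::
    "complex \<Rightarrow> (nat \<Rightarrow> complex) \<Rightarrow> nat list \<Rightarrow> (nat \<Rightarrow> complex) \<Rightarrow> complex" where
  "spin_HL t s lam u =
     (\<Sum>\<sigma> | \<sigma> permutes {..<length lam}. spin_HL_summand t s lam (u \<circ> \<sigma>))"

text \<open>
  \<open>antisym_ext f\<close> is the antisymmetric matrix whose entries above the diagonal are given by \<open>f\<close>,
  and \<open>pfaffian n A\<close> is the Pfaffian of the \<open>2n \<times> 2n\<close> matrix \<open>A\<close>.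
\<close>

definition antisym_ext :: "(nat \<Rightarrow> nat \<Rightarrow> complex) \<Rightarrow> nat \<Rightarrow> nat \<Rightarrow> complex" where
  "antisym_ext f i j = (if i < j then f i j else if j < i then - f j i else 0)"

definition pfaffian :: "nat \<Rightarrow> (nat \<Rightarrow> nat \<Rightarrow> complex) \<Rightarrow> complex" where
  "pfaffian n A =
     (\<Sum>\<sigma> | \<sigma> permutes {..<2 * n}. of_int (sign \<sigma>) * (\<Prod>k<n. A (\<sigma> (2 * k)) (\<sigma> (2 * k + 1))))
       / (2 ^ n * fact n)"

end

theory Submission
  imports Defs "HOL-Combinatorics.Multiset_Permutations"
begin

text \<open>
  Everything is expressed through finite sets \<open>U\<close> of complex numbers. Absorbing the prefactor into the
  Pfaffian turns the right-hand side into a sum over perfect matchings of \<open>U\<close>, and splitting off the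
  zero parts of the signatures turns the theorem into two statements.

  (1) A one-step identity between rational functions: the right-hand side equals a sum over
  \<open>T \<subseteq> U\<close> (the variables in nonzero rows) of explicit factors times the right-hand side for \<open>T\<close>
  with \<open>s\<^sub>0 = 0\<close>, \<open>\<gamma> = 1\<close>. Proof by induction on the number of variables: multiplied by
  \<open>\<Prod>k. (x - k) (1 - x k)\<close>, the difference of the two sides is a polynomial in one variable \<open>x\<close>, of
  degree at most twice the number of the other variables \<open>k\<close>. It vanishes at every \<open>x = k\<close>
  (antisymmetry) and at every \<open>x = 1 / k\<close> (both residues reduce to the identity without \<open>x\<close> and \<open>k\<close>). One more zero comes
  from the pair of variables \<open>s\<^sub>0, t s\<^sub>0\<close>: removing it divides both sides by the same constant and
  rescales \<open>s\<^sub>0\<close> to \<open>t\<^sup>2 s\<^sub>0\<close>, \<open>\<gamma>\<close> being adjusted accordingly.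

  (2) For \<open>\<gamma> = 1\<close> the right-hand side, up to a trivial factor, does not depend on \<open>s\<close>, so (1) says that it
  satisfies the recursion of the sum over signatures under deletion of the first row. The convergence
  assumption makes this recursion a contraction, which identifies the two.
\<close>

section \<open>Sums over orderings of a finite set\<close>

text \<open>The obstacle in (1) is a count of zeros. With \<open>V\<close> the other variables, the
  degree is bounded only by \<open>2 * card V\<close>, and the points \<open>k\<close>,
  \<open>1 / k\<close> are exactly that many. The pair \<open>s\<close>, \<open>t * s\<close>
  supplies the missing point because it degenerates both sides. In the subset sum, the factor
  \<open>x - s\<close> kills every \<open>T\<close> containing \<open>s\<close>, and the cross
  factor of \<open>t * s\<close> against \<open>s\<close> kills every \<open>T\<close> containing
  \<open>t * s\<close> alone. On the Pfaffian side, the entry numerator at \<open>x = s\<close> is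
  divisible by \<open>1 - s * y\<close>, so \<open>hfac\<close> is constant along the row of
  \<open>s\<close>; a Pluecker relation between Pfaffian minors then reduces the removal of the pair
  to a polynomial identity for four points. Afterwards \<open>s\<close> and \<open>t * s\<close> are
  exchanged for the two missing variables, with one polynomial argument for each. In (2) every step
  of the recursion shifts the parameters, so one bound has to serve all contracting parameter
  sequences at once. The danger is a large \<open>s i\<close>: the multiplicity weights grow
  quadratically in it for each pair of equal parts, and the denominators of the row weights must
  make up for this.\<close>

lemma sum_permutations_of_set_Cons:
  assumes "finite A" "A \<noteq> {}"
  shows "(\<Sum>xs\<in>permutations_of_set A. g xs)
       = (\<Sum>x\<in>A. \<Sum>xs\<in>permutations_of_set (A - {x}). g (x # xs))"
proof -
  have "(\<Sum>xs\<in>permutations_of_set A. g xs)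
      = (\<Sum>x\<in>A. \<Sum>xs\<in>(#) x ` permutations_of_set (A - {x}). g xs)"
    unfolding permutations_of_set_nonempty[OF assms(2)]
    by (rule sum.UNION_disjoint) (use assms in auto)
  also have "\<dots> = (\<Sum>x\<in>A. \<Sum>xs\<in>permutations_of_set (A - {x}). g (x # xs))"
    by (rule sum.cong[OF refl]) (simp add: sum.reindex)
  finally show ?thesis .
qed

text \<open>Cutting an ordering after position \<open>k\<close> amounts to choosing the set
  \<open>T\<close> of its first \<open>k\<close> elements and ordering both halves. The cut will
  separate the variables in nonzero rows from those in zero rows.\<close>

lemma sum_permutations_of_set_split:
  assumes "finite U" "k \<le> card U"
  shows "(\<Sum>xs\<in>permutations_of_set U. g (take k xs) (drop k xs))
       = (\<Sum>T | T \<subseteq> U \<and> card T = k.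
            \<Sum>ys\<in>permutations_of_set T. \<Sum>zs\<in>permutations_of_set (U - T). g ys zs)"
proof -
  have "(\<Sum>T | T \<subseteq> U \<and> card T = k.
            \<Sum>ys\<in>permutations_of_set T. \<Sum>zs\<in>permutations_of_set (U - T). g ys zs)
      = (\<Sum>(T, ys, zs)\<in>(SIGMA T:{T. T \<subseteq> U \<and> card T = k}.
            permutations_of_set T \<times> permutations_of_set (U - T)). g ys zs)"
    using assms(1) by (simp add: sum.cartesian_product sum.Sigma case_prod_unfold)
  also have "\<dots> = (\<Sum>xs\<in>permutations_of_set U. g (take k xs) (drop k xs))"
  proof (rule sum.reindex_bij_witness
          [where j = "\<lambda>(T, ys, zs). ys @ zs" and i = "\<lambda>xs. (set (take k xs), take k xs, drop k xs)"])
    fix a assume "a \<in> (SIGMA T:{T. T \<subseteq> U \<and> card T = k}. permutations_of_set T \<times> permutations_of_set (U - T))"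
    then obtain T ys zs where a: "a = (T, ys, zs)" "T \<subseteq> U" "card T = k"
        "ys \<in> permutations_of_set T" "zs \<in> permutations_of_set (U - T)" by auto
    have ys: "set ys = T" "length ys = k" "distinct ys" "set zs = U - T" "distinct zs"
      using a by (auto simp: permutations_of_set_def distinct_card)
    show "(\<lambda>xs. (set (take k xs), take k xs, drop k xs)) ((\<lambda>(T, ys, zs). ys @ zs) a) = a"
      using ys by (simp add: a)
    show "(\<lambda>(T, ys, zs). ys @ zs) a \<in> permutations_of_set U"
      using ys Un_absorb1[OF a(2)] Diff_disjoint[of T U] by (simp add: a permutations_of_set_def)
    show "g (take k ((\<lambda>(T, ys, zs). ys @ zs) a)) (drop k ((\<lambda>(T, ys, zs). ys @ zs) a))
        = (case a of (T, ys, zs) \<Rightarrow> g ys zs)"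
      using ys by (simp add: a)
  next
    fix xs assume xs: "xs \<in> permutations_of_set U"
    then have *: "set (take k xs) \<union> set (drop k xs) = U" "set (take k xs) \<inter> set (drop k xs) = {}"
        "distinct xs" "length xs = card U"
      by (auto simp: permutations_of_set_def distinct_card set_take_disj_set_drop_if_distinct simp flip: set_append)
    show "(\<lambda>(T, ys, zs). ys @ zs) ((\<lambda>xs. (set (take k xs), take k xs, drop k xs)) xs) = xs"
      by simp
    have "card (set (take k xs)) = k"
      using * assms(2) by (simp add: distinct_card)
    with * show "(\<lambda>xs. (set (take k xs), take k xs, drop k xs)) xs
        \<in> (SIGMA T:{T. T \<subseteq> U \<and> card T = k}. permutations_of_set T \<times> permutations_of_set (U - T))"
      by (auto simp: permutations_of_set_def)
  qed
  finally show ?thesis by simp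
qed

lemma sum_off_diagonal_swap:
  assumes "finite V"
  shows "(\<Sum>y\<in>V. \<Sum>w\<in>V - {y}. f y w) = (\<Sum>w\<in>V. \<Sum>y\<in>V - {w}. f y w)"
proof -
  have *: "(\<Sum>w\<in>V - {y}. g w) = (\<Sum>w\<in>V. if w = y then 0 else g w)" for y g
    using assms by (simp add: sum.If_cases Diff_eq Collect_neg_eq)
  show ?thesis
    unfolding * by (subst sum.swap) (intro sum.cong refl, auto)
qed

section \<open>Products over ordered pairs and the sign of a permutation\<close>

primrec pairprod :: "('a \<Rightarrow> 'a \<Rightarrow> 'b::comm_monoid_mult) \<Rightarrow> 'a list \<Rightarrow> 'b" where
  "pairprod f [] = 1"
| "pairprod f (x # xs) = (\<Prod>y\<leftarrow>xs. f x y) * pairprod f xs"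

lemma pairprod_append:
  "pairprod f (xs @ ys) = pairprod f xs * pairprod f ys * (\<Prod>x\<leftarrow>xs. \<Prod>y\<leftarrow>ys. f x y)"
  by (induction xs) (simp_all add: mult_ac)

lemma pairprod_map_upt:
  "pairprod f (map v [0..<N]) = (\<Prod>j<N. \<Prod>i<j. f (v i) (v j))"
proof (induction N)
  case (Suc N)
  have "(\<Prod>x\<leftarrow>map v [0..<N]. f x (v N)) = (\<Prod>i<N. f (v i) (v N))"
    by (simp add: prod.list_conv_set_nth atLeast0LessThan flip: prod.distinct_set_conv_list)
  with Suc show ?case by (simp add: pairprod_append mult_ac)
qed simp

text \<open>The sign in the form in which it arises when the variables of an antisymmetric double
  product are permuted; \<open>inversion_sign_eq_sign\<close> identifies it with
  \<open>sign\<close>.\<close>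

definition inversion_sign :: "nat \<Rightarrow> (nat \<Rightarrow> nat) \<Rightarrow> 'b::comm_ring_1" where
  "inversion_sign N \<sigma> = (\<Prod>(i, j) | i < j \<and> j < N. if \<sigma> i < \<sigma> j then 1 else - 1)"

lemma prod_pairs:
  "(\<Prod>j<N. \<Prod>i<j. g i j) = (\<Prod>(i, j) | i < j \<and> j < (N::nat). g i j)"
proof -
  have "(\<Prod>j<N. \<Prod>i<j. g i j) = (\<Prod>(j, i)\<in>(SIGMA j:{..<N}. {..<j}). g i j)"
    by (simp add: prod.Sigma)
  also have "\<dots> = (\<Prod>(i, j) | i < j \<and> j < N. g i j)"
    by (rule prod.reindex_bij_witness[where i = prod.swap and j = prod.swap]) auto
  finally show ?thesis .
qed

lemma finite_pairs: "finite {(i, j). i < j \<and> j < (N::nat)}"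
  by (rule finite_subset[of _ "{..<N} \<times> {..<N}"]) auto

text \<open>Sorting each image pair by \<open>min\<close> and \<open>max\<close> permutes the index
  pairs, and every inversion costs one change of sign.\<close>

lemma prod_antisymmetric_permute:
  fixes f :: "nat \<Rightarrow> nat \<Rightarrow> 'b::comm_ring_1"
  assumes "\<sigma> permutes {..<N}" and anti: "\<And>i j. f i j = - f j i"
  shows "(\<Prod>j<N. \<Prod>i<j. f (\<sigma> i) (\<sigma> j)) = inversion_sign N \<sigma> * (\<Prod>j<N. \<Prod>i<j. f i j)"
proof -
  let ?P = "{(i, j). i < j \<and> j < N}"
  have inj: "\<sigma> i = \<sigma> j \<longleftrightarrow> i = j" for i j
    using permutes_inj[OF assms(1)] by (auto simp: inj_def)
  have lt: "\<sigma> i < N \<longleftrightarrow> i < N" for i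
    using permutes_in_image[OF assms(1)] by auto
  let ?s = "\<lambda>(i, j). (min (\<sigma> i) (\<sigma> j), max (\<sigma> i) (\<sigma> j))"
  have bij: "bij_betw ?s ?P ?P"
  proof -
    have "inj_on ?s ?P"
      by (auto simp: inj_on_def inj min_def max_def split: if_splits)
    moreover have "?s ` ?P \<subseteq> ?P"
    proof clarify
      fix i j assume "i < j" "j < N"
      moreover from this have "\<sigma> i \<noteq> \<sigma> j" "\<sigma> i < N" "\<sigma> j < N" by (simp_all add: inj lt)
      ultimately show "min (\<sigma> i) (\<sigma> j) < max (\<sigma> i) (\<sigma> j) \<and> max (\<sigma> i) (\<sigma> j) < N"
        by (simp add: min_def max_def)
    qed
    ultimately show ?thesis
      by (simp add: bij_betw_def endo_inj_surj[OF finite_pairs])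
  qed
  have "(\<Prod>j<N. \<Prod>i<j. f (\<sigma> i) (\<sigma> j)) = (\<Prod>(i, j)\<in>?P. f (\<sigma> i) (\<sigma> j))"
    by (rule prod_pairs)
  also have "\<dots> = (\<Prod>x\<in>?P. (case x of (i, j) \<Rightarrow> if \<sigma> i < \<sigma> j then 1 else - 1)
       * (case ?s x of (i, j) \<Rightarrow> f i j))"
    by (intro prod.cong refl)
      (clarsimp simp: min_def max_def inj split: if_splits, metis anti inj less_irrefl)
  also have "\<dots> = inversion_sign N \<sigma> * (\<Prod>x\<in>?P. case ?s x of (i, j) \<Rightarrow> f i j)"
    by (simp add: prod.distrib inversion_sign_def)
  also have "(\<Prod>x\<in>?P. case ?s x of (i, j) \<Rightarrow> f i j) = (\<Prod>(i, j)\<in>?P. f i j)"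
    by (rule prod.reindex_bij_betw[OF bij])
  finally show ?thesis by (simp add: prod_pairs)
qed

text \<open>\<open>inversion_sign\<close> is itself an antisymmetric double product, that of
  \<open>e\<close>, so the transformation rule just proved applies to it and yields
  multiplicativity.\<close>

lemma inversion_sign_compose:
  assumes "\<sigma> permutes {..<N}" "\<tau> permutes {..<N}"
  shows "inversion_sign N (\<sigma> \<circ> \<tau>) = (inversion_sign N \<sigma> * inversion_sign N \<tau> :: 'b::comm_ring_1)"
proof -
  define e where "e = (\<lambda>i j::nat. if i < j then 1 else if j < i then - 1 else (0::'b))"
  have anti: "e i j = - e j i" for i j by (simp add: e_def)
  have eq: "inversion_sign N \<rho> = (\<Prod>j<N. \<Prod>i<j. e (\<rho> i) (\<rho> j))" if "\<rho> permutes {..<N}" for \<rho>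
  proof -
    have "(\<Prod>j<N. \<Prod>i<j. e i j) = 1" by (intro prod.neutral ballI) (simp add: e_def)
    then show ?thesis
      using prod_antisymmetric_permute[of \<rho> N e, OF that anti] by simp
  qed
  have "inversion_sign N (\<sigma> \<circ> \<tau>) = (\<Prod>j<N. \<Prod>i<j. e (\<sigma> (\<tau> i)) (\<sigma> (\<tau> j)))"
    by (simp add: eq permutes_compose assms)
  also have "\<dots> = inversion_sign N \<tau> * (\<Prod>j<N. \<Prod>i<j. e (\<sigma> i) (\<sigma> j))"
    by (rule prod_antisymmetric_permute[OF assms(2), of "\<lambda>i j. e (\<sigma> i) (\<sigma> j)"]) (rule anti)
  finally show ?thesis by (simp add: eq[OF assms(1)] mult.commute)
qed

lemma inversion_sign_transpose:
  assumes "a < b" "b < N"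
  shows "inversion_sign N (Transposition.transpose a b) = (- 1 :: 'b::comm_ring_1)"
proof -
  let ?P = "{(i, j). i < j \<and> j < N}"
  let ?K = "{a<..<b}"
  \<comment> \<open>The inversions of the transposition are \<open>(a, b)\<close> and, for each
    \<open>k\<close> strictly between, \<open>(a, k)\<close> and \<open>(k, b)\<close>: an odd
    number.\<close>
  have eq: "?P \<inter> {x. \<not> (case x of (i, j) \<Rightarrow> Transposition.transpose a b i < Transposition.transpose a b j)}
      = insert (a, b) (Pair a ` ?K \<union> (\<lambda>k. (k, b)) ` ?K)"
    (is "_ = ?R")
  proof (rule set_eqI, clarify)
    fix i j
    consider "i = a" "j = b" | "i = a" "j \<noteq> b" | "i \<noteq> a" "i \<noteq> b" "j = b" | "i = b" | "i \<noteq> a" "i \<noteq> b" "j = a"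
      | "i \<noteq> a" "i \<noteq> b" "j \<noteq> a" "j \<noteq> b" by blast
    then show "(i, j) \<in> ?P \<inter> {x. \<not> (case x of (i, j) \<Rightarrow> Transposition.transpose a b i < Transposition.transpose a b j)}
        \<longleftrightarrow> (i, j) \<in> ?R"
      using assms by cases (auto simp: Transposition.transpose_def)
  qed
  have c: "card (insert (a, b) (Pair a ` ?K \<union> (\<lambda>k. (k, b)) ` ?K)) = Suc (2 * card ?K)"
    by (subst card_insert_disjoint, simp, force)
      (subst card_Un_disjoint, auto simp: card_image inj_on_def)
  have "inversion_sign N (Transposition.transpose a b)
      = (\<Prod>x\<in>?P. if (case x of (i, j) \<Rightarrow> Transposition.transpose a b i < Transposition.transpose a b j) then 1 else - 1 :: 'b)"
    unfolding inversion_sign_def by (intro prod.cong) auto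
  also have "\<dots> = (- 1) ^ card (?P \<inter> {x. \<not> (case x of (i, j) \<Rightarrow> Transposition.transpose a b i < Transposition.transpose a b j)})"
    by (subst prod.If_cases[OF finite_pairs]) (simp add: Collect_neg_eq)
  finally show ?thesis unfolding eq c by simp
qed

lemma inversion_sign_eq_sign:
  assumes "\<sigma> permutes {..<N}"
  shows "inversion_sign N \<sigma> = (of_int (sign \<sigma>) :: 'b::comm_ring_1)"
  using assms finite_lessThan[of N]
proof (induction rule: permutes_induct)
  case id
  have "inversion_sign N id = (1::'b)"
    unfolding inversion_sign_def by (intro prod.neutral) auto
  then show ?case by (simp add: id_def)
next
  case (swap a b p)
  have "inversion_sign N (Transposition.transpose a b) = (- 1 :: 'b)"
    using swap inversion_sign_transpose[of a b N] inversion_sign_transpose[of b a N]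
    by (cases a b rule: linorder_cases) (auto simp: Transposition.transpose_commute)
  then have "inversion_sign N (Transposition.transpose a b \<circ> p) = - (of_int (sign p) :: 'b)"
    using swap by (subst inversion_sign_compose) (auto intro: permutes_swap_id)
  moreover have "sign (Transposition.transpose a b \<circ> p) = - sign p"
    using swap by (subst sign_compose)
      (auto simp: sign_swap_id permutation_swap_id intro: permutation_permutes[THEN iffD2])
  ultimately show ?case by (metis of_int_minus)
qed

lemma bij_betw_permutations_of_set:
  assumes "inj_on u {..<N}"
  shows "bij_betw (\<lambda>\<sigma>. map (u \<circ> \<sigma>) [0..<N]) {\<sigma>. \<sigma> permutes {..<N}}
           (permutations_of_set (u ` {..<N}))"
proof (rule bij_betw_imageI)
  let ?f = "\<lambda>\<sigma>. map (u \<circ> \<sigma>) [0..<N]"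
  show inj: "inj_on ?f {\<sigma>. \<sigma> permutes {..<N}}"
  proof (rule inj_onI, rule ext)
    fix \<sigma> \<tau> i
    assume *: "\<sigma> \<in> {\<sigma>. \<sigma> permutes {..<N}}" "\<tau> \<in> {\<sigma>. \<sigma> permutes {..<N}}" "?f \<sigma> = ?f \<tau>"
    show "\<sigma> i = \<tau> i"
    proof (cases "i < N")
      case True
      then have "u (\<sigma> i) = u (\<tau> i)" using *(3) by (auto simp: map_eq_conv)
      moreover have "\<sigma> i < N" "\<tau> i < N"
        using * True permutes_in_image[of \<sigma> "{..<N}" i] permutes_in_image[of \<tau> "{..<N}" i] by auto
      ultimately show ?thesis using assms by (auto dest: inj_onD)
    next
      case False
      then show ?thesis using * by (simp add: permutes_not_in)
    qed
  qed
  have sub: "?f ` {\<sigma>. \<sigma> permutes {..<N}} \<subseteq> permutations_of_set (u ` {..<N})"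
  proof (rule image_subsetI)
    fix \<sigma> assume "\<sigma> \<in> {\<sigma>. \<sigma> permutes {..<N}}"
    then have s: "\<sigma> permutes {..<N}" by simp
    have "set (?f \<sigma>) = u ` {..<N}"
      using permutes_image[OF s] by (metis atLeast_upt image_comp list.set_map)
    moreover have "inj_on (u \<circ> \<sigma>) {0..<N}"
      using assms permutes_inj[OF s] permutes_image[OF s]
      by (intro comp_inj_on) (auto simp: lessThan_atLeast0 intro: inj_on_subset)
    ultimately show "?f \<sigma> \<in> permutations_of_set (u ` {..<N})"
      by (simp add: permutations_of_set_def distinct_map)
  qed
  show "?f ` {\<sigma>. \<sigma> permutes {..<N}} = permutations_of_set (u ` {..<N})"
  proof (rule card_subset_eq[OF _ sub])
    show "card (?f ` {\<sigma>. \<sigma> permutes {..<N}}) = card (permutations_of_set (u ` {..<N}))"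
      by (simp add: card_image inj assms card_permutations[of "{..<N}" N])
  qed simp
qed

section \<open>Sums over perfect matchings\<close>

text \<open>Consecutive entries are matched, and \<open>b\<close> runs over the unmatched pairs. Two
  matched pairs are joined by four factors \<open>b\<close>, so for antisymmetric \<open>b\<close>
  and symmetric \<open>h\<close> the weight depends on the matching alone and no signs have to be
  tracked. The value 0 on singletons makes odd lists weightless.\<close>

fun match_weight ::
    "('a \<Rightarrow> 'a \<Rightarrow> 'b::field_char_0) \<Rightarrow> ('a \<Rightarrow> 'a \<Rightarrow> 'b) \<Rightarrow> 'a list \<Rightarrow> 'b" where
  "match_weight h b [] = 1"
| "match_weight h b [x] = 0"
| "match_weight h b (x # y # zs) = h x y * (\<Prod>z\<leftarrow>zs. b x z * b y z) * match_weight h b zs"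

text \<open>
  Each matching of \<open>2n\<close> elements arises from \<open>2\<^sup>n n!\<close> orderings.
\<close>

definition matchsum ::
    "('a \<Rightarrow> 'a \<Rightarrow> 'b::field_char_0) \<Rightarrow> ('a \<Rightarrow> 'a \<Rightarrow> 'b) \<Rightarrow> 'a set \<Rightarrow> 'b" where
  "matchsum h b U = (\<Sum>xs\<in>permutations_of_set U. match_weight h b xs)
     / (2 ^ (card U div 2) * fact (card U div 2))"

lemma match_weight_odd: "odd (length xs) \<Longrightarrow> match_weight h b xs = 0"
  by (induction h b xs rule: match_weight.induct) auto

lemma matchsum_odd: "odd (card U) \<Longrightarrow> matchsum h b U = 0"
  by (auto simp: matchsum_def match_weight_odd length_finite_permutations_of_set intro!: sum.neutral)

lemma matchsum_empty [simp]: "matchsum h b {} = 1"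
  by (simp add: matchsum_def)

text \<open>The counterpart of expanding a Pfaffian along row \<open>x\<close>, with the signs
  absorbed into \<open>b\<close>.\<close>

definition match_expansion ::
    "('a \<Rightarrow> 'a \<Rightarrow> 'b::field_char_0) \<Rightarrow> ('a \<Rightarrow> 'a \<Rightarrow> 'b) \<Rightarrow> 'a \<Rightarrow> 'a set \<Rightarrow> 'b" where
  "match_expansion h b x V =
     (\<Sum>y\<in>V. h x y * (\<Prod>z\<in>V - {y}. b x z * b y z) * matchsum h b (V - {y}))"

text \<open>Group the orderings by their first two elements. With
  \<open>card U = 2 * (n + 1)\<close>, each first element \<open>x\<close> contributes
  \<open>2 ^ n * fact n\<close> copies of its expansion, and the normalisation exceeds this number
  by the factor \<open>2 * (n + 1)\<close>.\<close>

lemma matchsum_average: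
  assumes "finite U" "U \<noteq> {}"
  shows "of_nat (card U) * matchsum h b U = (\<Sum>x\<in>U. match_expansion h b x (U - {x}))"
proof (cases "even (card U)")
  case False
  have "match_expansion h b x (U - {x}) = 0" if "x \<in> U" for x
    unfolding match_expansion_def
  proof (intro sum.neutral ballI)
    fix y assume y: "y \<in> U - {x}"
    have "card U = Suc (Suc (card (U - {x} - {y})))"
      using assms that y by (metis card_Suc_Diff1 finite_Diff)
    then have "odd (card (U - {x} - {y}))" using False by simp
    then show "h x y * (\<Prod>z\<in>U - {x} - {y}. b x z * b y z) * matchsum h b (U - {x} - {y}) = 0"
      by (simp add: matchsum_odd)
  qed
  with False show ?thesis by (simp add: matchsum_odd)
next
  case True
  define n where "n = card U div 2 - 1"
  have "card U > 0" using assms by (simp add: card_gt_0_iff)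
  with True have n: "card U = 2 * Suc n"
    unfolding n_def by (auto elim!: evenE)
  have "(\<Sum>xs\<in>permutations_of_set U. match_weight h b xs)
      = (\<Sum>x\<in>U. \<Sum>xs\<in>permutations_of_set (U - {x}). match_weight h b (x # xs))"
    by (rule sum_permutations_of_set_Cons[OF assms])
  also have "\<dots> = (\<Sum>x\<in>U. 2 ^ n * fact n * match_expansion h b x (U - {x}))"
  proof (rule sum.cong[OF refl])
    fix x assume x: "x \<in> U"
    let ?V = "U - {x}"
    have cV: "card ?V = Suc (2 * n)" using x n assms by simp
    then have V: "finite ?V" "?V \<noteq> {}" using assms by (simp, metis card.empty nat.distinct(1))
    have "(\<Sum>xs\<in>permutations_of_set ?V. match_weight h b (x # xs))
        = (\<Sum>y\<in>?V. \<Sum>xs\<in>permutations_of_set (?V - {y}). match_weight h b (x # y # xs))"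
      by (rule sum_permutations_of_set_Cons[OF V])
    also have "\<dots> = (\<Sum>y\<in>?V. \<Sum>xs\<in>permutations_of_set (?V - {y}).
        h x y * (\<Prod>z\<in>?V - {y}. b x z * b y z) * match_weight h b xs)"
      by (intro sum.cong refl) (auto simp: permutations_of_set_def prod.distinct_set_conv_list[symmetric])
    also have "\<dots> = (\<Sum>y\<in>?V. 2 ^ n * fact n
        * (h x y * (\<Prod>z\<in>?V - {y}. b x z * b y z) * matchsum h b (?V - {y})))"
      using V cV by (intro sum.cong refl) (simp add: matchsum_def card_Diff_singleton flip: sum_distrib_left)
    finally show "(\<Sum>xs\<in>permutations_of_set ?V. match_weight h b (x # xs))
        = 2 ^ n * fact n * match_expansion h b x ?V"
      by (simp add: match_expansion_def sum_distrib_left)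
  qed
  finally have eq: "(\<Sum>xs\<in>permutations_of_set U. match_weight h b xs)
      = 2 ^ n * fact n * (\<Sum>x\<in>U. match_expansion h b x (U - {x}))"
    by (simp add: sum_distrib_left)
  have cancel: "(2 * a) * (P * X / (2 * P * (a * F))) = P * X / (P * F)" if "a \<noteq> 0" for a P X F :: 'b
    using that by (cases "P = 0"; cases "F = 0") (auto simp: field_simps)
  have nz: "(1 + of_nat n :: 'b) \<noteq> 0" by (metis of_nat_Suc of_nat_neq_0)
  have "of_nat (card U) * matchsum h b U = (2 * (1 + of_nat n))
      * (2 ^ n * (fact n * (\<Sum>x\<in>U. match_expansion h b x (U - {x})))
         / (2 * 2 ^ n * ((1 + of_nat n) * fact n)))"
    unfolding matchsum_def eq n by (simp add: mult.assoc)
  with cancel[OF nz, of "2 ^ n" "fact n * (\<Sum>x\<in>U. match_expansion h b x (U - {x}))" "fact n"]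
  show ?thesis by simp
qed

lemma sum_off_diagonal_antisymmetric:
  fixes f :: "'a \<Rightarrow> 'a \<Rightarrow> 'b::field_char_0"
  assumes "finite V" and anti: "\<And>y w. y \<in> V \<Longrightarrow> w \<in> V \<Longrightarrow> f y w = - f w y"
  shows "(\<Sum>y\<in>V. \<Sum>w\<in>V - {y}. f y w) = 0"
proof -
  have "(\<Sum>y\<in>V. \<Sum>w\<in>V - {y}. f y w) = (\<Sum>y\<in>V. \<Sum>w\<in>V - {y}. - f w y)"
    by (intro sum.cong refl anti) auto
  also have "\<dots> = - (\<Sum>y\<in>V. \<Sum>w\<in>V - {y}. f y w)"
    by (simp add: sum_negf sum_off_diagonal_swap[OF assms(1), of f])
  finally show ?thesis by simp
qed

section \<open>Row expansion of matching sums\<close>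

locale matching =
  fixes h b :: "'a \<Rightarrow> 'a \<Rightarrow> 'b::field_char_0"
  assumes h_sym: "h x y = h y x" and b_anti: "b x y = - b y x"
begin

text \<open>Expanding along \<open>x\<close>, and then along \<open>z\<close> wherever
  \<open>z\<close> is not the partner of \<open>x\<close>, gives a form that is visibly symmetric
  under exchanging \<open>x\<close> with \<open>z\<close> and \<open>y\<close> with
  \<open>w\<close>.\<close>

lemma match_expansion_pair:
  assumes "finite U" "x \<in> U" "z \<in> U" "x \<noteq> z"
    and IH: "\<And>y. y \<in> U - {x, z} \<Longrightarrow> matchsum h b (U - {x, y}) = match_expansion h b z (U - {x, y, z})"
  shows "match_expansion h b x (U - {x}) =
     h x z * (\<Prod>k\<in>U - {x, z}. b x k * b z k) * matchsum h b (U - {x, z}) +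
     (\<Sum>y\<in>U - {x, z}. \<Sum>w\<in>U - {x, z} - {y}. h x y * h z w * (b x z * b x w * b y z * b y w)
        * (\<Prod>k\<in>U - {x, y, z, w}. b x k * b y k * b z k * b w k) * matchsum h b (U - {x, y, z, w}))"
proof -
  let ?t = "\<lambda>y. h x y * (\<Prod>k\<in>U - {x} - {y}. b x k * b y k) * matchsum h b (U - {x} - {y})"
  have "match_expansion h b x (U - {x}) = ?t z + (\<Sum>y\<in>U - {x} - {z}. ?t y)"
    unfolding match_expansion_def by (rule sum.remove) (use assms in auto)
  also have "?t z = h x z * (\<Prod>k\<in>U - {x, z}. b x k * b z k) * matchsum h b (U - {x, z})"
    by (simp add: Diff_insert2[symmetric] insert_commute)
  also have "(\<Sum>y\<in>U - {x} - {z}. ?t y) = (\<Sum>y\<in>U - {x, z}. \<Sum>w\<in>U - {x, z} - {y}.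
       h x y * h z w * (b x z * b x w * b y z * b y w)
        * (\<Prod>k\<in>U - {x, y, z, w}. b x k * b y k * b z k * b w k) * matchsum h b (U - {x, y, z, w}))"
  proof (rule sum.cong)
    fix y assume y: "y \<in> U - {x, z}"
    have *: "U - {x} - {y} = insert z (U - {x, y, z})" using y assms by auto
    have **: "U - {x} - {y} = U - {x, y}" by auto
    have "(\<Prod>k\<in>U - {x} - {y}. b x k * b y k) = (b x z * b y z) * (\<Prod>k\<in>U - {x, y, z}. b x k * b y k)"
      unfolding * using assms(1) by (subst prod.insert) auto
    then have "?t y = h x y * (b x z * b y z) * (\<Prod>k\<in>U - {x, y, z}. b x k * b y k)
        * match_expansion h b z (U - {x, y, z})"
      unfolding ** IH[OF y, symmetric] by (simp add: mult_ac)
    also have "\<dots> = (\<Sum>w\<in>U - {x, y, z}. h x y * (b x z * b y z) * (\<Prod>k\<in>U - {x, y, z}. b x k * b y k)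
        * (h z w * (\<Prod>k\<in>U - {x, y, z} - {w}. b z k * b w k) * matchsum h b (U - {x, y, z} - {w})))"
      by (simp add: match_expansion_def sum_distrib_left)
    also have "\<dots> = (\<Sum>w\<in>U - {x, z} - {y}. h x y * h z w * (b x z * b x w * b y z * b y w)
        * (\<Prod>k\<in>U - {x, y, z, w}. b x k * b y k * b z k * b w k) * matchsum h b (U - {x, y, z, w}))"
    proof (rule sum.cong)
      fix w assume w: "w \<in> U - {x, z} - {y}"
      have 1: "U - {x, y, z} - {w} = U - {x, y, z, w}" by auto
      have 2: "U - {x, y, z} = insert w (U - {x, y, z, w})" using w by auto
      have "(\<Prod>k\<in>U - {x, y, z}. b x k * b y k) = b x w * b y w * (\<Prod>k\<in>U - {x, y, z, w}. b x k * b y k)"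
        unfolding 2 using assms(1) by (subst prod.insert) auto
      then show "h x y * (b x z * b y z) * (\<Prod>k\<in>U - {x, y, z}. b x k * b y k)
          * (h z w * (\<Prod>k\<in>U - {x, y, z} - {w}. b z k * b w k) * matchsum h b (U - {x, y, z} - {w}))
        = h x y * h z w * (b x z * b x w * b y z * b y w)
        * (\<Prod>k\<in>U - {x, y, z, w}. b x k * b y k * b z k * b w k) * matchsum h b (U - {x, y, z, w})"
        unfolding 1 by (simp add: prod.distrib mult_ac)
    qed auto
    finally show "?t y = (\<Sum>w\<in>U - {x, z} - {y}. h x y * h z w * (b x z * b x w * b y z * b y w)
        * (\<Prod>k\<in>U - {x, y, z, w}. b x k * b y k * b z k * b w k) * matchsum h b (U - {x, y, z, w}))" .
  qed auto
  finally show ?thesis .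
qed

text \<open>By the symmetric form in \<open>match_expansion_pair\<close>, the expansions along any
  two elements agree; their average is the matching sum, so each of them equals it.\<close>

lemma matchsum_expand:
  assumes "finite V" "x \<notin> V"
  shows "matchsum h b (insert x V) = match_expansion h b x V"
proof -
  have "matchsum h b U = match_expansion h b x (U - {x})" if "finite U" "x \<in> U" for U x
    using that
  proof (induction "card U" arbitrary: U x rule: less_induct)
    case (less U x)
    have eq: "match_expansion h b x (U - {x}) = match_expansion h b z (U - {z})" if z: "z \<in> U" "z \<noteq> x" for z
    proof -
      have IH: "matchsum h b (U - {p, y}) = match_expansion h b q (U - {p, y, q})"
        if "p \<in> U" "q \<in> U" "p \<noteq> q" "y \<in> U - {p, q}" for p q y
      proof -
        have "card (U - {p, y}) < card U" using less.prems that by (intro psubset_card_mono) auto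
        then have "matchsum h b (U - {p, y}) = match_expansion h b q (U - {p, y} - {q})"
          by (intro less.hyps) (use less.prems that in auto)
        also have "U - {p, y} - {q} = U - {p, y, q}" by auto
        finally show ?thesis .
      qed
      let ?G = "\<lambda>x z y w. h x y * h z w * (b x z * b x w * b y z * b y w)
        * (\<Prod>k\<in>U - {x, y, z, w}. b x k * b y k * b z k * b w k) * matchsum h b (U - {x, y, z, w})"
      have sym: "?G x z y w = ?G z x w y" for y w
      proof -
        have s: "{x, y, z, w} = {z, w, x, y}" by auto
        have "b x z * b x w * b y z * b y w = b z x * b z y * b w x * b w y"
          using b_anti[of x z] b_anti[of x w] b_anti[of y z] b_anti[of y w] by simp
        then show ?thesis unfolding s by (simp add: mult_ac)
      qed
      have s2: "U - {z, x} = U - {x, z}" by auto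
      have "match_expansion h b x (U - {x}) =
          h x z * (\<Prod>k\<in>U - {x, z}. b x k * b z k) * matchsum h b (U - {x, z}) +
          (\<Sum>y\<in>U - {x, z}. \<Sum>w\<in>U - {x, z} - {y}. ?G x z y w)"
        by (rule match_expansion_pair) (use less.prems z IH in auto)
      also have "(\<Sum>y\<in>U - {x, z}. \<Sum>w\<in>U - {x, z} - {y}. ?G x z y w)
          = (\<Sum>w\<in>U - {x, z}. \<Sum>y\<in>U - {x, z} - {w}. ?G x z y w)"
        by (rule sum_off_diagonal_swap) (use less.prems in auto)
      also have "\<dots> = (\<Sum>w\<in>U - {x, z}. \<Sum>y\<in>U - {x, z} - {w}. ?G z x w y)"
        by (intro sum.cong refl sym)
      also have "h x z * (\<Prod>k\<in>U - {x, z}. b x k * b z k) * matchsum h b (U - {x, z}) + \<dots>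
          = match_expansion h b z (U - {z})"
        by (subst match_expansion_pair[of U z x])
          (use less.prems z IH in \<open>auto simp: s2 h_sym[of x z] mult.commute[of "b x _"]\<close>)
      finally show ?thesis .
    qed
    have "of_nat (card U) * matchsum h b U = (\<Sum>z\<in>U. match_expansion h b z (U - {z}))"
      by (rule matchsum_average) (use less.prems in auto)
    also have "\<dots> = (\<Sum>z\<in>U. match_expansion h b x (U - {x}))"
      using eq by (intro sum.cong refl) metis
    also have "\<dots> = of_nat (card U) * match_expansion h b x (U - {x})" by simp
    finally show ?case using less.prems by (auto simp: card_eq_0_iff)
  qed
  from this[of "insert x V" x] assms show ?thesis by simp
qed

text \<open>A Pfaffian with a repeated row is zero: expanding once more along \<open>x\<close> gives
  a double sum whose summand changes sign when \<open>y\<close> and \<open>w\<close> are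
  exchanged.\<close>

lemma matchsum_vanish:
  assumes V: "finite V" "x \<notin> V"
  shows "(\<Sum>y\<in>V. h x y * (\<Prod>k\<in>V - {y}. b y k) * matchsum h b (insert x (V - {y}))) = 0"
proof -
  let ?f = "\<lambda>y w. h x y * h x w * b y w *
      (\<Prod>k\<in>V - {y, w}. b y k * b w k * b x k) * matchsum h b (V - {y, w})"
  have "(\<Sum>y\<in>V. h x y * (\<Prod>k\<in>V - {y}. b y k) * matchsum h b (insert x (V - {y})))
      = (\<Sum>y\<in>V. \<Sum>w\<in>V - {y}. ?f y w)"
  proof (rule sum.cong[OF refl])
    fix y assume y: "y \<in> V"
    have "h x y * (\<Prod>k\<in>V - {y}. b y k)
        * (h x w * (\<Prod>k\<in>V - {y} - {w}. b x k * b w k) * matchsum h b (V - {y} - {w})) = ?f y w"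
      if w: "w \<in> V - {y}" for w
    proof -
      have "V - {y} - {w} = V - {y, w}" by auto
      moreover have "(\<Prod>k\<in>V - {y}. b y k) = b y w * (\<Prod>k\<in>V - {y} - {w}. b y k)"
        by (rule prod.remove) (use V w in auto)
      ultimately show ?thesis by (simp add: prod.distrib mult_ac)
    qed
    moreover have "matchsum h b (insert x (V - {y})) = match_expansion h b x (V - {y})"
      by (rule matchsum_expand) (use V in auto)
    ultimately show "h x y * (\<Prod>k\<in>V - {y}. b y k) * matchsum h b (insert x (V - {y}))
        = (\<Sum>w\<in>V - {y}. ?f y w)"
      unfolding match_expansion_def by (simp only: sum_distrib_left) (rule sum.cong[OF refl])
  qed
  also have "\<dots> = 0"
  proof (rule sum_off_diagonal_antisymmetric[OF V(1)])
    fix y w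
    have "V - {y, w} = V - {w, y}" by auto
    moreover have "b y k * b w k * b x k = b w k * b y k * b x k" for k by simp
    ultimately show "?f y w = - ?f w y"
      by (subst b_anti[of y w]) (simp only: mult_minus_right mult_minus_left mult_ac)
  qed
  finally show ?thesis .
qed

text \<open>
  The relations below are those of Pfaffian minors for the antisymmetric matrix \<open>h / b\<close>:
  \<open>matchsum h b U\<close> is the Pfaffian minor indexed by \<open>U\<close> times the product of \<open>b\<close> over all pairs.
\<close>

definition row_sum :: "'a \<Rightarrow> 'a set \<Rightarrow> 'b" where
  "row_sum i J = (\<Sum>j\<in>J. h i j / b i j * (\<Prod>k\<in>J - {j}. b j k) * matchsum h b (J - {j}))"

text \<open>Since division by zero gives zero, the matrix \<open>h / b\<close> thereby has zero
  diagonal, and \<open>row_sum i J\<close> can be formed for \<open>i\<close> inside or outside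
  \<open>J\<close> alike.\<close>

lemma b_diag [simp]: "b x x = 0"
  using b_anti[of x x] by (simp add: eq_neg_iff_add_eq_0 flip: mult_2)

text \<open>Row \<open>i\<close> is repeated here: each quotient \<open>h i j / b i j\<close> meets
  a factor \<open>b j i = - b i j\<close>, and what remains is the sum in
  \<open>matchsum_vanish\<close>.\<close>

lemma row_sum_mem:
  assumes J: "finite J" "i \<in> J" and nz: "\<And>j. j \<in> J \<Longrightarrow> j \<noteq> i \<Longrightarrow> b i j \<noteq> 0"
  shows "row_sum i J = 0"
proof -
  define V where "V = J - {i}"
  have V: "finite V" "i \<notin> V" "J = insert i V" using J by (auto simp: V_def)
  have "row_sum i J = (\<Sum>j\<in>V. h i j / b i j * (\<Prod>k\<in>J - {j}. b j k) * matchsum h b (J - {j}))"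
    unfolding row_sum_def V(3) using V by simp
  also have "\<dots> = (\<Sum>j\<in>V. - (h i j * (\<Prod>k\<in>V - {j}. b j k) * matchsum h b (insert i (V - {j}))))"
  proof (rule sum.cong[OF refl])
    fix j assume j: "j \<in> V"
    then have "J - {j} = insert i (V - {j})" using V by auto
    moreover have "b i j \<noteq> 0" using j nz V by auto
    ultimately show "h i j / b i j * (\<Prod>k\<in>J - {j}. b j k) * matchsum h b (J - {j})
        = - (h i j * (\<Prod>k\<in>V - {j}. b j k) * matchsum h b (insert i (V - {j})))"
      using V b_anti[of j i] by simp
  qed
  also have "\<dots> = 0" using matchsum_vanish[OF V(1,2)] by (simp add: sum_negf)
  finally show ?thesis .
qed

lemma row_sum_notin:
  assumes J: "finite J" "i \<notin> J" and nz: "\<And>j. j \<in> J \<Longrightarrow> b i j \<noteq> 0"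
  shows "(\<Prod>k\<in>J. b i k) * row_sum i J = matchsum h b (insert i J)"
  unfolding row_sum_def matchsum_expand[OF J] match_expansion_def sum_distrib_left
proof (rule sum.cong[OF refl])
  fix j assume j: "j \<in> J"
  have "(\<Prod>k\<in>J. b i k) = b i j * (\<Prod>k\<in>J - {j}. b i k)"
    by (rule prod.remove[OF J(1) j])
  then show "(\<Prod>k\<in>J. b i k) * (h i j / b i j * (\<Prod>k\<in>J - {j}. b j k) * matchsum h b (J - {j}))
      = h i j * (\<Prod>z\<in>J - {j}. b i z * b j z) * matchsum h b (J - {j})"
    using nz[OF j] by (simp add: prod.distrib)
qed

text \<open>One double sum over \<open>I\<close> and \<open>J\<close> is evaluated in both orders;
  the minus sign is the antisymmetry of \<open>h / b\<close>.\<close>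

lemma row_sum_exchange:
  "(\<Sum>i\<in>I. (\<Prod>k\<in>I - {i}. b i k) * matchsum h b (I - {i}) * row_sum i J)
   = - (\<Sum>j\<in>J. (\<Prod>k\<in>J - {j}. b j k) * matchsum h b (J - {j}) * row_sum j I)"
proof -
  have anti: "h j i / b j i = - (h i j / b i j)" for i j
    using h_sym[of i j] b_anti[of i j] by simp
  have "(\<Sum>i\<in>I. (\<Prod>k\<in>I - {i}. b i k) * matchsum h b (I - {i}) * row_sum i J)
     = (\<Sum>i\<in>I. \<Sum>j\<in>J. (\<Prod>k\<in>I - {i}. b i k) * matchsum h b (I - {i})
          * (h i j / b i j * (\<Prod>k\<in>J - {j}. b j k) * matchsum h b (J - {j})))"
    by (simp add: row_sum_def sum_distrib_left)
  also have "\<dots> = (\<Sum>j\<in>J. \<Sum>i\<in>I. (\<Prod>k\<in>I - {i}. b i k) * matchsum h b (I - {i})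
          * (h i j / b i j * (\<Prod>k\<in>J - {j}. b j k) * matchsum h b (J - {j})))"
    by (rule sum.swap)
  also have "\<dots> = (\<Sum>j\<in>J. \<Sum>i\<in>I. - ((\<Prod>k\<in>J - {j}. b j k) * matchsum h b (J - {j})
          * (h j i / b j i * (\<Prod>k\<in>I - {i}. b i k) * matchsum h b (I - {i}))))"
    by (intro sum.cong refl, subst anti) (simp only: mult_minus_left mult_minus_right minus_minus mult_ac)
  finally show ?thesis by (simp add: row_sum_def sum_distrib_left sum_negf)
qed

text \<open>Tanner's relation for Pfaffian minors: exchange with \<open>I = {p, q, z}\<close> and
  \<open>J = {p, q} \<union> V\<close>, where the rows \<open>p\<close> and \<open>q\<close> are
  repeated and drop out on both sides. It says that the minors containing \<open>p\<close> and
  \<open>q\<close>, divided by the minor of \<open>{p, q}\<close>, again obey a row expansion. This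
  is the tool for removing a pair of variables.\<close>

lemma matchsum_tanner:
  assumes V: "finite V" "z \<notin> V" "p \<notin> V" "q \<notin> V" "p \<noteq> q" "z \<noteq> p" "z \<noteq> q"
    and nz: "\<And>x y. x \<in> {p, q, z} \<union> V \<Longrightarrow> y \<in> {p, q, z} \<union> V \<Longrightarrow> x \<noteq> y \<Longrightarrow> b x y \<noteq> 0"
  shows "matchsum h b {p, q} * matchsum h b ({p, q} \<union> insert z V) =
    (\<Sum>w\<in>V. matchsum h b {p, q, z, w} * (\<Prod>k\<in>V - {w}. b z k * b w k)
       * matchsum h b ({p, q} \<union> (V - {w})))"
proof -
  let ?I = "{p, q, z}" and ?J = "{p, q} \<union> V"
  let ?B = "\<lambda>I i. (\<Prod>k\<in>I - {i}. b i k) * matchsum h b (I - {i})"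
  have zero: "row_sum i I = 0" if "finite I" "i \<in> I" "I \<subseteq> {p, q, z} \<union> V" for i I
    by (rule row_sum_mem) (use that nz in blast)+
  have "(\<Sum>i\<in>?I. ?B ?I i * row_sum i ?J) = ?B ?I z * row_sum z ?J"
  proof -
    have "row_sum p ?J = 0" "row_sum q ?J = 0" using V by (auto intro!: zero)
    then show ?thesis using V by simp
  qed
  moreover have "(\<Sum>j\<in>?J. ?B ?J j * row_sum j ?I) = (\<Sum>j\<in>V. ?B ?J j * row_sum j ?I)"
  proof -
    have "row_sum p ?I = 0" "row_sum q ?I = 0" using V by (auto intro!: zero)
    then show ?thesis using V by simp
  qed
  ultimately have ex: "?B ?I z * row_sum z ?J = - (\<Sum>j\<in>V. ?B ?J j * row_sum j ?I)"
    using row_sum_exchange[of ?I ?J] by simp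
  have z0: "b z p \<noteq> 0" "b z q \<noteq> 0" using nz V by auto
  have Iz: "?I - {z} = {p, q}" using V by auto
  have prodJ: "(\<Prod>k\<in>?J. f k) = f p * f q * (\<Prod>k\<in>V. f k)" for f :: "'a \<Rightarrow> 'b"
    using V by simp
  have "matchsum h b (insert z ?J) = (\<Prod>k\<in>?J. b z k) * row_sum z ?J"
    by (rule row_sum_notin[symmetric]) (use V nz in auto)
  then have "matchsum h b {p, q} * matchsum h b (insert z ?J)
      = (\<Prod>k\<in>V. b z k) * (?B ?I z * row_sum z ?J)"
    unfolding prodJ Iz using V by simp
  also have "\<dots> = (\<Sum>j\<in>V. - ((\<Prod>k\<in>V. b z k) * (?B ?J j * row_sum j ?I)))"
    unfolding ex by (simp add: sum_distrib_left sum_negf)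
  also have "\<dots> = (\<Sum>w\<in>V. matchsum h b {p, q, z, w} * (\<Prod>k\<in>V - {w}. b z k * b w k)
       * matchsum h b ({p, q} \<union> (V - {w})))"
  proof (rule sum.cong[OF refl])
    fix w assume w: "w \<in> V"
    then have wne: "w \<noteq> p" "w \<noteq> q" "w \<noteq> z" using V by auto
    have Jw: "?J - {w} = {p, q} \<union> (V - {w})" using wne by auto
    have wnz: "b w p \<noteq> 0" "b w q \<noteq> 0" "b w z \<noteq> 0" using nz[of w] w wne by auto
    have "(\<Prod>k\<in>?I. b w k) * row_sum w ?I = matchsum h b (insert w ?I)"
      by (rule row_sum_notin) (use wne wnz in auto)
    moreover have "insert w ?I = {p, q, z, w}" by auto
    moreover have "(\<Prod>k\<in>?I. b w k) = b w p * b w q * b w z" using V by simp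
    ultimately have rw: "row_sum w ?I = matchsum h b {p, q, z, w} / (b w p * b w q * b w z)"
      using wnz by (simp add: field_simps)
    have "(\<Prod>k\<in>?J - {w}. b w k) = b w p * b w q * (\<Prod>k\<in>V - {w}. b w k)"
      unfolding Jw using V by simp
    moreover have "(\<Prod>k\<in>V. b z k) = - b w z * (\<Prod>k\<in>V - {w}. b z k)"
      unfolding b_anti[of w z] minus_minus by (rule prod.remove[OF V(1) w])
    ultimately show "- ((\<Prod>k\<in>V. b z k) * (?B ?J w * row_sum w ?I))
      = matchsum h b {p, q, z, w} * (\<Prod>k\<in>V - {w}. b z k * b w k) * matchsum h b ({p, q} \<union> (V - {w}))"
      unfolding rw Jw using wnz by (simp add: prod.distrib)
  qed
  also have "insert z ?J = {p, q} \<union> insert z V" by auto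
  finally show ?thesis .
qed

end

section \<open>The two sides as polynomials in one variable\<close>

definition bfac :: "complex \<Rightarrow> complex \<Rightarrow> complex \<Rightarrow> complex" where
  "bfac t x y = (1 - t * x * y) / (x - y)"

definition hnum :: "complex \<Rightarrow> complex \<Rightarrow> complex \<Rightarrow> complex \<Rightarrow> complex \<Rightarrow> complex" where
  "hnum t s \<kappa> x y = (1 - t) * (1 - s * x) * (1 - s * y) + \<kappa> * (1 - x * y)"

definition hfac :: "complex \<Rightarrow> complex \<Rightarrow> complex \<Rightarrow> complex \<Rightarrow> complex \<Rightarrow> complex" where
  "hfac t s \<kappa> x y = hnum t s \<kappa> x y / (1 - x * y)"

text \<open>With \<open>\<kappa> = (1 - \<gamma>) * (t - s^2 / \<gamma>)\<close> this is the
  right-hand side of the theorem: \<open>hfac / bfac\<close> is the matrix entry, and the product of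
  \<open>bfac\<close> over all pairs is the prefactor.\<close>

definition Phi :: "complex \<Rightarrow> complex \<Rightarrow> complex \<Rightarrow> complex set \<Rightarrow> complex" where
  "Phi t s \<kappa> = matchsum (hfac t s \<kappa>) (bfac t)"

lemma bfac_anti: "bfac t x y = - bfac t y x"
  unfolding bfac_def by (simp add: mult_ac minus_divide_right)

interpretation matching "hfac t s \<kappa>" "bfac t" for t s \<kappa>
  by unfold_locales (simp_all add: hfac_def hnum_def mult_ac bfac_anti[symmetric])

lemma Phi_empty [simp]: "Phi t s \<kappa> {} = 1"
  by (simp add: Phi_def)

lemma Phi_expand:
  assumes "finite V" "x \<notin> V"
  shows "Phi t s \<kappa> (insert x V) =
    (\<Sum>y\<in>V. hfac t s \<kappa> x y * (\<Prod>k\<in>V - {y}. bfac t x k * bfac t y k) * Phi t s \<kappa> (V - {y}))"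
  unfolding Phi_def using matchsum_expand[OF assms] by (simp add: match_expansion_def)

section \<open>Polynomial functions with degree bounds\<close>

definition polyfun :: "nat \<Rightarrow> (complex \<Rightarrow> complex) \<Rightarrow> bool" where
  "polyfun d f \<longleftrightarrow> (\<exists>p. degree p \<le> d \<and> (\<forall>x. f x = poly p x))"

lemma polyfun_const: "polyfun d (\<lambda>x. c)"
  unfolding polyfun_def by (rule exI[of _ "[:c:]"]) simp

lemma polyfun_linear: "d \<ge> 1 \<Longrightarrow> polyfun d (\<lambda>x. a * x + c)"
  unfolding polyfun_def by (rule exI[of _ "[:c, a:]"]) (simp add: degree_pCons_le[THEN order_trans])

lemma polyfun_mono: "polyfun d f \<Longrightarrow> d \<le> e \<Longrightarrow> polyfun e f"
  unfolding polyfun_def by (meson order_trans)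

lemma polyfun_add: "polyfun d f \<Longrightarrow> polyfun d g \<Longrightarrow> polyfun d (\<lambda>x. f x + g x)"
  unfolding polyfun_def by (metis degree_add_le poly_add)

lemma polyfun_diff: "polyfun d f \<Longrightarrow> polyfun d g \<Longrightarrow> polyfun d (\<lambda>x. f x - g x)"
  unfolding polyfun_def by (metis degree_diff_le poly_diff)

lemma polyfun_mult: "polyfun d f \<Longrightarrow> polyfun e g \<Longrightarrow> polyfun (d + e) (\<lambda>x. f x * g x)"
  unfolding polyfun_def by (metis add_mono degree_mult_le order_trans poly_mult)

lemma polyfun_sum: "(\<And>i. i \<in> A \<Longrightarrow> polyfun d (f i)) \<Longrightarrow> polyfun d (\<lambda>x. \<Sum>i\<in>A. f i x)"
  by (induction A rule: infinite_finite_induct) (auto intro: polyfun_const polyfun_add)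

lemma polyfun_prod:
  "(\<And>i. i \<in> A \<Longrightarrow> polyfun d (f i)) \<Longrightarrow> polyfun (d * card A) (\<lambda>x. \<Prod>i\<in>A. f i x)"
proof (induction A rule: infinite_finite_induct)
  case (insert a A)
  then have "polyfun (d + d * card A) (\<lambda>x. f a x * (\<Prod>i\<in>A. f i x))"
    by (intro polyfun_mult) auto
  with insert show ?case by simp
qed (auto intro: polyfun_const)

lemma polyfun_zero:
  assumes "polyfun d f" "finite Z" "card Z > d" "\<And>z. z \<in> Z \<Longrightarrow> f z = 0"
  shows "f x = 0"
proof -
  from assms(1) obtain p where p: "degree p \<le> d" "\<And>x. f x = poly p x"
    unfolding polyfun_def by auto
  have "p = 0"
  proof (rule ccontr)
    assume p0: "p \<noteq> 0"
    have "card Z \<le> card {x. poly p x = 0}"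
      using poly_roots_finite[OF p0] assms(4) p(2) by (intro card_mono) auto
    also have "\<dots> \<le> degree p" by (rule card_poly_roots_bound[OF p0])
    finally show False using p(1) assms(3) by simp
  qed
  then show ?thesis by (simp add: p(2))
qed

section \<open>The Pfaffian side with its poles cleared\<close>

text \<open>The row expansion of \<open>Phi t s \<kappa> (insert x V)\<close> times the product of
  all \<open>(x - k) * (1 - x * k)\<close>, with the denominators in \<open>x\<close> cancelled
  beforehand, so that it can be evaluated at the former poles as well.\<close>

definition Phi_poly :: "complex \<Rightarrow> complex \<Rightarrow> complex \<Rightarrow> complex set \<Rightarrow> complex \<Rightarrow> complex" where
  "Phi_poly t s \<kappa> V x = (\<Sum>y\<in>V. hnum t s \<kappa> x y * (x - y) *
     (\<Prod>k\<in>V - {y}. (1 - t * x * k) * (1 - x * k) * bfac t y k) * Phi t s \<kappa> (V - {y}))"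

lemma Phi_poly_eq:
  assumes V: "finite V" "x \<notin> V" and nz: "\<And>k. k \<in> V \<Longrightarrow> x * k \<noteq> 1"
  shows "Phi_poly t s \<kappa> V x = Phi t s \<kappa> (insert x V) * (\<Prod>k\<in>V. (x - k) * (1 - x * k))"
  unfolding Phi_poly_def Phi_expand[OF V] sum_distrib_right
proof (rule sum.cong[OF refl])
  fix y assume y: "y \<in> V"
  have "(\<Prod>k\<in>V. (x - k) * (1 - x * k)) = (x - y) * (1 - x * y) * (\<Prod>k\<in>V - {y}. (x - k) * (1 - x * k))"
    by (rule prod.remove) (use V y in auto)
  moreover have "(\<Prod>k\<in>V - {y}. bfac t x k * bfac t y k) * (\<Prod>k\<in>V - {y}. (x - k) * (1 - x * k))
      = (\<Prod>k\<in>V - {y}. (1 - t * x * k) * (1 - x * k) * bfac t y k)"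
    unfolding prod.distrib[symmetric] using V by (intro prod.cong refl) (auto simp: bfac_def)
  moreover have "hfac t s \<kappa> x y * (1 - x * y) = hnum t s \<kappa> x y"
    using nz[OF y] by (simp add: hfac_def)
  ultimately have 1: "(\<Prod>k\<in>V. (x - k) * (1 - x * k)) = (x - y) * (1 - x * y) * (\<Prod>k\<in>V - {y}. (x - k) * (1 - x * k))"
    and 2: "(\<Prod>k\<in>V - {y}. bfac t x k * bfac t y k) * (\<Prod>k\<in>V - {y}. (x - k) * (1 - x * k))
      = (\<Prod>k\<in>V - {y}. (1 - t * x * k) * (1 - x * k) * bfac t y k)"
    and 3: "hfac t s \<kappa> x y * (1 - x * y) = hnum t s \<kappa> x y" by blast+
  show "hnum t s \<kappa> x y * (x - y) *
     (\<Prod>k\<in>V - {y}. (1 - t * x * k) * (1 - x * k) * bfac t y k) * Phi t s \<kappa> (V - {y})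
    = hfac t s \<kappa> x y * (\<Prod>k\<in>V - {y}. bfac t x k * bfac t y k) * Phi t s \<kappa> (V - {y})
      * (\<Prod>k\<in>V. (x - k) * (1 - x * k))"
    unfolding 1 2[symmetric] 3[symmetric] by (simp only: mult_ac)
qed

text \<open>The term \<open>y = x\<close> contains \<open>x - x\<close>; up to a common factor the
  others form the repeated-row sum of \<open>matchsum_vanish\<close>.\<close>

lemma Phi_poly_zero:
  assumes V: "finite V" "x \<notin> V" and nz: "\<And>k. k \<in> V \<Longrightarrow> x * k \<noteq> 1"
  shows "Phi_poly t s \<kappa> (insert x V) x = 0"
proof -
  let ?h = "hfac t s \<kappa>" and ?b = "bfac t"
  let ?C = "- (1 - t * x * x) * (1 - x * x) * (\<Prod>k\<in>V. (1 - t * x * k) * (1 - x * k))"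
  have "Phi_poly t s \<kappa> (insert x V) x = (\<Sum>y\<in>V. hnum t s \<kappa> x y * (x - y) *
     (\<Prod>k\<in>insert x V - {y}. (1 - t * x * k) * (1 - x * k) * ?b y k) * Phi t s \<kappa> (insert x V - {y}))"
    unfolding Phi_poly_def using V by simp
  also have "\<dots> = (\<Sum>y\<in>V. ?C * (?h x y * (\<Prod>k\<in>V - {y}. ?b y k) * Phi t s \<kappa> (insert x (V - {y}))))"
  proof (rule sum.cong[OF refl])
    fix y assume y: "y \<in> V"
    have xy: "x \<noteq> y" using V y by auto
    have 1: "insert x V - {y} = insert x (V - {y})" using V y by auto
    have num: "hnum t s \<kappa> x y = ?h x y * (1 - x * y)"
      using nz[OF y] by (simp add: hfac_def)
    have byx: "(x - y) * ?b y x = - (1 - t * x * y)"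
      using xy by (simp add: bfac_def field_simps)
    have rem: "(\<Prod>k\<in>V. (1 - t * x * k) * (1 - x * k))
        = (1 - t * x * y) * (1 - x * y) * (\<Prod>k\<in>V - {y}. (1 - t * x * k) * (1 - x * k))"
      by (rule prod.remove) (use V y in auto)
    have "hnum t s \<kappa> x y * (x - y) *
       (\<Prod>k\<in>insert x V - {y}. (1 - t * x * k) * (1 - x * k) * ?b y k)
      = ?h x y * (1 - x * y) * ((x - y) * ?b y x) * ((1 - t * x * x) * (1 - x * x)) *
        ((\<Prod>k\<in>V - {y}. (1 - t * x * k) * (1 - x * k)) * (\<Prod>k\<in>V - {y}. ?b y k))"
      unfolding 1 num using V by (subst prod.insert) (simp_all add: prod.distrib mult_ac)
    also have "\<dots> = ?C * (?h x y * (\<Prod>k\<in>V - {y}. ?b y k))"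
      unfolding byx rem by algebra
    finally show "hnum t s \<kappa> x y * (x - y) *
     (\<Prod>k\<in>insert x V - {y}. (1 - t * x * k) * (1 - x * k) * ?b y k) * Phi t s \<kappa> (insert x V - {y})
      = ?C * (?h x y * (\<Prod>k\<in>V - {y}. ?b y k) * Phi t s \<kappa> (insert x (V - {y})))"
      unfolding 1 by (simp only: mult.assoc)
  qed
  also have "\<dots> = 0"
    using matchsum_vanish[OF V, of t s \<kappa>] unfolding Phi_def by (simp only: sum_distrib_left[symmetric] mult_zero_right)
  finally show ?thesis .
qed

text \<open>At \<open>x = 1 / y\<close> the factor \<open>1 - x * y\<close> kills every term except
  the one matching \<open>x\<close> with \<open>y\<close>, so that only the matchings of
  \<open>V\<close> remain.\<close>

lemma Phi_poly_inverse:
  assumes V: "finite V" "y \<notin> V" and y: "y \<noteq> 0"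
  shows "Phi_poly t s \<kappa> (insert y V) (1 / y) = (1 - t) * (1 - s / y) * (1 - s * y) * (1 / y - y) *
     (\<Prod>k\<in>V. (1 - t * k / y) * (1 - k / y) * bfac t y k) * Phi t s \<kappa> V"
proof -
  let ?g = "\<lambda>w. hnum t s \<kappa> (1 / y) w * (1 / y - w) *
     (\<Prod>k\<in>insert y V - {w}. (1 - t * (1 / y) * k) * (1 - (1 / y) * k) * bfac t w k)
       * Phi t s \<kappa> (insert y V - {w})"
  have "(\<Sum>w\<in>V. ?g w) = 0"
  proof (intro sum.neutral ballI)
    fix w assume "w \<in> V"
    then have "(\<Prod>k\<in>insert y V - {w}. (1 - t * (1 / y) * k) * (1 - (1 / y) * k) * bfac t w k) = 0"
      using V y by (intro prod_zero) auto
    then show "?g w = 0" by simp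
  qed
  then have "Phi_poly t s \<kappa> (insert y V) (1 / y) = ?g y"
    unfolding Phi_poly_def using V by simp
  also have "insert y V - {y} = V" using V by auto
  finally show ?thesis using y by (simp add: hnum_def)
qed

lemma Phi_poly_degree:
  assumes "finite V"
  shows "polyfun (2 * card V) (Phi_poly t s \<kappa> V)"
  unfolding Phi_poly_def
proof (rule polyfun_sum)
  fix y assume y: "y \<in> V"
  have lin: "polyfun 1 (\<lambda>x. 1 - c * x)" "polyfun 1 (\<lambda>x. x - c)" for c
    using polyfun_linear[of 1 "- c" 1] polyfun_linear[of 1 1 "- c"] by (auto simp: algebra_simps)
  have h: "polyfun 1 (\<lambda>x. hnum t s \<kappa> x y)"
    using polyfun_linear[of 1 "- (1 - t) * s * (1 - s * y) - \<kappa> * y" "(1 - t) * (1 - s * y) + \<kappa>"]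
    by (simp add: hnum_def algebra_simps)
  have "polyfun 2 (\<lambda>x. (1 - t * x * k) * (1 - x * k) * bfac t y k)" for k
    using polyfun_mult[OF polyfun_mult[OF lin(1)[of "t * k"] lin(1)[of k]] polyfun_const[of 0 "bfac t y k"]]
    by (simp add: mult_ac numeral_2_eq_2)
  then have "polyfun (1 + 1 + 2 * card (V - {y}) + 0) (\<lambda>x. hnum t s \<kappa> x y * (x - y) *
     (\<Prod>k\<in>V - {y}. (1 - t * x * k) * (1 - x * k) * bfac t y k) * Phi t s \<kappa> (V - {y}))"
    by (intro polyfun_mult[OF polyfun_mult[OF polyfun_mult[OF h lin(2)] polyfun_prod] polyfun_const])
  then show "polyfun (2 * card V) (\<lambda>x. hnum t s \<kappa> x y * (x - y) *
     (\<Prod>k\<in>V - {y}. (1 - t * x * k) * (1 - x * k) * bfac t y k) * Phi t s \<kappa> (V - {y}))"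
    by (rule polyfun_mono) (use card.remove[OF assms y] in simp)
qed

text \<open>For \<open>s = \<kappa> = 0\<close> the numerator \<open>hnum\<close> is the constant
  \<open>1 - t\<close>. The degree saved in this way pays for the factor \<open>x - s\<close> in
  \<open>Rsum_poly\<close>.\<close>

lemma Phi_poly_degree_0:
  assumes "finite V"
  shows "polyfun (2 * card V - 1) (Phi_poly t 0 0 V)"
  unfolding Phi_poly_def
proof (rule polyfun_sum)
  fix y assume y: "y \<in> V"
  have lin: "polyfun 1 (\<lambda>x. 1 - c * x)" "polyfun 1 (\<lambda>x. x - c)" for c
    using polyfun_linear[of 1 "- c" 1] polyfun_linear[of 1 1 "- c"] by (auto simp: algebra_simps)
  have h: "polyfun 0 (\<lambda>x. hnum t 0 0 x y)"
    by (simp add: hnum_def polyfun_const)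
  have "polyfun 2 (\<lambda>x. (1 - t * x * k) * (1 - x * k) * bfac t y k)" for k
    using polyfun_mult[OF polyfun_mult[OF lin(1)[of "t * k"] lin(1)[of k]] polyfun_const[of 0 "bfac t y k"]]
    by (simp add: mult_ac numeral_2_eq_2)
  then have "polyfun (0 + 1 + 2 * card (V - {y}) + 0) (\<lambda>x. hnum t 0 0 x y * (x - y) *
     (\<Prod>k\<in>V - {y}. (1 - t * x * k) * (1 - x * k) * bfac t y k) * Phi t 0 0 (V - {y}))"
    by (intro polyfun_mult[OF polyfun_mult[OF polyfun_mult[OF h lin(2)] polyfun_prod] polyfun_const])
  then show "polyfun (2 * card V - 1) (\<lambda>x. hnum t 0 0 x y * (x - y) *
     (\<Prod>k\<in>V - {y}. (1 - t * x * k) * (1 - x * k) * bfac t y k) * Phi t 0 0 (V - {y}))"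
    by (rule polyfun_mono) (use card.remove[OF assms y] in simp)
qed

lemma sum_Pow_insert:
  assumes "finite A" "a \<notin> A"
  shows "(\<Sum>T\<in>Pow (insert a A). f T) = (\<Sum>T\<in>Pow A. f T + f (insert a T))"
proof -
  have "Pow A \<inter> insert a ` Pow A = {}" using assms by auto
  moreover have "inj_on (insert a) (Pow A)" using assms by (auto simp: inj_on_def)
  ultimately show ?thesis
    unfolding Pow_insert using assms
    by (subst sum.union_disjoint) (auto simp: sum.reindex sum.distrib)
qed

text \<open>
  With \<open>p = \<gamma> t + s\<^sup>2 / \<gamma>\<close> the refined weight \<open>(1 - s^2 t^(2 j) / \<gamma>) (1 - \<gamma> t^(2 j + 1))\<close> and the constant
  \<open>(1 - \<gamma>) (t - s\<^sup>2 / \<gamma>) = t + s\<^sup>2 - p\<close> of the Pfaffian entries are polynomial in \<open>s\<close> and \<open>p\<close>; keeping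
  \<open>p\<close> fixed while \<open>s\<close> varies allows exceptional values of \<open>s\<close> to be reached by continuity.
\<close>

definition zweight :: "complex \<Rightarrow> complex \<Rightarrow> complex \<Rightarrow> nat \<Rightarrow> complex" where
  "zweight t s p m = (\<Prod>j<m. 1 - p * t ^ (2 * j) + s ^ 2 * t ^ (4 * j + 1))"

definition cross :: "complex \<Rightarrow> complex set \<Rightarrow> complex set \<Rightarrow> complex" where
  "cross t T R = (\<Prod>x\<in>T. \<Prod>y\<in>R. (x - t * y) / (x - y))"

lemma cross_insert_left:
  assumes "finite T" "x \<notin> T"
  shows "cross t (insert x T) R = (\<Prod>y\<in>R. (x - t * y) / (x - y)) * cross t T R"
  using assms by (simp add: cross_def)

lemma cross_insert_right:
  assumes "finite R" "y \<notin> R"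
  shows "cross t T (insert y R) = (\<Prod>x\<in>T. (x - t * y) / (x - y)) * cross t T R"
  unfolding cross_def prod.insert[OF assms] prod.distrib ..

lemma divide_diff_mult_swap:
  fixes k x :: complex
  assumes "k \<noteq> x"
  shows "(k - a) / (k - x) * (x - k) = a - k"
proof -
  have "(k - a) / (k - x) * (x - k) = - ((k - a) / (k - x) * (k - x))"
    by (simp only: mult_minus_right[symmetric] minus_diff_eq)
  also have "\<dots> = a - k" using assms by simp
  finally show ?thesis .
qed

section \<open>The subset sum with its poles cleared\<close>

text \<open>For even \<open>card U\<close> only even \<open>T\<close> contribute, because
  \<open>Phi\<close> vanishes on odd sets, and \<open>div 2\<close> is exact there. Summing over all
  subsets lets one variable be split off without parity conditions.\<close>

definition Rsum :: "complex \<Rightarrow> complex \<Rightarrow> complex \<Rightarrow> complex set \<Rightarrow> complex" where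
  "Rsum t s p U = (\<Sum>T\<in>Pow U. zweight t s p (card (U - T) div 2) * (\<Prod>x\<in>T. x - s)
     * cross t T (U - T) * Phi t 0 0 T)"

text \<open>The first summand collects the subsets of \<open>insert x V\<close> that omit
  \<open>x\<close>, whence the \<open>Suc\<close> in the count of zero rows; the second collects
  those that contain \<open>x\<close>.\<close>

definition Rsum_poly :: "complex \<Rightarrow> complex \<Rightarrow> complex \<Rightarrow> complex set \<Rightarrow> complex \<Rightarrow> complex" where
  "Rsum_poly t s p V x = (\<Sum>T\<in>Pow V.
     zweight t s p (Suc (card (V - T)) div 2) * (\<Prod>k\<in>T. k - s) * cross t T (V - T) * Phi t 0 0 T
       * ((\<Prod>k\<in>T. t * x - k) * (\<Prod>k\<in>V - T. x - k) * (\<Prod>k\<in>V. 1 - x * k)) +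
     zweight t s p (card (V - T) div 2) * (\<Prod>k\<in>T. k - s) * cross t T (V - T)
       * ((x - s) * Phi_poly t 0 0 T x * (\<Prod>j\<in>V - T. (x - t * j) * (1 - x * j))))"

lemma Rsum_poly_eq:
  assumes V: "finite V" "x \<notin> V" and nz: "\<And>k. k \<in> V \<Longrightarrow> x * k \<noteq> 1"
  shows "Rsum_poly t s p V x = Rsum t s p (insert x V) * (\<Prod>k\<in>V. (x - k) * (1 - x * k))"
  unfolding Rsum_def Rsum_poly_def sum_Pow_insert[OF V] sum_distrib_right
proof (rule sum.cong[OF refl])
  fix T assume "T \<in> Pow V"
  then have T: "T \<subseteq> V" "finite T" "x \<notin> T" "finite (V - T)" "x \<notin> V - T"
    using V by (auto intro: finite_subset)
  define R where "R = V - T"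
  have R: "finite R" "x \<notin> R" using T by (simp_all add: R_def)
  have U: "insert x V - T = insert x R" "insert x V - insert x T = R"
    using T V by (auto simp: R_def)
  have split: "(\<Prod>k\<in>V. f k) = (\<Prod>k\<in>T. f k) * (\<Prod>k\<in>R. f k)" for f :: "complex \<Rightarrow> complex"
    unfolding R_def using T V by (metis prod.subset_diff mult.commute)
  have PT: "Phi_poly t 0 0 T x = Phi t 0 0 (insert x T) * (\<Prod>k\<in>T. (x - k) * (1 - x * k))"
    by (rule Phi_poly_eq) (use T nz in auto)
  have e1: "(\<Prod>k\<in>T. (k - t * x) / (k - x)) * (\<Prod>k\<in>T. x - k) = (\<Prod>k\<in>T. t * x - k)"
    unfolding prod.distrib[symmetric] using T by (intro prod.cong refl divide_diff_mult_swap) auto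
  have e2: "(\<Prod>k\<in>R. (x - t * k) / (x - k)) * (\<Prod>k\<in>R. x - k) = (\<Prod>k\<in>R. x - t * k)"
    unfolding prod.distrib[symmetric] using R by (intro prod.cong refl) auto
  have A: "zweight t s p (card (insert x R) div 2) * (\<Prod>x\<in>T. x - s) * cross t T (insert x R) * Phi t 0 0 T
        * (\<Prod>k\<in>V. (x - k) * (1 - x * k))
      = zweight t s p (Suc (card R) div 2) * (\<Prod>k\<in>T. k - s) * cross t T R * Phi t 0 0 T
       * ((\<Prod>k\<in>T. t * x - k) * (\<Prod>k\<in>R. x - k) * (\<Prod>k\<in>V. 1 - x * k))"
    unfolding cross_insert_right[OF R] prod.distrib card_insert_disjoint[OF R] split[of "\<lambda>k. x - k"] e1[symmetric]
    by (simp only: mult_ac)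
  have B: "zweight t s p (card R div 2) * (\<Prod>x\<in>insert x T. x - s) * cross t (insert x T) R * Phi t 0 0 (insert x T)
        * (\<Prod>k\<in>V. (x - k) * (1 - x * k))
      = zweight t s p (card R div 2) * (\<Prod>k\<in>T. k - s) * cross t T R
       * ((x - s) * Phi_poly t 0 0 T x * (\<Prod>j\<in>R. (x - t * j) * (1 - x * j)))"
    unfolding cross_insert_left[OF T(2,3)] split prod.distrib PT e2[symmetric] prod.insert[OF T(2,3)]
    by (simp only: mult_ac)
  show "zweight t s p (Suc (card (V - T)) div 2) * (\<Prod>k\<in>T. k - s) * cross t T (V - T) * Phi t 0 0 T
       * ((\<Prod>k\<in>T. t * x - k) * (\<Prod>k\<in>V - T. x - k) * (\<Prod>k\<in>V. 1 - x * k)) +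
     zweight t s p (card (V - T) div 2) * (\<Prod>k\<in>T. k - s) * cross t T (V - T)
       * ((x - s) * Phi_poly t 0 0 T x * (\<Prod>j\<in>V - T. (x - t * j) * (1 - x * j)))
    = (zweight t s p (card (insert x V - T) div 2) * (\<Prod>x\<in>T. x - s) * cross t T (insert x V - T) * Phi t 0 0 T
      + zweight t s p (card (insert x V - insert x T) div 2) * (\<Prod>x\<in>insert x T. x - s)
        * cross t (insert x T) (insert x V - insert x T) * Phi t 0 0 (insert x T))
       * (\<Prod>k\<in>V. (x - k) * (1 - x * k))"
    unfolding U R_def[symmetric] distrib_right A B ..
qed

text \<open>The value \<open>x\<close> now occurs twice. Both copies inside or both outside
  \<open>T\<close> give 0; the two mixed terms differ only in a factor \<open>x - t * x\<close>
  against \<open>t * x - x\<close> and cancel.\<close>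

lemma Rsum_poly_zero:
  assumes V: "finite V" "x \<notin> V" and nz: "\<And>k. k \<in> V \<Longrightarrow> x * k \<noteq> 1"
  shows "Rsum_poly t s p (insert x V) x = 0"
  unfolding Rsum_poly_def sum_Pow_insert[OF V]
proof (intro sum.neutral ballI)
  fix T assume "T \<in> Pow V"
  then have T: "T \<subseteq> V" "finite T" "x \<notin> T"
    using V by (auto intro: finite_subset)
  define R where "R = V - T"
  have R: "finite R" "x \<notin> R" using V by (simp_all add: R_def)
  have U: "insert x V - T = insert x R" "insert x V - insert x T = R"
    using T V by (auto simp: R_def)
  have split: "(\<Prod>k\<in>V. f k) = (\<Prod>k\<in>T. f k) * (\<Prod>k\<in>R. f k)" for f :: "complex \<Rightarrow> complex"
    unfolding R_def using T V by (metis prod.subset_diff mult.commute)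
  have z1: "(\<Prod>k\<in>insert x R. x - k) = 0" using R by simp
  have z2: "Phi_poly t 0 0 (insert x T) x = 0"
    by (rule Phi_poly_zero) (use T nz in auto)
  have PT: "Phi_poly t 0 0 T x = Phi t 0 0 (insert x T) * (\<Prod>k\<in>T. (x - k) * (1 - x * k))"
    by (rule Phi_poly_eq) (use T nz in auto)
  have e1: "(\<Prod>k\<in>T. (k - t * x) / (k - x)) * (\<Prod>k\<in>T. x - k) = (\<Prod>k\<in>T. t * x - k)"
    unfolding prod.distrib[symmetric] using T by (intro prod.cong refl divide_diff_mult_swap) auto
  have e2: "(\<Prod>k\<in>R. (x - t * k) / (x - k)) * (\<Prod>k\<in>R. x - k) = (\<Prod>k\<in>R. x - t * k)"
    unfolding prod.distrib[symmetric] using R by (intro prod.cong refl) auto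
  let ?c = "zweight t s p (Suc (card R) div 2)"
  have A: "?c * (\<Prod>k\<in>T. k - s) * cross t T (insert x R)
       * ((x - s) * Phi_poly t 0 0 T x * (\<Prod>j\<in>insert x R. (x - t * j) * (1 - x * j)))
     = (x - t * x) * (?c * (x - s) * (1 - x * x) * (\<Prod>k\<in>T. k - s) * cross t T R * Phi t 0 0 (insert x T)
        * (\<Prod>k\<in>T. t * x - k) * (\<Prod>k\<in>R. x - t * k) * (\<Prod>k\<in>V. 1 - x * k))"
    unfolding cross_insert_right[OF R] PT prod.insert[OF R] prod.distrib e1[symmetric]
      split[of "\<lambda>k. 1 - x * k"]
    by (simp only: mult_ac)
  have B: "?c * (\<Prod>k\<in>insert x T. k - s) * cross t (insert x T) R * Phi t 0 0 (insert x T)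
       * ((\<Prod>k\<in>insert x T. t * x - k) * (\<Prod>k\<in>R. x - k) * (\<Prod>k\<in>insert x V. 1 - x * k))
     = (t * x - x) * (?c * (x - s) * (1 - x * x) * (\<Prod>k\<in>T. k - s) * cross t T R * Phi t 0 0 (insert x T)
        * (\<Prod>k\<in>T. t * x - k) * (\<Prod>k\<in>R. x - t * k) * (\<Prod>k\<in>V. 1 - x * k))"
    unfolding cross_insert_left[OF T(2,3)] prod.insert[OF T(2,3)] prod.insert[OF V] e2[symmetric]
    by (simp only: mult_ac)
  show "zweight t s p (Suc (card (insert x V - T)) div 2) * (\<Prod>k\<in>T. k - s) * cross t T (insert x V - T) * Phi t 0 0 T
       * ((\<Prod>k\<in>T. t * x - k) * (\<Prod>k\<in>insert x V - T. x - k) * (\<Prod>k\<in>insert x V. 1 - x * k)) +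
     zweight t s p (card (insert x V - T) div 2) * (\<Prod>k\<in>T. k - s) * cross t T (insert x V - T)
       * ((x - s) * Phi_poly t 0 0 T x * (\<Prod>j\<in>insert x V - T. (x - t * j) * (1 - x * j))) +
    (zweight t s p (Suc (card (insert x V - insert x T)) div 2) * (\<Prod>k\<in>insert x T. k - s)
       * cross t (insert x T) (insert x V - insert x T) * Phi t 0 0 (insert x T)
       * ((\<Prod>k\<in>insert x T. t * x - k) * (\<Prod>k\<in>insert x V - insert x T. x - k) * (\<Prod>k\<in>insert x V. 1 - x * k)) +
     zweight t s p (card (insert x V - insert x T) div 2) * (\<Prod>k\<in>insert x T. k - s)
       * cross t (insert x T) (insert x V - insert x T)
       * ((x - s) * Phi_poly t 0 0 (insert x T) x * (\<Prod>j\<in>insert x V - insert x T. (x - t * j) * (1 - x * j)))) = 0"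
    unfolding U card_insert_disjoint[OF R] z1 z2 A B by (simp add: algebra_simps)
qed

text \<open>Unless both \<open>y\<close> and the new variable lie in \<open>T\<close>, a factor
  \<open>1 - (1 / y) * y\<close> occurs. The surviving terms reproduce \<open>Rsum t s p V\<close>
  with the very constant of \<open>Phi_poly_inverse\<close>.\<close>

lemma Rsum_poly_inverse:
  assumes V: "finite V" "y \<notin> V" and y: "y \<noteq> 0"
  shows "Rsum_poly t s p (insert y V) (1 / y) = (1 - t) * (1 - s / y) * (1 - s * y) * (1 / y - y) *
     (\<Prod>k\<in>V. (1 - t * k / y) * (1 - k / y) * bfac t y k) * Rsum t s p V"
  unfolding Rsum_poly_def Rsum_def sum_Pow_insert[OF V] sum_distrib_left
proof (rule sum.cong[OF refl])
  fix T assume "T \<in> Pow V"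
  then have T: "T \<subseteq> V" "finite T" "y \<notin> T"
    using V by (auto intro: finite_subset)
  define R where "R = V - T"
  have R: "finite R" "y \<notin> R" using V by (simp_all add: R_def)
  have U: "insert y V - T = insert y R" "insert y V - insert y T = R"
    using T V by (auto simp: R_def)
  have split: "(\<Prod>k\<in>V. f k) = (\<Prod>k\<in>T. f k) * (\<Prod>k\<in>R. f k)" for f :: "complex \<Rightarrow> complex"
    unfolding R_def using T V by (metis prod.subset_diff mult.commute)
  have z1: "(\<Prod>k\<in>insert y V. 1 - 1 / y * k) = 0" using V y by simp
  have z2: "(\<Prod>j\<in>insert y R. (1 / y - t * j) * (1 - 1 / y * j)) = 0" using R y by simp
  have PT: "Phi_poly t 0 0 (insert y T) (1 / y) = (1 - t) * (1 / y - y) *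
     (\<Prod>k\<in>T. (1 - t * k / y) * (1 - k / y) * bfac t y k) * Phi t 0 0 T"
    using Phi_poly_inverse[OF T(2,3) y, of t 0 0] by simp
  have e: "(\<Prod>k\<in>R. (y - t * k) / (y - k)) * (\<Prod>j\<in>R. (1 / y - t * j) * (1 - 1 / y * j))
      = (\<Prod>k\<in>R. (1 - t * k / y) * (1 - k / y) * bfac t y k)"
    unfolding prod.distrib[symmetric]
  proof (rule prod.cong[OF refl])
    fix k assume "k \<in> R"
    then have "y - k \<noteq> 0" using R by auto
    then show "(y - t * k) / (y - k) * ((1 / y - t * k) * (1 - 1 / y * k))
        = (1 - t * k / y) * (1 - k / y) * bfac t y k"
      using y by (simp add: bfac_def field_simps)
  qed
  have s: "(1 / y - s) * (y - s) = (1 - s / y) * (1 - s * y)" using y by (simp add: field_simps)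
  have "zweight t s p (card R div 2) * (\<Prod>k\<in>insert y T. k - s) * cross t (insert y T) R
       * ((1 / y - s) * Phi_poly t 0 0 (insert y T) (1 / y) * (\<Prod>j\<in>R. (1 / y - t * j) * (1 - 1 / y * j)))
    = (1 - t) * ((1 / y - s) * (y - s)) * (1 / y - y) *
     ((\<Prod>k\<in>T. (1 - t * k / y) * (1 - k / y) * bfac t y k) *
     ((\<Prod>k\<in>R. (y - t * k) / (y - k)) * (\<Prod>j\<in>R. (1 / y - t * j) * (1 - 1 / y * j)))) *
     (zweight t s p (card R div 2) * (\<Prod>x\<in>T. x - s) * cross t T R * Phi t 0 0 T)"
    unfolding cross_insert_left[OF T(2,3)] prod.insert[OF T(2,3)] PT by (simp only: mult_ac)
  also have "\<dots> = (1 - t) * (1 - s / y) * (1 - s * y) * (1 / y - y) *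
     (\<Prod>k\<in>V. (1 - t * k / y) * (1 - k / y) * bfac t y k) *
     (zweight t s p (card R div 2) * (\<Prod>x\<in>T. x - s) * cross t T R * Phi t 0 0 T)"
    unfolding e s split[symmetric] by (simp only: mult_ac)
  finally show "zweight t s p (Suc (card (insert y V - T)) div 2) * (\<Prod>k\<in>T. k - s) * cross t T (insert y V - T) * Phi t 0 0 T
       * ((\<Prod>k\<in>T. t * (1 / y) - k) * (\<Prod>k\<in>insert y V - T. 1 / y - k) * (\<Prod>k\<in>insert y V. 1 - 1 / y * k)) +
     zweight t s p (card (insert y V - T) div 2) * (\<Prod>k\<in>T. k - s) * cross t T (insert y V - T)
       * ((1 / y - s) * Phi_poly t 0 0 T (1 / y) * (\<Prod>j\<in>insert y V - T. (1 / y - t * j) * (1 - 1 / y * j))) +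
    (zweight t s p (Suc (card (insert y V - insert y T)) div 2) * (\<Prod>k\<in>insert y T. k - s)
       * cross t (insert y T) (insert y V - insert y T) * Phi t 0 0 (insert y T)
       * ((\<Prod>k\<in>insert y T. t * (1 / y) - k) * (\<Prod>k\<in>insert y V - insert y T. 1 / y - k) * (\<Prod>k\<in>insert y V. 1 - 1 / y * k)) +
     zweight t s p (card (insert y V - insert y T) div 2) * (\<Prod>k\<in>insert y T. k - s)
       * cross t (insert y T) (insert y V - insert y T)
       * ((1 / y - s) * Phi_poly t 0 0 (insert y T) (1 / y) * (\<Prod>j\<in>insert y V - insert y T. (1 / y - t * j) * (1 - 1 / y * j))))
    = (1 - t) * (1 - s / y) * (1 - s * y) * (1 / y - y) *
     (\<Prod>k\<in>V. (1 - t * k / y) * (1 - k / y) * bfac t y k) *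
     (zweight t s p (card (V - T) div 2) * (\<Prod>x\<in>T. x - s) * cross t T (V - T) * Phi t 0 0 T)"
    unfolding U R_def[symmetric] z1 z2 by simp
qed

lemma Rsum_poly_degree:
  assumes "finite V"
  shows "polyfun (2 * card V) (Rsum_poly t s p V)"
  unfolding Rsum_poly_def
proof (intro polyfun_sum polyfun_add)
  fix T assume "T \<in> Pow V"
  then have T: "T \<subseteq> V" "finite T" using assms by (auto intro: finite_subset)
  have cV: "card V = card T + card (V - T)"
    using T assms by (metis card_Diff_subset card_mono le_add_diff_inverse)
  have lin: "polyfun 1 (\<lambda>x. 1 - x * c)" "polyfun 1 (\<lambda>x. x - c)" "polyfun 1 (\<lambda>x. t * x - c)" for c
    using polyfun_linear[of 1 "- c" 1] polyfun_linear[of 1 1 "- c"] polyfun_linear[of 1 t "- c"]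
    by (auto simp: algebra_simps)
  have lin2: "polyfun 2 (\<lambda>x. (x - t * j) * (1 - x * j))" for j
    using polyfun_mult[OF lin(2)[of "t * j"] lin(1)[of j]] by (simp add: numeral_2_eq_2)
  have "polyfun (0 + (1 * card T + 1 * card (V - T) + 1 * card V))
    (\<lambda>x. zweight t s p (Suc (card (V - T)) div 2) * (\<Prod>k\<in>T. k - s) * cross t T (V - T) * Phi t 0 0 T
       * ((\<Prod>k\<in>T. t * x - k) * (\<Prod>k\<in>V - T. x - k) * (\<Prod>k\<in>V. 1 - x * k)))"
    by (intro polyfun_mult[OF polyfun_const] polyfun_mult[OF polyfun_mult[OF polyfun_prod polyfun_prod] polyfun_prod] lin)
  then show "polyfun (2 * card V)
    (\<lambda>x. zweight t s p (Suc (card (V - T)) div 2) * (\<Prod>k\<in>T. k - s) * cross t T (V - T) * Phi t 0 0 T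
       * ((\<Prod>k\<in>T. t * x - k) * (\<Prod>k\<in>V - T. x - k) * (\<Prod>k\<in>V. 1 - x * k)))"
    by (rule polyfun_mono) (use cV in simp)
  show "polyfun (2 * card V) (\<lambda>x. zweight t s p (card (V - T) div 2) * (\<Prod>k\<in>T. k - s) * cross t T (V - T)
       * ((x - s) * Phi_poly t 0 0 T x * (\<Prod>j\<in>V - T. (x - t * j) * (1 - x * j))))"
  \<comment> \<open>For empty \<open>T\<close> the truncated difference
    \<open>2 * card T - 1\<close> would spoil the count of degrees; but then \<open>Phi_poly\<close>
    is an empty sum.\<close>
  proof (cases "T = {}")
    case True
    then show ?thesis by (simp add: Phi_poly_def polyfun_const)
  next
    case False
    then have "card T > 0" using T by (simp add: card_gt_0_iff)
    have "polyfun (0 + (1 + (2 * card T - 1) + 2 * card (V - T)))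
      (\<lambda>x. zweight t s p (card (V - T) div 2) * (\<Prod>k\<in>T. k - s) * cross t T (V - T)
       * ((x - s) * Phi_poly t 0 0 T x * (\<Prod>j\<in>V - T. (x - t * j) * (1 - x * j))))"
      by (intro polyfun_mult[OF polyfun_const]
          polyfun_mult[OF polyfun_mult[OF lin(2) Phi_poly_degree_0[OF T(2)]] polyfun_prod] lin2)
    then show ?thesis
      by (rule polyfun_mono) (use cV \<open>card T > 0\<close> in simp)
  qed
qed

section \<open>The one-step identity\<close>

text \<open>Taking out the factor \<open>j = 0\<close> rescales \<open>s\<close> and
  \<open>p\<close> by \<open>t ^ 2\<close>. In terms of
  \<open>p = \<gamma> * t + s^2 / \<gamma>\<close> this means that \<open>\<gamma>\<close> is
  rescaled by \<open>t ^ 2\<close> too.\<close>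

lemma zweight_Suc:
  "zweight t s p (Suc m) = (1 - p + s ^ 2 * t) * zweight t (s * t ^ 2) (p * t ^ 2) m"
  unfolding zweight_def prod.lessThan_Suc_shift
  by (auto simp: power_add power_mult power2_eq_square numeral_eq_Suc algebra_simps
      intro!: arg_cong2[of _ _ _ _ "(*)"] prod.cong)

text \<open>Only the \<open>T\<close> that avoid both \<open>s\<close> and \<open>t * s\<close>
  survive. For them \<open>(x - s)\<close> times the cross factors
  \<open>(x - t * s) / (x - s)\<close> and \<open>(x - t^2 * s) / (x - t * s)\<close> telescopes to
  \<open>x - t^2 * s\<close>, the factor belonging to the rescaled parameter.\<close>

lemma Rsum_eval:
  assumes V: "finite V" "s \<notin> V" "t * s \<notin> V" "s \<noteq> t * s"
  shows "Rsum t s p (insert s (insert (t * s) V))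
       = (1 - p + s ^ 2 * t) * Rsum t (s * t ^ 2) (p * t ^ 2) V"
proof -
  have V': "finite (insert (t * s) V)" "s \<notin> insert (t * s) V" using V by auto
  show ?thesis
    unfolding Rsum_def sum_Pow_insert[OF V'] sum_Pow_insert[OF V(1,3)] sum_distrib_left
  proof (rule sum.cong[OF refl])
    fix T assume "T \<in> Pow V"
    then have T: "T \<subseteq> V" "finite T" "s \<notin> T" "t * s \<notin> T"
      using V by (auto intro: finite_subset)
    define R where "R = V - T"
    have R: "finite R" "t * s \<notin> R" "s \<notin> R" using V by (simp_all add: R_def)
    have R': "finite (insert (t * s) R)" "s \<notin> insert (t * s) R" using R V by auto
    let ?U = "insert s (insert (t * s) V)"
    have U: "?U - T = insert s (insert (t * s) R)" "?U - insert (t * s) T = insert s R"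
      using T V by (auto simp: R_def)
    have z1: "(\<Prod>x\<in>insert s S. x - s) = 0" if "finite S" for S
      using that by (intro prod_zero) auto
    have z2: "cross t (insert (t * s) T) (insert s R) = 0"
      unfolding cross_def using T R by (intro prod_zero) auto
    have e: "(\<Prod>x\<in>T. x - s) * ((\<Prod>x\<in>T. (x - t * s) / (x - s)) * (\<Prod>x\<in>T. (x - t * (t * s)) / (x - t * s)))
        = (\<Prod>x\<in>T. x - s * t ^ 2)"
      unfolding prod.distrib[symmetric]
    proof (rule prod.cong[OF refl])
      fix x assume "x \<in> T"
      then have "x - s \<noteq> 0" "x - t * s \<noteq> 0" using T by auto
      then show "(x - s) * ((x - t * s) / (x - s) * ((x - t * (t * s)) / (x - t * s))) = x - s * t\<^sup>2"
        by (simp add: power2_eq_square mult_ac)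
    qed
    have card: "card (insert s (insert (t * s) R)) div 2 = Suc (card R div 2)"
      using R R' by simp
    have "zweight t s p (card (insert s (insert (t * s) R)) div 2) * (\<Prod>x\<in>T. x - s)
        * cross t T (insert s (insert (t * s) R)) * Phi t 0 0 T
      = (1 - p + s ^ 2 * t) * (zweight t (s * t ^ 2) (p * t ^ 2) (card R div 2)
        * (\<Prod>x\<in>T. x - s * t ^ 2) * cross t T R * Phi t 0 0 T)"
      unfolding cross_insert_right[OF R'] cross_insert_right[OF R(1,2)] card zweight_Suc e[symmetric]
      by (simp only: mult_ac)
    then show "zweight t s p (card (?U - T) div 2) * (\<Prod>x\<in>T. x - s) * cross t T (?U - T) * Phi t 0 0 T +
        zweight t s p (card (?U - insert s T) div 2) * (\<Prod>x\<in>insert s T. x - s)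
          * cross t (insert s T) (?U - insert s T) * Phi t 0 0 (insert s T) +
        (zweight t s p (card (?U - insert (t * s) T) div 2) * (\<Prod>x\<in>insert (t * s) T. x - s)
          * cross t (insert (t * s) T) (?U - insert (t * s) T) * Phi t 0 0 (insert (t * s) T) +
        zweight t s p (card (?U - insert s (insert (t * s) T)) div 2) * (\<Prod>x\<in>insert s (insert (t * s) T). x - s)
          * cross t (insert s (insert (t * s) T)) (?U - insert s (insert (t * s) T))
          * Phi t 0 0 (insert s (insert (t * s) T)))
      = (1 - p + s ^ 2 * t) * (zweight t (s * t ^ 2) (p * t ^ 2) (card (V - T) div 2)
        * (\<Prod>x\<in>T. x - s * t ^ 2) * cross t T (V - T) * Phi t 0 0 T)"
      unfolding U R_def[symmetric] z1[OF T(2)] z1[OF finite.insertI[OF T(2)]] z2 by simp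
  qed
qed

text \<open>At \<open>x = s\<close> the numerator has the factor \<open>1 - s * y\<close>, which
  cancels the denominator; the value no longer depends on \<open>y\<close>.\<close>

lemma hfac_special:
  assumes "s * y \<noteq> 1"
  shows "hfac t s (t + s ^ 2 - p) s y = 1 - p + s ^ 2 * t"
proof -
  have "hnum t s (t + s ^ 2 - p) s y = (1 - p + s ^ 2 * t) * (1 - s * y)"
    unfolding hnum_def by (simp add: algebra_simps power2_eq_square)
  then show ?thesis using assms by (simp add: hfac_def)
qed

lemma Phi_pair:
  assumes "x \<noteq> y"
  shows "Phi t s \<kappa> {x, y} = hfac t s \<kappa> x y"
  using Phi_expand[of "{y}" x t s \<kappa>] assms by simp

text \<open>The three matchings of \<open>s\<close>, \<open>t * s\<close>, \<open>z\<close>,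
  \<open>w\<close> each contain one constant value of \<open>hfac_special\<close>. After division by
  that constant and clearing of denominators, this identity is what \<open>Phi_four_point\<close>
  amounts to.\<close>

lemma four_point_identity:
  fixes t s p z w :: complex
  defines "\<kappa> \<equiv> t + s ^ 2 - p"
  defines "s' \<equiv> s * t ^ 2"
  shows "s * (1 - t) * (z - w) * (1 - t * s * z) * (1 - t * s * w) * (1 - t * (t * s) * z) * (1 - t * (t * s) * w)
       * hnum t s \<kappa> z w
     - (1 - t * s * (t * s)) * (1 - t * z * (t * s)) * (1 - t * z * w) * (s - z) * (t * s - w) * (1 - z * w)
       * hnum t s \<kappa> (t * s) w
     + (1 - t * s * (t * s)) * (1 - t * w * (t * s)) * (1 - t * z * w) * (s - w) * (t * s - z) * (1 - z * w)
       * hnum t s \<kappa> (t * s) z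
     = s * (1 - t) * (z - w) * (s - z) * (s - w) * (t * s - z) * (t * s - w)
       * hnum t s' (t + s' ^ 2 - p * t ^ 2) z w"
  unfolding \<kappa>_def s'_def hnum_def by algebra

lemma Phi_four_point:
  fixes t s p z w :: complex
  defines "\<kappa> \<equiv> t + s ^ 2 - p"
  assumes ne: "s \<noteq> 0" "t \<noteq> 1" "s \<noteq> z" "s \<noteq> w" "t * s \<noteq> z" "t * s \<noteq> w" "z \<noteq> w"
    and nz: "s * (t * s) \<noteq> 1" "s * z \<noteq> 1" "s * w \<noteq> 1" "t * s * z \<noteq> 1" "t * s * w \<noteq> 1" "z * w \<noteq> 1"
  shows "Phi t s \<kappa> {s, t * s, z, w}
     = (1 - p + s ^ 2 * t) * hfac t (s * t ^ 2) (t + (s * t ^ 2) ^ 2 - p * t ^ 2) z w"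
proof -
  define d1 d2 d3 d4 d5 d6 d7 d8 d9 where d: "d1 = s - t * s" "d2 = s - z" "d3 = s - w" "d4 = t * s - z"
    "d5 = t * s - w" "d6 = z - w" "d7 = 1 - z * w" "d8 = 1 - t * s * z" "d9 = 1 - t * s * w"
  have dnz: "d1 \<noteq> 0" "d2 \<noteq> 0" "d3 \<noteq> 0" "d4 \<noteq> 0" "d5 \<noteq> 0" "d6 \<noteq> 0" "d7 \<noteq> 0" "d8 \<noteq> 0" "d9 \<noteq> 0"
    using ne nz by (simp_all add: d)
  let ?h = "hfac t s \<kappa>" and ?b = "bfac t" and ?c = "1 - p + s ^ 2 * t"
  have ts: "s \<noteq> t * s" using ne by simp
  have "Phi t s \<kappa> {s, t * s, z, w} =
      ?h s (t * s) * (?b s z * ?b (t * s) z * (?b s w * ?b (t * s) w)) * Phi t s \<kappa> {z, w}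
    + ?h s z * (?b s (t * s) * ?b z (t * s) * (?b s w * ?b z w)) * Phi t s \<kappa> {t * s, w}
    + ?h s w * (?b s (t * s) * ?b w (t * s) * (?b s z * ?b w z)) * Phi t s \<kappa> {t * s, z}"
  proof -
    have "{t * s, z, w} - {t * s} = {z, w}" "{t * s, z, w} - {z} = {t * s, w}" "{t * s, z, w} - {w} = {t * s, z}"
      using ne by auto
    then show ?thesis
      using ne ts by (subst Phi_expand) (simp_all add: add.assoc)
  qed
  also have "\<dots> = ?c * (?b s z * ?b (t * s) z * ?b s w * ?b (t * s) w * ?h z w
      + ?b s (t * s) * ?b z (t * s) * ?b s w * ?b z w * ?h (t * s) w
      + ?b s (t * s) * ?b w (t * s) * ?b s z * ?b w z * ?h (t * s) z)"
    using ne nz unfolding \<kappa>_def by (simp add: Phi_pair hfac_special algebra_simps)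
  also have "?b s z * ?b (t * s) z * ?b s w * ?b (t * s) w * ?h z w
      + ?b s (t * s) * ?b z (t * s) * ?b s w * ?b z w * ?h (t * s) w
      + ?b s (t * s) * ?b w (t * s) * ?b s z * ?b w z * ?h (t * s) z
     = hfac t (s * t ^ 2) (t + (s * t ^ 2) ^ 2 - p * t ^ 2) z w"
  proof -
    define n1 n2 n3 n4 where n: "n1 = hnum t s \<kappa> z w" "n2 = hnum t s \<kappa> (t * s) w" "n3 = hnum t s \<kappa> (t * s) z"
      "n4 = hnum t (s * t ^ 2) (t + (s * t ^ 2) ^ 2 - p * t ^ 2) z w"
    define e0 e1 e2 e3 where e: "e0 = 1 - t * s * (t * s)" "e1 = 1 - t * (t * s) * z" "e2 = 1 - t * (t * s) * w"
      "e3 = 1 - t * z * w"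
    have b: "?b s z = d8 / d2" "?b (t * s) z = e1 / d4" "?b s w = d9 / d3" "?b (t * s) w = e2 / d5"
      "?b s (t * s) = e0 / d1" "?b z (t * s) = - (e1 / d4)" "?b z w = e3 / d6"
      "?b w (t * s) = - (e2 / d5)" "?b w z = - (e3 / d6)"
      using bfac_anti[of t z "t * s"] bfac_anti[of t w "t * s"] bfac_anti[of t w z]
      unfolding bfac_def d e by simp_all
    have h: "?h z w = n1 / d7" "?h (t * s) w = n2 / d9" "?h (t * s) z = n3 / d8"
      "hfac t (s * t ^ 2) (t + (s * t ^ 2) ^ 2 - p * t ^ 2) z w = n4 / d7"
      unfolding hfac_def d n by simp_all
    have main: "d1 * d6 * d8 * d9 * e1 * e2 * n1 - e0 * e1 * e3 * d2 * d5 * d7 * n2 + e0 * e2 * e3 * d3 * d4 * d7 * n3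
        = d1 * d6 * d2 * d3 * d4 * d5 * n4"
      using four_point_identity[of s t z w p] unfolding d e n \<kappa>_def by algebra
    have "d8 / d2 * (e1 / d4) * (d9 / d3) * (e2 / d5) * (n1 / d7)
        + e0 / d1 * - (e1 / d4) * (d9 / d3) * (e3 / d6) * (n2 / d9)
        + e0 / d1 * - (e2 / d5) * (d8 / d2) * - (e3 / d6) * (n3 / d8)
      = (d1 * d6 * d8 * d9 * e1 * e2 * n1 - e0 * e1 * e3 * d2 * d5 * d7 * n2 + e0 * e2 * e3 * d3 * d4 * d7 * n3)
        / (d1 * d6 * d2 * d3 * d4 * d5 * d7)"
      using dnz by (simp add: divide_simps)
    also have "\<dots> = n4 / d7" unfolding main using dnz by simp
    finally show ?thesis unfolding b h .
  qed
  finally show ?thesis .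
qed

text \<open>The condition on \<open>t * x * y\<close> keeps \<open>bfac\<close> nonzero and so
  concerns distinct elements; \<open>x * y = 1\<close> is excluded for \<open>x = y\<close> as well,
  so that the points \<open>k\<close> and \<open>1 / k\<close> are always different zeros.\<close>

definition admissible :: "complex \<Rightarrow> complex set \<Rightarrow> bool" where
  "admissible t U \<longleftrightarrow> finite U \<and> (\<forall>x\<in>U. \<forall>y\<in>U. x * y \<noteq> 1 \<and> (x \<noteq> y \<longrightarrow> t * x * y \<noteq> 1))"

lemma admissible_subset: "admissible t U \<Longrightarrow> V \<subseteq> U \<Longrightarrow> admissible t V"
  unfolding admissible_def by (auto intro: finite_subset)

lemma admissible_finite: "admissible t U \<Longrightarrow> finite U"
  by (simp add: admissible_def)

text \<open>Tanner's relation with \<open>p = s\<close>, \<open>q = t * s\<close> expresses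
  \<open>?c * Phi\<close> by four-point minors and smaller instances of the claim. Inserting
  \<open>Phi_four_point\<close> and the induction hypothesis leaves \<open>?c ^ 2\<close> times the
  row expansion of \<open>?Phi'\<close> along \<open>z\<close>.\<close>

lemma Phi_eval:
  assumes U: "admissible t (insert s (insert (t * s) V))"
    and ne: "s \<notin> V" "t * s \<notin> V" "s \<noteq> 0" "t \<noteq> 1"
  shows "Phi t s (t + s ^ 2 - p) (insert s (insert (t * s) V))
     = (1 - p + s ^ 2 * t) * Phi t (s * t ^ 2) (t + (s * t ^ 2) ^ 2 - p * t ^ 2) V"
proof -
  let ?\<kappa> = "t + s ^ 2 - p" and ?c = "1 - p + s ^ 2 * t"
  let ?Phi' = "Phi t (s * t ^ 2) (t + (s * t ^ 2) ^ 2 - p * t ^ 2)"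
  have ts: "s \<noteq> t * s" using ne by simp
  show ?thesis
  proof (cases "?c = 0")
    \<comment> \<open>Tanner's relation would require division by \<open>?c\<close>; but if
      \<open>?c = 0\<close>, the whole row of \<open>s\<close> vanishes and both sides are
      0.\<close>
    case True
    have V: "finite (insert (t * s) V)" "s \<notin> insert (t * s) V"
      using admissible_finite[OF U] ne ts by auto
    have "hfac t s ?\<kappa> s y = 0" if "y \<in> insert (t * s) V" for y
      using U that True by (subst hfac_special) (auto simp: admissible_def)
    then show ?thesis unfolding Phi_expand[OF V] True by simp
  next
    case c: False
    have "finite V" using admissible_finite[OF U] by simp
    then show ?thesis using U ne
    proof (induction V rule: finite_psubset_induct)
      case (psubset V)
      show ?case
      proof (cases "V = {}")
        case True
        have "s * (t * s) \<noteq> 1" using psubset.prems(1) by (auto simp: admissible_def)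
        then show ?thesis using True ts by (simp add: Phi_pair hfac_special)
      next
        case False
        then obtain z where z: "z \<in> V" by auto
        define W where "W = V - {z}"
        have W: "V = insert z W" "z \<notin> W" "finite W" using z psubset.hyps by (auto simp: W_def)
        have adm: "admissible t (insert s (insert (t * s) (insert z W)))" using psubset.prems(1) W by simp
        have ne': "s \<noteq> z" "t * s \<noteq> z" "s \<notin> W" "t * s \<notin> W" using psubset.prems W by auto
        have IH: "Phi t s ?\<kappa> ({s, t * s} \<union> (W - {w})) = ?c * ?Phi' (W - {w})" for w
        proof -
          have "Phi t s ?\<kappa> (insert s (insert (t * s) (W - {w}))) = ?c * ?Phi' (W - {w})"
          proof (rule psubset.IH)
            show "W - {w} \<subset> V" using W by auto
            show "admissible t (insert s (insert (t * s) (W - {w})))"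
              by (rule admissible_subset[OF adm]) auto
          qed (use ne ne' in auto)
          moreover have "{s, t * s} \<union> (W - {w}) = insert s (insert (t * s) (W - {w}))" by auto
          ultimately show ?thesis by (simp only:)
        qed
        have nz: "bfac t x y \<noteq> 0" if "x \<in> {s, t * s, z} \<union> W" "y \<in> {s, t * s, z} \<union> W" "x \<noteq> y" for x y
        proof -
          have "t * x * y \<noteq> 1" using adm that unfolding admissible_def by blast
          then show ?thesis using that(3) by (simp add: bfac_def)
        qed
        have "?c * Phi t s ?\<kappa> ({s, t * s} \<union> insert z W)
            = Phi t s ?\<kappa> {s, t * s} * Phi t s ?\<kappa> ({s, t * s} \<union> insert z W)"
          using adm ts by (simp add: Phi_pair hfac_special admissible_def)
        also have "\<dots> = (\<Sum>w\<in>W. Phi t s ?\<kappa> {s, t * s, z, w} * (\<Prod>k\<in>W - {w}. bfac t z k * bfac t w k)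
            * Phi t s ?\<kappa> ({s, t * s} \<union> (W - {w})))"
          unfolding Phi_def by (rule matchsum_tanner) (use W ne' ts nz in auto)
        also have "\<dots> = (\<Sum>w\<in>W. ?c * (?c * (hfac t (s * t ^ 2) (t + (s * t ^ 2) ^ 2 - p * t ^ 2) z w
            * (\<Prod>k\<in>W - {w}. bfac t z k * bfac t w k) * ?Phi' (W - {w}))))"
        proof (rule sum.cong[OF refl])
          fix w assume w: "w \<in> W"
          have "Phi t s ?\<kappa> {s, t * s, z, w} = ?c * hfac t (s * t ^ 2) (t + (s * t ^ 2) ^ 2 - p * t ^ 2) z w"
            by (rule Phi_four_point) (use w ne ne' W adm in \<open>auto simp: admissible_def\<close>)
          then show "Phi t s ?\<kappa> {s, t * s, z, w} * (\<Prod>k\<in>W - {w}. bfac t z k * bfac t w k)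
            * Phi t s ?\<kappa> ({s, t * s} \<union> (W - {w})) =
            ?c * (?c * (hfac t (s * t ^ 2) (t + (s * t ^ 2) ^ 2 - p * t ^ 2) z w
            * (\<Prod>k\<in>W - {w}. bfac t z k * bfac t w k) * ?Phi' (W - {w})))"
            unfolding IH by (simp only: mult_ac)
        qed
        also have "\<dots> = ?c * (?c * ?Phi' (insert z W))"
          unfolding Phi_expand[OF W(3,2)] by (simp only: sum_distrib_left)
        finally have "Phi t s ?\<kappa> ({s, t * s} \<union> insert z W) = ?c * ?Phi' (insert z W)"
          using c by (simp only: mult_cancel_left) simp
        moreover have "{s, t * s} \<union> insert z W = insert s (insert (t * s) (insert z W))" by auto
        ultimately show ?thesis by (simp only: W(1))
      qed
    qed
  qed
qed

section \<open>Exchanging one variable for another\<close>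

definition identity_at :: "complex \<Rightarrow> complex \<Rightarrow> complex \<Rightarrow> complex set \<Rightarrow> bool" where
  "identity_at t s p U \<longleftrightarrow> Phi t s (t + s ^ 2 - p) U = Rsum t s p U"

text \<open>The known point \<open>e\<close> together with all \<open>k\<close> and
  \<open>1 / k\<close> gives \<open>2 * card V + 1\<close> zeros of a polynomial of degree at most
  \<open>2 * card V\<close>. The assumptions on \<open>V\<close> and \<open>e\<close> make these
  points distinct.\<close>

lemma identity_extend:
  assumes V: "admissible t V" "0 \<notin> V"
    and IH: "\<And>y. y \<in> V \<Longrightarrow> identity_at t s p (V - {y})"
    and e: "e \<notin> V" "\<And>k. k \<in> V \<Longrightarrow> e * k \<noteq> 1" "identity_at t s p (insert e V)"
    and x: "x \<notin> V" "\<And>k. k \<in> V \<Longrightarrow> x * k \<noteq> 1"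
  shows "identity_at t s p (insert x V)"
proof -
  let ?\<kappa> = "t + s ^ 2 - p"
  have fin: "finite V" by (rule admissible_finite[OF V(1)])
  have ne1: "y * k \<noteq> 1" if "y \<in> V" "k \<in> V" for y k
    using V(1) that by (auto simp: admissible_def)
  define F where "F = (\<lambda>x. Phi_poly t s ?\<kappa> V x - Rsum_poly t s p V x)"
  let ?Z = "insert e (V \<union> (\<lambda>y. 1 / y) ` V)"
  have "polyfun (2 * card V) F"
    unfolding F_def by (intro polyfun_diff Phi_poly_degree Rsum_poly_degree fin)
  moreover have "finite ?Z" using fin by simp
  moreover have "card ?Z > 2 * card V"
  proof -
    have "1 / y \<notin> V" if "y \<in> V" for y using ne1[of y "1 / y"] that V(2) by (cases "y = 0") auto
    then have "V \<inter> (\<lambda>y. 1 / y) ` V = {}" by auto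
    then have "card (V \<union> (\<lambda>y. 1 / y) ` V) = card V + card ((\<lambda>y. 1 / y) ` V)"
      using fin by (intro card_Un_disjoint) auto
    also have "card ((\<lambda>y. 1 / y) ` V) = card V"
      by (rule card_image) (auto simp: inj_on_def)
    finally have "card (V \<union> (\<lambda>y. 1 / y) ` V) = 2 * card V" by simp
    moreover have "e \<notin> V \<union> (\<lambda>y. 1 / y) ` V"
    proof
      assume "e \<in> V \<union> (\<lambda>y. 1 / y) ` V"
      then obtain y where "y \<in> V" "e = 1 / y" using e(1) by auto
      then show False using e(2)[of y] V(2) by (cases "y = 0") auto
    qed
    ultimately show ?thesis using fin by simp
  qed
  moreover have "F z = 0" if "z \<in> ?Z" for z
  proof -
    from that consider "z = e" | "z \<in> V" | y where "y \<in> V" "z = 1 / y" by auto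
    then show ?thesis
    proof cases
      case 1
      have "Phi_poly t s ?\<kappa> V e = Rsum_poly t s p V e"
        using e fin by (simp add: Phi_poly_eq Rsum_poly_eq identity_at_def)
      with 1 show ?thesis by (simp add: F_def)
    next
      case 2
      define W where "W = V - {z}"
      have W: "V = insert z W" "finite W" "z \<notin> W" using 2 fin by (auto simp: W_def)
      then show ?thesis using ne1[OF 2] unfolding F_def W(1)
        by (subst Phi_poly_zero Rsum_poly_zero, simp_all)+
    next
      case 3
      define W where "W = V - {y}"
      have W: "V = insert y W" "finite W" "y \<notin> W" using 3 fin by (auto simp: W_def)
      have "y \<noteq> 0" using 3 V(2) by auto
      moreover have "Phi t s ?\<kappa> W = Rsum t s p W" using IH[OF 3(1)] by (simp add: identity_at_def W_def)
      ultimately show ?thesis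
        unfolding F_def 3(2) W(1) by (simp add: Phi_poly_inverse[OF W(2,3)] Rsum_poly_inverse[OF W(2,3)])
    qed
  qed
  ultimately have "F x = 0" by (rule polyfun_zero)
  then have "Phi t s ?\<kappa> (insert x V) * (\<Prod>k\<in>V. (x - k) * (1 - x * k))
      = Rsum t s p (insert x V) * (\<Prod>k\<in>V. (x - k) * (1 - x * k))"
    using x fin by (simp add: F_def Phi_poly_eq Rsum_poly_eq)
  moreover have "(\<Prod>k\<in>V. (x - k) * (1 - x * k)) \<noteq> 0"
    using x fin by auto
  ultimately show ?thesis by (simp add: identity_at_def)
qed

text \<open>
  For these \<open>s\<close> the numbers \<open>s\<close> and \<open>t s\<close> are available as additional zeros.
\<close>

definition generic :: "complex \<Rightarrow> complex set \<Rightarrow> complex \<Rightarrow> bool" where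
  "generic t V s \<longleftrightarrow> admissible t (insert s (insert (t * s) V)) \<and> s \<notin> V \<and> t * s \<notin> V \<and> s \<noteq> 0"

text \<open>Each way of failing to be generic, apart from \<open>s = 0\<close>, is an equation for
  \<open>s\<close> of the form \<open>s = c\<close>, \<open>s * k = c\<close> or
  \<open>s * s = c\<close> with \<open>k\<close> in \<open>V\<close> and \<open>c\<close> from a
  finite set, with \<open>c\<close> nonzero in the equations \<open>s * k = c\<close>.\<close>

lemma finite_not_generic:
  assumes V: "admissible t V" and t: "t \<noteq> 0"
  shows "finite {s. \<not> generic t V s}"
proof -
  have fin: "finite V" by (rule admissible_finite[OF V])
  have sq: "finite {s. s * s = c}" for c :: complex
  proof (rule finite_subset)
    show "{s. s * s = c} \<subseteq> {csqrt c, - csqrt c}"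
    proof
      fix x assume "x \<in> {s. s * s = c}"
      then have "x\<^sup>2 = (csqrt c)\<^sup>2" by (simp add: power2_eq_square[of x])
      then have "x = csqrt c \<or> x = - csqrt c" by (rule power2_eq_iff[THEN iffD1])
      then show "x \<in> {csqrt c, - csqrt c}" by simp
    qed
  qed simp
  have lin: "finite {s. \<exists>k\<in>V. s * k = c}" if "c \<noteq> 0" for c
  proof (rule finite_subset)
    show "{s. \<exists>k\<in>V. s * k = c} \<subseteq> (\<lambda>k. c / k) ` V"
    proof
      fix x assume "x \<in> {s. \<exists>k\<in>V. s * k = c}"
      then obtain k where "k \<in> V" "x * k = c" by auto
      with that show "x \<in> (\<lambda>k. c / k) ` V" by (intro image_eqI[of _ _ k]) (auto simp: field_simps)
    qed
  qed (use fin in simp)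
  have "{s. \<not> generic t V s} \<subseteq> {0} \<union> V \<union> (\<lambda>k. k / t) ` V
      \<union> {s. s * s = 1} \<union> {s. s * s = 1 / t} \<union> {s. s * s = 1 / t ^ 2}
      \<union> {s. \<exists>k\<in>V. s * k = 1} \<union> {s. \<exists>k\<in>V. s * k = 1 / t} \<union> {s. \<exists>k\<in>V. s * k = 1 / t ^ 2}" (is "_ \<subseteq> ?E")
  proof (rule subsetI, rule ccontr)
    fix s assume "s \<in> {s. \<not> generic t V s}" and s: "s \<notin> ?E"
    have 1: "s \<noteq> 0" "s \<notin> V" "s * s \<noteq> 1" "\<And>k. k \<in> V \<Longrightarrow> s * k \<noteq> 1" using s by auto
    have 2: "t * s \<notin> V" using s t by (auto simp: image_iff)
    have 3: "t * (s * s) \<noteq> 1" "\<And>k. k \<in> V \<Longrightarrow> t * (s * k) \<noteq> 1" using s t by (auto simp: field_simps)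
    have 4: "t * (t * (s * s)) \<noteq> 1" "\<And>k. k \<in> V \<Longrightarrow> t * (t * (s * k)) \<noteq> 1"
      using s t by (auto simp: field_simps power2_eq_square)
    have "generic t V s"
      using V 1 2 3 4 unfolding generic_def admissible_def by (auto simp: mult_ac)
    then show False using \<open>s \<in> {s. \<not> generic t V s}\<close> by simp
  qed
  then show ?thesis
    by (rule finite_subset) (use fin t in \<open>intro finite_UnI sq lin finite_imageI; simp\<close>)
qed

section \<open>From generic \<open>s\<close> to all \<open>s\<close>\<close>

text \<open>The parameter \<open>s\<close> occurs in numerators only, so the denominators are
  constants and cause no discontinuity. \<open>\<kappa>\<close> is a function here because fixing
  \<open>p\<close> makes it vary with \<open>s\<close>.\<close>

lemma continuous_match_weight:
  assumes "continuous_on UNIV \<kappa>"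
  shows "continuous_on UNIV (\<lambda>s. match_weight (hfac t s (\<kappa> s)) (bfac t) xs)"
  by (induction xs rule: induct_list012)
    (auto simp: hfac_def hnum_def divide_inverse intro!: continuous_intros assms)

lemma continuous_Phi:
  assumes "continuous_on UNIV \<kappa>"
  shows "continuous_on UNIV (\<lambda>s. Phi t s (\<kappa> s) U)"
  unfolding Phi_def matchsum_def
  by (intro continuous_intros continuous_match_weight assms) auto

lemma continuous_vanish_off_finite:
  fixes f :: "complex \<Rightarrow> complex"
  assumes "continuous_on UNIV f" "finite S" "\<And>x. x \<notin> S \<Longrightarrow> f x = 0"
  shows "f x = 0"
proof -
  have "closure (- S) = UNIV"
    using assms(2) by (simp add: closure_complement empty_interior_finite)
  then show ?thesis
    using assms by (intro continuous_constant_on_closure[of "- S" f 0 x]) auto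
qed

lemma one_step_identity:
  assumes t: "t \<noteq> 0" "t \<noteq> 1" and "admissible t U" "even (card U)"
  shows "Phi t s (t + s ^ 2 - p) U = Rsum t s p U"
proof -
  have "identity_at t s p U" if "admissible t U" "card U = 2 * n" for n
    using that
  proof (induction n arbitrary: U s p)
    case 0
    then have "U = {}" by (simp add: admissible_finite)
    then show ?case by (simp add: identity_at_def Rsum_def zweight_def cross_def)
  next
    case (Suc n)
    have fin: "finite U" by (rule admissible_finite[OF Suc.prems(1)])
    have "U \<noteq> {}" using Suc.prems(2) by auto
    \<comment> \<open>If 0 is among the variables, it is the one singled out as \<open>x\<close>, so
      that every element of \<open>V\<close> has an inverse.\<close>
    then obtain x where x: "x \<in> U" "0 \<in> U \<Longrightarrow> x = 0" by (cases "0 \<in> U") auto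
    define V where "V = U - {x}"
    have V: "U = insert x V" "x \<notin> V" "0 \<notin> V" "finite V" "card V = 2 * n + 1"
      using x fin Suc.prems(2) by (auto simp: V_def)
    have admV: "admissible t V" by (rule admissible_subset[OF Suc.prems(1)]) (auto simp: V(1))
    obtain z where z: "z \<in> V" using V(5) by fastforce
    define W where "W = V - {z}"
    have W: "V = insert z W" "z \<notin> W" "finite W" "card W = 2 * n"
      using z V by (auto simp: W_def)
    have gen: "identity_at t s p U" if g: "generic t V s" for s
    proof -
      have adm: "admissible t (insert s (insert (t * s) V))" and sne: "s \<notin> V" "t * s \<notin> V" "s \<noteq> 0"
        using g by (auto simp: generic_def)
      have ts: "s \<noteq> t * s" "t * s \<noteq> 0" using sne t by auto
      have ne1: "a * k \<noteq> 1" if "a \<in> insert s (insert (t * s) V)" "k \<in> insert s (insert (t * s) V)" for a k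
        using adm that unfolding admissible_def by blast
      have admW: "admissible t (insert s (insert (t * s) W))"
        by (rule admissible_subset[OF adm]) (auto simp: W(1))
      \<comment> \<open>Starting point: both evaluations extract the same factor, and the rescaled
        parameters are covered by the induction hypothesis for \<open>W\<close>.\<close>
      have sW: "identity_at t s p (insert s (insert (t * s) W))"
      proof -
        have "identity_at t (s * t ^ 2) (p * t ^ 2) W"
          by (rule Suc.IH) (use W in \<open>auto intro: admissible_subset[OF adm]\<close>)
        then show ?thesis
          using Phi_eval[OF admW] Rsum_eval[of W s t] W sne t ts
          by (simp add: identity_at_def)
      qed
      \<comment> \<open>Here \<open>s\<close> is the known zero and is exchanged for
        \<open>z\<close>, while \<open>t * s\<close> stays among the other variables.\<close>
      have tsV: "identity_at t s p (insert z (insert (t * s) W))"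
      proof (rule identity_extend[where e = s])
        show "identity_at t s p (insert s (insert (t * s) W))" by (rule sW)
        show "admissible t (insert (t * s) W)" by (rule admissible_subset[OF admW]) auto
        show "identity_at t s p (insert (t * s) W - {y})" if "y \<in> insert (t * s) W" for y
          by (rule Suc.IH)
            (use that W sne in \<open>auto intro: admissible_subset[OF admW] simp: card_Diff_singleton\<close>)
        show "s * k \<noteq> 1" if "k \<in> insert (t * s) W" for k
          by (rule ne1) (use that W(1) in auto)
        show "z * k \<noteq> 1" if "k \<in> insert (t * s) W" for k
          by (rule ne1) (use that W(1) in auto)
      qed (use sne ts W V(3) in auto)
      \<comment> \<open>The second exchange: \<open>t * s\<close> is now the known zero and gives
        way to \<open>x\<close>.\<close>
      have "identity_at t s p (insert x V)"
      proof (rule identity_extend[where e = "t * s"])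
        show "admissible t V" by (rule admV)
        show "identity_at t s p (V - {y})" if "y \<in> V" for y
          by (rule Suc.IH) (use that V in \<open>auto intro: admissible_subset[OF admV] simp: card_Diff_singleton\<close>)
        show "identity_at t s p (insert (t * s) V)"
          using tsV W(1) by (simp add: insert_commute)
        show "x * k \<noteq> 1" if "k \<in> V" for k
          using Suc.prems(1) that V(1) by (auto simp: admissible_def)
        show "t * s * k \<noteq> 1" if "k \<in> V" for k
          by (rule ne1) (use that in auto)
      qed (use sne V in auto)
      then show ?thesis by (simp add: V(1))
    qed
    \<comment> \<open>With \<open>p\<close> held fixed, both sides are continuous in
      \<open>s\<close>, and only finitely many \<open>s\<close> fail to be generic.\<close>
    have "Phi t s (t + s ^ 2 - p) U - Rsum t s p U = 0"
    proof (rule continuous_vanish_off_finite[where x = s])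
      show "continuous_on UNIV (\<lambda>s. Phi t s (t + s ^ 2 - p) U - Rsum t s p U)"
        unfolding Rsum_def zweight_def by (intro continuous_intros continuous_Phi)
      show "finite {s. \<not> generic t V s}" by (rule finite_not_generic[OF admV t(1)])
    qed (use gen in \<open>auto simp: identity_at_def\<close>)
    then show ?case by (simp add: identity_at_def)
  qed
  then show ?thesis using assms by (auto simp: identity_at_def elim: evenE)
qed

section \<open>Splitting off the zero parts\<close>

definition hlfac :: "complex \<Rightarrow> complex \<Rightarrow> complex \<Rightarrow> complex" where
  "hlfac t x y = (x - t * y) / (x - y)"

text \<open>As a function of \<open>a\<close> the product tends to 1 at infinity, and its simple
  pole at \<open>a = x\<close> has residue \<open>(1 - t) * x\<close> times the product over the
  other elements.\<close>

lemma hlfac_partial_fractions: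
  assumes "finite I" "a \<notin> I"
  shows "(\<Prod>y\<in>I. hlfac t a y) = 1 + (1 - t) * (\<Sum>x\<in>I. x / (a - x) * (\<Prod>y\<in>I - {x}. hlfac t x y))"
  using assms
proof (induction I arbitrary: a rule: finite_induct)
  case (insert z I)
  let ?P = "\<lambda>x. \<Prod>y\<in>I - {x}. hlfac t x y"
  have az: "a \<noteq> z" "a \<notin> I" using insert by auto
  \<comment> \<open>Partial fractions in \<open>a\<close> for the two poles \<open>x\<close> and
    \<open>z\<close>.\<close>
  have key: "hlfac t a z * (x / (a - x)) = x / (a - x) * hlfac t x z + (1 - t) * z / (a - z) * (x / (z - x))"
    if "x \<in> I" for x
  proof -
    have nz: "a - x \<noteq> 0" "a - z \<noteq> 0" "x - z \<noteq> 0" using that az insert.hyps by auto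
    have swap: "z - x = - (x - z)" by simp
    show ?thesis
      unfolding hlfac_def swap divide_minus_right using nz by (simp add: divide_simps) (simp add: algebra_simps)
  qed
  have z: "hlfac t a z = 1 + (1 - t) * z / (a - z)"
    using az by (simp add: hlfac_def field_simps)
  have I: "insert z I - {x} = insert z (I - {x})" if "x \<in> I" for x using that insert.hyps by auto
  have sum: "(\<Sum>x\<in>insert z I. x / (a - x) * (\<Prod>y\<in>insert z I - {x}. hlfac t x y))
      = z / (a - z) * (\<Prod>y\<in>I. hlfac t z y) + (\<Sum>x\<in>I. x / (a - x) * (hlfac t x z * ?P x))"
    using insert.hyps by (simp add: I)
  have "(\<Prod>y\<in>insert z I. hlfac t a y)
      = hlfac t a z * (1 + (1 - t) * (\<Sum>x\<in>I. x / (a - x) * ?P x))"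
    using insert.hyps insert.IH[of a] az by simp
  also have "\<dots> = hlfac t a z + (1 - t) * (\<Sum>x\<in>I. hlfac t a z * (x / (a - x)) * ?P x)"
    by (simp add: distrib_left sum_distrib_left mult_ac)
  also have "(\<Sum>x\<in>I. hlfac t a z * (x / (a - x)) * ?P x)
      = (\<Sum>x\<in>I. x / (a - x) * (hlfac t x z * ?P x) + (1 - t) * z / (a - z) * (x / (z - x) * ?P x))"
  proof (rule sum.cong[OF refl])
    fix x assume "x \<in> I"
    show "hlfac t a z * (x / (a - x)) * ?P x
      = x / (a - x) * (hlfac t x z * ?P x) + (1 - t) * z / (a - z) * (x / (z - x) * ?P x)"
      unfolding key[OF \<open>x \<in> I\<close>] by (simp only: distrib_right mult.assoc)
  qed
  also have "\<dots> = (\<Sum>x\<in>I. x / (a - x) * (hlfac t x z * ?P x))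
      + (1 - t) * z / (a - z) * (\<Sum>x\<in>I. x / (z - x) * ?P x)"
    by (simp add: sum.distrib sum_distrib_left)
  also have "(1 - t) * z / (a - z) * (\<Sum>x\<in>I. x / (z - x) * ?P x)
      = z / (a - z) * ((\<Prod>y\<in>I. hlfac t z y) - 1)"
    using insert.IH[of z] insert.hyps by simp
  finally show ?case unfolding sum z by (simp add: algebra_simps)
qed simp

text \<open>When \<open>a\<close> is added, write
  \<open>hlfac t x a = t - (1 - t) * x / (a - x)\<close>. The pole parts cancel against the partial
  fractions of the new term, and the sum \<open>S\<close> over \<open>I\<close> becomes
  \<open>1 + t * S\<close>.\<close>

lemma sum_prod_hlfac:
  assumes "finite I"
  shows "(1 - t) * (\<Sum>x\<in>I. \<Prod>y\<in>I - {x}. hlfac t x y) = 1 - t ^ card I"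
  using assms
proof (induction I rule: finite_induct)
  case (insert a I)
  let ?P = "\<lambda>x. \<Prod>y\<in>I - {x}. hlfac t x y"
  have I: "insert a I - {x} = insert a (I - {x})" if "x \<in> I" for x using that insert.hyps by auto
  have split: "hlfac t x a * ?P x = t * ?P x - (1 - t) * (x / (a - x) * ?P x)" if "x \<in> I" for x
  proof -
    have "a - x \<noteq> 0" "x - a \<noteq> 0" using that insert.hyps by auto
    then have "hlfac t x a = t - (1 - t) * (x / (a - x))"
      unfolding hlfac_def by (simp add: divide_simps) (simp add: algebra_simps)
    then show ?thesis by (simp only: left_diff_distrib mult.assoc)
  qed
  have "(\<Sum>x\<in>insert a I. \<Prod>y\<in>insert a I - {x}. hlfac t x y)
      = (\<Prod>y\<in>I. hlfac t a y) + (\<Sum>x\<in>I. hlfac t x a * ?P x)"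
    using insert.hyps by (simp add: I)
  also have "(\<Sum>x\<in>I. hlfac t x a * ?P x) = (\<Sum>x\<in>I. t * ?P x - (1 - t) * (x / (a - x) * ?P x))"
    by (rule sum.cong[OF refl split])
  also have "\<dots> = t * (\<Sum>x\<in>I. ?P x) - (1 - t) * (\<Sum>x\<in>I. x / (a - x) * ?P x)"
    by (simp only: sum_subtractf sum_distrib_left)
  also have "(\<Prod>y\<in>I. hlfac t a y) = 1 + (1 - t) * (\<Sum>x\<in>I. x / (a - x) * ?P x)"
    by (rule hlfac_partial_fractions[OF insert.hyps])
  finally have "(\<Sum>x\<in>insert a I. \<Prod>y\<in>insert a I - {x}. hlfac t x y) = 1 + t * (\<Sum>x\<in>I. ?P x)"
    by simp
  then have "(1 - t) * (\<Sum>x\<in>insert a I. \<Prod>y\<in>insert a I - {x}. hlfac t x y)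
      = 1 - t + t * ((1 - t) * (\<Sum>x\<in>I. ?P x))" by (simp add: algebra_simps)
  also have "\<dots> = 1 - t ^ card (insert a I)"
    unfolding insert.IH using insert.hyps by (simp add: algebra_simps)
  finally show ?case .
qed simp

text \<open>Peeling off the first variable contributes \<open>1 - t ^ k\<close> when
  \<open>k\<close> variables are left. This produces the \<open>t_pochhammer\<close> factor that the
  theorem divides out for the zero parts.\<close>

lemma sum_pairprod_hlfac:
  assumes "finite I"
  shows "(1 - t) ^ card I * (\<Sum>xs\<in>permutations_of_set I. pairprod (hlfac t) xs)
       = t_pochhammer t t (card I)"
  using assms
proof (induction "card I" arbitrary: I)
  case 0
  then show ?case by (simp add: t_pochhammer_def)
next
  case (Suc n)
  then have "I \<noteq> {}" by auto
  have "(\<Sum>xs\<in>permutations_of_set I. pairprod (hlfac t) xs)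
      = (\<Sum>x\<in>I. \<Sum>xs\<in>permutations_of_set (I - {x}). (\<Prod>y\<in>I - {x}. hlfac t x y) * pairprod (hlfac t) xs)"
    unfolding sum_permutations_of_set_Cons[OF Suc.prems \<open>I \<noteq> {}\<close>]
    by (intro sum.cong refl) (auto simp: permutations_of_set_def prod.distinct_set_conv_list[symmetric])
  then have "(1 - t) ^ n * (\<Sum>xs\<in>permutations_of_set I. pairprod (hlfac t) xs)
      = (\<Sum>x\<in>I. (\<Prod>y\<in>I - {x}. hlfac t x y)
          * ((1 - t) ^ n * (\<Sum>xs\<in>permutations_of_set (I - {x}). pairprod (hlfac t) xs)))"
    by (simp add: sum_distrib_left mult_ac)
  also have "\<dots> = (\<Sum>x\<in>I. (\<Prod>y\<in>I - {x}. hlfac t x y) * t_pochhammer t t n)"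
  proof (rule sum.cong[OF refl])
    fix x assume "x \<in> I"
    then have "n = card (I - {x})" using Suc by simp
    then show "(\<Prod>y\<in>I - {x}. hlfac t x y)
          * ((1 - t) ^ n * (\<Sum>xs\<in>permutations_of_set (I - {x}). pairprod (hlfac t) xs))
      = (\<Prod>y\<in>I - {x}. hlfac t x y) * t_pochhammer t t n"
      using Suc.hyps(1)[of "I - {x}"] Suc.prems by simp
  qed
  finally have "(1 - t) ^ card I * (\<Sum>xs\<in>permutations_of_set I. pairprod (hlfac t) xs)
      = ((1 - t) * (\<Sum>x\<in>I. \<Prod>y\<in>I - {x}. hlfac t x y)) * t_pochhammer t t n"
    unfolding Suc.hyps(2)[symmetric] by (simp add: sum_distrib_right mult.assoc)
  also have "\<dots> = t_pochhammer t t (card I)"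
    unfolding sum_prod_hlfac[OF Suc.prems] unfolding Suc.hyps(2)[symmetric]
    by (simp add: t_pochhammer_def mult.commute)
  finally show ?case .
qed

section \<open>Spin Hall-Littlewood functions on sets of variables\<close>

definition row_weight :: "complex \<Rightarrow> (nat \<Rightarrow> complex) \<Rightarrow> nat \<Rightarrow> complex \<Rightarrow> complex" where
  "row_weight t s l x = (1 - t) / (1 - s l * x) * (\<Prod>j<l. (x - s j) / (1 - s j * x))"

definition spin_weight :: "complex \<Rightarrow> (nat \<Rightarrow> complex) \<Rightarrow> nat list \<Rightarrow> complex list \<Rightarrow> complex" where
  "spin_weight t s lam xs = pairprod (hlfac t) xs * (\<Prod>(l, x)\<leftarrow>zip lam xs. row_weight t s l x)"

definition spin_sym :: "complex \<Rightarrow> (nat \<Rightarrow> complex) \<Rightarrow> nat list \<Rightarrow> complex set \<Rightarrow> complex" where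
  "spin_sym t s lam U = (\<Sum>xs\<in>permutations_of_set U. spin_weight t s lam xs)"

lemma row_weight_Suc:
  "row_weight t s (Suc l) x = (x - s 0) / (1 - s 0 * x) * row_weight t (s \<circ> Suc) l x"
  unfolding row_weight_def prod.lessThan_Suc_shift by (simp add: mult_ac)

lemma prod_row_weight_Suc:
  assumes "length \<mu> = length ys"
  shows "(\<Prod>(l, x)\<leftarrow>zip (map Suc \<mu>) ys. row_weight t s l x)
     = (\<Prod>x\<leftarrow>ys. (x - s 0) / (1 - s 0 * x)) * (\<Prod>(l, x)\<leftarrow>zip \<mu> ys. row_weight t (s \<circ> Suc) l x)"
  using assms by (induction \<mu> ys rule: list_induct2) (simp_all add: row_weight_Suc comp_def)

lemma spin_weight_append:
  assumes "length \<mu> = length ys" "length zs = m"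
  shows "spin_weight t s (map Suc \<mu> @ replicate m 0) (ys @ zs) =
     (\<Prod>x\<leftarrow>ys. \<Prod>y\<leftarrow>zs. hlfac t x y) * (\<Prod>x\<leftarrow>ys. (x - s 0) / (1 - s 0 * x))
     * spin_weight t (s \<circ> Suc) \<mu> ys * (pairprod (hlfac t) zs * (\<Prod>x\<leftarrow>zs. (1 - t) / (1 - s 0 * x)))"
proof -
  have "zip (map Suc \<mu> @ replicate m 0) (ys @ zs) = zip (map Suc \<mu>) ys @ map (Pair 0) zs"
    using assms by (simp add: zip_replicate1)
  moreover have "(\<Prod>(l, x)\<leftarrow>map (Pair 0) zs. row_weight t s l x) = (\<Prod>x\<leftarrow>zs. (1 - t) / (1 - s 0 * x))"
    by (simp add: row_weight_def comp_def)
  ultimately show ?thesis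
    unfolding spin_weight_def pairprod_append
    by (simp only: map_append prod_list.append prod_row_weight_Suc[OF assms(1)] mult_ac)
qed

text \<open>All zero rows carry the same factor \<open>(1 - t) / (1 - s 0 * x)\<close>, so the
  orderings of their variables enter through \<open>pairprod\<close> alone and are summed by
  \<open>sum_pairprod_hlfac\<close>. The set \<open>T\<close> holds the variables in nonzero rows,
  whose parts drop by one as the parameters shift.\<close>

lemma spin_sym_split:
  assumes "finite U" "card U = length \<mu> + m"
  shows "spin_sym t s (map Suc \<mu> @ replicate m 0) U =
    (\<Sum>T | T \<subseteq> U \<and> card T = length \<mu>. cross t T (U - T) * (\<Prod>x\<in>T. (x - s 0) / (1 - s 0 * x))
       * spin_sym t (s \<circ> Suc) \<mu> T * (t_pochhammer t t m * (\<Prod>x\<in>U - T. 1 / (1 - s 0 * x))))"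
proof -
  let ?g = "\<lambda>ys zs. spin_weight t s (map Suc \<mu> @ replicate m 0) (ys @ zs)"
  have "spin_sym t s (map Suc \<mu> @ replicate m 0) U
      = (\<Sum>xs\<in>permutations_of_set U. ?g (take (length \<mu>) xs) (drop (length \<mu>) xs))"
    by (simp add: spin_sym_def)
  also have "\<dots> = (\<Sum>T | T \<subseteq> U \<and> card T = length \<mu>.
      \<Sum>ys\<in>permutations_of_set T. \<Sum>zs\<in>permutations_of_set (U - T). ?g ys zs)"
    by (rule sum_permutations_of_set_split) (use assms in auto)
  also have "\<dots> = (\<Sum>T | T \<subseteq> U \<and> card T = length \<mu>. cross t T (U - T)
      * (\<Prod>x\<in>T. (x - s 0) / (1 - s 0 * x))
      * spin_sym t (s \<circ> Suc) \<mu> T * (t_pochhammer t t m * (\<Prod>x\<in>U - T. 1 / (1 - s 0 * x))))"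
  proof (rule sum.cong[OF refl])
    fix T assume "T \<in> {T. T \<subseteq> U \<and> card T = length \<mu>}"
    then have T: "T \<subseteq> U" "card T = length \<mu>" "finite T" using assms by (auto intro: finite_subset)
    have R: "finite (U - T)" "card (U - T) = m" using T assms by (auto simp: card_Diff_subset)
    let ?c = "cross t T (U - T) * (\<Prod>x\<in>T. (x - s 0) / (1 - s 0 * x))"
    let ?d = "\<Prod>x\<in>U - T. (1 - t) / (1 - s 0 * x)"
    have g: "?g ys zs = ?c * spin_weight t (s \<circ> Suc) \<mu> ys * (pairprod (hlfac t) zs * ?d)"
      if "ys \<in> permutations_of_set T" "zs \<in> permutations_of_set (U - T)" for ys zs
    proof -
      have ys: "set ys = T" "distinct ys" "length ys = length \<mu>"
        and zs: "set zs = U - T" "distinct zs" "length zs = m"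
        using that T R by (auto simp: permutations_of_set_def distinct_card[symmetric])
      have "(\<Prod>x\<leftarrow>ys. f x) = (\<Prod>x\<in>T. f x)" "(\<Prod>x\<leftarrow>zs. f x) = (\<Prod>x\<in>U - T. f x)"
        for f :: "complex \<Rightarrow> complex"
        using ys zs prod.distinct_set_conv_list[of ys f] prod.distinct_set_conv_list[of zs f] by simp_all
      then show ?thesis
        using ys zs by (simp add: spin_weight_append cross_def hlfac_def)
    qed
    have "(\<Sum>ys\<in>permutations_of_set T. \<Sum>zs\<in>permutations_of_set (U - T). ?g ys zs)
       = (\<Sum>ys\<in>permutations_of_set T. \<Sum>zs\<in>permutations_of_set (U - T).
           ?c * spin_weight t (s \<circ> Suc) \<mu> ys * (pairprod (hlfac t) zs * ?d))"
      by (intro sum.cong refl g)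
    also have "\<dots> = ?c * spin_sym t (s \<circ> Suc) \<mu> T
        * ((\<Sum>zs\<in>permutations_of_set (U - T). pairprod (hlfac t) zs) * ?d)"
      unfolding spin_sym_def
      by (simp only: sum_distrib_left sum_distrib_right mult.assoc) (rule sum.swap)
    also have "?d = (1 - t) ^ m * (\<Prod>x\<in>U - T. 1 / (1 - s 0 * x))"
      using R(2) by (simp add: prod_dividef)
    also have "(\<Sum>zs\<in>permutations_of_set (U - T). pairprod (hlfac t) zs) * ((1 - t) ^ m * (\<Prod>x\<in>U - T. 1 / (1 - s 0 * x)))
        = t_pochhammer t t m * (\<Prod>x\<in>U - T. 1 / (1 - s 0 * x))"
      using sum_pairprod_hlfac[OF R(1), of t] R(2) by (simp add: mult_ac)
    finally show "(\<Sum>ys\<in>permutations_of_set T. \<Sum>zs\<in>permutations_of_set (U - T). ?g ys zs)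
      = ?c * spin_sym t (s \<circ> Suc) \<mu> T * (t_pochhammer t t m * (\<Prod>x\<in>U - T. 1 / (1 - s 0 * x)))" .
  qed
  finally show ?thesis .
qed

lemma spin_HL_eq_spin_sym:
  assumes "inj_on u {..<length lam}"
  shows "spin_HL t s lam u = spin_sym t s lam (u ` {..<length lam})"
proof -
  let ?N = "length lam"
  have "spin_HL_summand t s lam v = spin_weight t s lam (map v [0..<?N])" for v
  proof -
    have "(\<Prod>(l, x)\<leftarrow>zip lam (map v [0..<?N]). row_weight t s l x)
        = (\<Prod>i<?N. row_weight t s (lam ! i) (v i))"
      by (simp add: prod.list_conv_set_nth atLeast0LessThan)
    then show ?thesis
      unfolding spin_HL_summand_def spin_weight_def pairprod_map_upt row_weight_def hlfac_def by simp
  qed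
  then have "spin_HL t s lam u = (\<Sum>\<sigma> | \<sigma> permutes {..<?N}. spin_weight t s lam (map (u \<circ> \<sigma>) [0..<?N]))"
    by (simp add: spin_HL_def)
  also have "\<dots> = spin_sym t s lam (u ` {..<?N})"
    unfolding spin_sym_def by (rule sum.reindex_bij_betw[OF bij_betw_permutations_of_set[OF assms]])
  finally show ?thesis .
qed

section \<open>Even signatures and their zero parts\<close>

definition even_signatures :: "nat \<Rightarrow> nat list set" where
  "even_signatures N = {lam \<in> signatures N. \<forall>i. even (count_list lam i)}"

lemma sorted_desc_decompose:
  fixes lam :: "nat list"
  assumes "sorted_wrt (\<ge>) lam"
  shows "\<exists>\<mu> m. lam = map Suc \<mu> @ replicate m 0 \<and> sorted_wrt (\<ge>) \<mu>"
  using assms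
proof (induction lam)
  case (Cons a lam)
  then obtain \<mu> m where \<mu>: "lam = map Suc \<mu> @ replicate m 0" "sorted_wrt (\<ge>) \<mu>" by auto
  show ?case
  proof (cases a)
    case 0
    then have "\<mu> = []" using Cons.prems \<mu> by (cases \<mu>) auto
    then show ?thesis using 0 \<mu> by (intro exI[of _ "[]"] exI[of _ "Suc m"]) auto
  next
    case (Suc b)
    then show ?thesis using Cons.prems \<mu> by (intro exI[of _ "b # \<mu>"] exI[of _ m]) auto
  qed
qed simp

lemma count_list_shift:
  "count_list (map Suc \<mu> @ replicate m 0) 0 = m"
  "count_list (map Suc \<mu> @ replicate m 0) (Suc i) = count_list \<mu> i"
proof -
  have "count_list (map Suc \<mu>) 0 = 0" "count_list (map Suc \<mu>) (Suc i) = count_list \<mu> i"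
    by (induction \<mu>) auto
  moreover have "count_list (replicate m 0) (0::nat) = m" "count_list (replicate m 0) (Suc i) = 0"
    by (induction m) auto
  ultimately show "count_list (map Suc \<mu> @ replicate m 0) 0 = m"
    "count_list (map Suc \<mu> @ replicate m 0) (Suc i) = count_list \<mu> i" by simp_all
qed

lemma shift_in_even_signatures:
  "map Suc \<mu> @ replicate m 0 \<in> even_signatures N \<longleftrightarrow>
     even m \<and> m \<le> N \<and> \<mu> \<in> even_signatures (N - m)"
proof -
  have "(\<forall>i. even (count_list (map Suc \<mu> @ replicate m 0) i)) \<longleftrightarrow> even m \<and> (\<forall>i. even (count_list \<mu> i))"
  proof
    assume *: "\<forall>i. even (count_list (map Suc \<mu> @ replicate m 0) i)"
    show "even m \<and> (\<forall>i. even (count_list \<mu> i))"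
    proof (intro conjI allI)
      show "even m" using *[THEN spec, of 0] by (simp only: count_list_shift)
      show "even (count_list \<mu> i)" for i using *[THEN spec, of "Suc i"] by (simp only: count_list_shift)
    qed
  next
    assume *: "even m \<and> (\<forall>i. even (count_list \<mu> i))"
    show "\<forall>i. even (count_list (map Suc \<mu> @ replicate m 0) i)"
    proof
      fix i show "even (count_list (map Suc \<mu> @ replicate m 0) i)"
        using * by (cases i) (simp_all only: count_list_shift)
    qed
  qed
  moreover have "sorted_wrt (\<ge>) (map Suc \<mu> @ replicate m 0) \<longleftrightarrow> sorted_wrt (\<ge>) \<mu>"
  proof -
    have "sorted_wrt (\<ge>) (replicate m (0::nat))" by (induction m) auto
    then show ?thesis by (auto simp: sorted_wrt_append sorted_wrt_map)
  qed
  ultimately show ?thesis by (auto simp: even_signatures_def signatures_def)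
qed

lemma even_signatures_decompose:
  "even_signatures (2 * n) = (\<Union>m\<le>n. (\<lambda>\<mu>. map Suc \<mu> @ replicate (2 * m) 0) ` even_signatures (2 * (n - m)))"
proof (intro equalityI subsetI)
  fix lam assume lam: "lam \<in> even_signatures (2 * n)"
  then obtain \<mu> m where \<mu>: "lam = map Suc \<mu> @ replicate m 0"
    using sorted_desc_decompose[of lam] by (auto simp: even_signatures_def signatures_def)
  with lam have m: "even m" "m \<le> 2 * n" "\<mu> \<in> even_signatures (2 * n - m)"
    by (auto simp: shift_in_even_signatures)
  then obtain k where "m = 2 * k" by (auto elim: evenE)
  with m \<mu> show "lam \<in> (\<Union>m\<le>n. (\<lambda>\<mu>. map Suc \<mu> @ replicate (2 * m) 0) ` even_signatures (2 * (n - m)))"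
    by (auto simp: diff_mult_distrib2)
qed (auto simp: shift_in_even_signatures diff_mult_distrib2)

lemma has_sum_UN_finite:
  fixes f :: "'a \<Rightarrow> 'b::topological_comm_monoid_add"
  assumes "finite I" "disjoint_family_on B I" "\<And>i. i \<in> I \<Longrightarrow> (f has_sum a i) (B i)"
  shows "(f has_sum (\<Sum>i\<in>I. a i)) (\<Union>i\<in>I. B i)"
  using assms
proof (induction I rule: finite_induct)
  case (insert i I)
  then have "B i \<inter> (\<Union>i\<in>I. B i) = {}" by (auto simp: disjoint_family_on_def)
  moreover have "(f has_sum (\<Sum>i\<in>I. a i)) (\<Union>i\<in>I. B i)"
    using insert by (auto simp: disjoint_family_on_def)
  ultimately show ?case using insert by (auto intro: has_sum_Un_disjoint)
qed simp

lemma has_sum_finite_sum: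
  fixes f :: "'i \<Rightarrow> 'a \<Rightarrow> 'b::topological_comm_monoid_add"
  assumes "\<And>i. i \<in> I \<Longrightarrow> (f i has_sum a i) A"
  shows "((\<lambda>x. \<Sum>i\<in>I. f i x) has_sum (\<Sum>i\<in>I. a i)) A"
  using assms by (induction I rule: infinite_finite_induct) (auto intro: has_sum_add)

lemma has_sum_even_signatures:
  fixes f :: "nat list \<Rightarrow> 'b::topological_comm_monoid_add"
  assumes "\<And>m. m \<le> n \<Longrightarrow>
    ((\<lambda>\<mu>. f (map Suc \<mu> @ replicate (2 * m) 0)) has_sum a m) (even_signatures (2 * (n - m)))"
  shows "(f has_sum (\<Sum>m\<le>n. a m)) (even_signatures (2 * n))"
  unfolding even_signatures_decompose[of n]
proof (rule has_sum_UN_finite)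
  show "disjoint_family_on (\<lambda>m. (\<lambda>\<mu>. map Suc \<mu> @ replicate (2 * m) 0) ` even_signatures (2 * (n - m))) {..n}"
    unfolding disjoint_family_on_def
  proof (intro ballI impI)
    fix m m' :: nat assume "m \<noteq> m'"
    have "map Suc \<mu> @ replicate (2 * m) 0 \<noteq> map Suc \<nu> @ replicate (2 * m') 0" for \<mu> \<nu>
      using count_list_shift(1)[of \<mu> "2 * m"] count_list_shift(1)[of \<nu> "2 * m'"] \<open>m \<noteq> m'\<close>
      by (metis mult_cancel1 zero_neq_numeral)
    then show "(\<lambda>\<mu>. map Suc \<mu> @ replicate (2 * m) 0) ` even_signatures (2 * (n - m))
      \<inter> (\<lambda>\<mu>. map Suc \<mu> @ replicate (2 * m') 0) ` even_signatures (2 * (n - m')) = {}" by auto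
  qed
  fix m assume "m \<in> {..n}"
  then show "(f has_sum a m) ((\<lambda>\<mu>. map Suc \<mu> @ replicate (2 * m) 0) ` even_signatures (2 * (n - m)))"
    using assms[of m] by (subst has_sum_reindex) (auto simp: inj_on_def o_def dest: map_injective)
qed simp

section \<open>Multiplicity weights and the first-row recursion\<close>

definition mult_weight :: "complex \<Rightarrow> complex \<Rightarrow> nat \<Rightarrow> complex" where
  "mult_weight t a c = (\<Prod>j = 1..c div 2. (1 - a ^ 2 * t ^ (2 * j - 2)) / (1 - t ^ (2 * j)))"

definition sig_weight :: "complex \<Rightarrow> (nat \<Rightarrow> complex) \<Rightarrow> nat list \<Rightarrow> complex" where
  "sig_weight t s lam = (\<Prod>i\<in>set lam. mult_weight t (s i) (count_list lam i))"

lemma mult_weight_0 [simp]: "mult_weight t a 0 = 1"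
  by (simp add: mult_weight_def)

lemma sig_weight_superset:
  assumes "finite A" "set lam \<subseteq> A"
  shows "sig_weight t s lam = (\<Prod>i\<in>A. mult_weight t (s i) (count_list lam i))"
  unfolding sig_weight_def
  by (rule prod.mono_neutral_left) (use assms in auto)

lemma sig_weight_shift:
  "sig_weight t s (map Suc \<mu> @ replicate m 0) = mult_weight t (s 0) m * sig_weight t (s \<circ> Suc) \<mu>"
proof -
  have "sig_weight t s (map Suc \<mu> @ replicate m 0)
      = (\<Prod>i\<in>insert 0 (Suc ` set \<mu>). mult_weight t (s i) (count_list (map Suc \<mu> @ replicate m 0) i))"
    by (rule sig_weight_superset) auto
  also have "\<dots> = mult_weight t (s 0) m * (\<Prod>i\<in>set \<mu>. mult_weight t (s (Suc i)) (count_list \<mu> i))"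
    by (subst prod.insert) (auto simp: prod.reindex count_list_shift simp del: count_list_append)
  finally show ?thesis by (simp add: sig_weight_def)
qed

text \<open>Only finitely many parts occur, and multiplicity 0 has weight 1, so the infinite product
  has finite support.\<close>

lemma prodinf_mult_weight:
  "(\<Prod>i. mult_weight t (s (Suc i)) (count_list (map Suc \<mu> @ replicate m 0) (Suc i)))
     = sig_weight t (s \<circ> Suc) \<mu>"
  unfolding count_list_shift by (subst prodinf_finite[of "set \<mu>"]) (auto simp: sig_weight_def)

text \<open>The weight \<open>z\<close> of the zero parts is left open in order to cover both the
  unrefined weights of the recursion and the refined ones of the theorem. The product of the
  \<open>1 - s 0 * x\<close> clears the denominators of the first row, leaving
  \<open>x - s 0\<close> for each \<open>x\<close> in \<open>T\<close>.\<close>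

lemma has_sum_first_row:
  assumes U: "finite U" "card U = 2 * n" "\<And>x. x \<in> U \<Longrightarrow> 1 - s 0 * x \<noteq> 0"
    and poch: "\<And>k. t_pochhammer t t k \<noteq> 0"
    and G: "\<And>T. T \<subseteq> U \<Longrightarrow> even (card T) \<Longrightarrow>
      ((\<lambda>\<mu>. sig_weight t (s \<circ> Suc) \<mu> * spin_sym t (s \<circ> Suc) \<mu> T) has_sum G T) (even_signatures (card T))"
    and f: "\<And>\<mu> m. f (map Suc \<mu> @ replicate (2 * m) 0) = z m / t_pochhammer t t (2 * m)
      * (\<Prod>x\<in>U. 1 - s 0 * x) * sig_weight t (s \<circ> Suc) \<mu> * spin_sym t s (map Suc \<mu> @ replicate (2 * m) 0) U"
  shows "(f has_sum (\<Sum>T | T \<subseteq> U \<and> even (card T).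
      z (card (U - T) div 2) * (\<Prod>x\<in>T. x - s 0) * cross t T (U - T) * G T)) (even_signatures (2 * n))"
proof -
  let ?c = "\<lambda>T. z (card (U - T) div 2) * (\<Prod>x\<in>T. x - s 0) * cross t T (U - T)"
  let ?A = "\<lambda>m. {T. T \<subseteq> U \<and> card T = 2 * (n - m)}"
  have "(f has_sum (\<Sum>m\<le>n. \<Sum>T\<in>?A m. ?c T * G T)) (even_signatures (2 * n))"
  proof (rule has_sum_even_signatures)
    fix m assume m: "m \<le> n"
    have "f (map Suc \<mu> @ replicate (2 * m) 0)
        = (\<Sum>T\<in>?A m. ?c T * (sig_weight t (s \<circ> Suc) \<mu> * spin_sym t (s \<circ> Suc) \<mu> T))"
      if "\<mu> \<in> even_signatures (2 * (n - m))" for \<mu>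
    proof -
      have len: "length \<mu> = 2 * (n - m)" using that by (simp add: even_signatures_def signatures_def)
      have cU: "card U = length \<mu> + 2 * m" using m U(2) len by simp
      have "f (map Suc \<mu> @ replicate (2 * m) 0) = (\<Sum>T\<in>?A m. z m / t_pochhammer t t (2 * m)
          * (\<Prod>x\<in>U. 1 - s 0 * x) * sig_weight t (s \<circ> Suc) \<mu> *
          (cross t T (U - T) * (\<Prod>x\<in>T. (x - s 0) / (1 - s 0 * x))
            * spin_sym t (s \<circ> Suc) \<mu> T * (t_pochhammer t t (2 * m) * (\<Prod>x\<in>U - T. 1 / (1 - s 0 * x)))))"
        unfolding f spin_sym_split[OF U(1) cU] len sum_distrib_left ..
      also have "\<dots> = (\<Sum>T\<in>?A m. ?c T * (sig_weight t (s \<circ> Suc) \<mu> * spin_sym t (s \<circ> Suc) \<mu> T))"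
      proof (rule sum.cong[OF refl])
        fix T assume "T \<in> ?A m"
        then have T: "T \<subseteq> U" "card T = 2 * (n - m)" "finite T" using U(1) by (auto intro: finite_subset)
        have "card (U - T) = 2 * m" using T U m by (simp add: card_Diff_subset)
        then have cm: "card (U - T) div 2 = m" by simp
        have nz: "(\<Prod>x\<in>T. 1 - s 0 * x) \<noteq> 0" "(\<Prod>x\<in>U - T. 1 - s 0 * x) \<noteq> 0"
          using T U by (auto simp: subset_iff)
        have split: "(\<Prod>x\<in>U. 1 - s 0 * x) = (\<Prod>x\<in>U - T. 1 - s 0 * x) * (\<Prod>x\<in>T. 1 - s 0 * x)"
          by (rule prod.subset_diff[OF T(1) U(1)])
        show "z m / t_pochhammer t t (2 * m)
          * (\<Prod>x\<in>U. 1 - s 0 * x) * sig_weight t (s \<circ> Suc) \<mu> *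
          (cross t T (U - T) * (\<Prod>x\<in>T. (x - s 0) / (1 - s 0 * x))
            * spin_sym t (s \<circ> Suc) \<mu> T * (t_pochhammer t t (2 * m) * (\<Prod>x\<in>U - T. 1 / (1 - s 0 * x))))
          = ?c T * (sig_weight t (s \<circ> Suc) \<mu> * spin_sym t (s \<circ> Suc) \<mu> T)"
          unfolding cm split prod_dividef using nz poch[of "2 * m"] by simp
      qed
      finally show ?thesis .
    qed
    moreover have "((\<lambda>\<mu>. \<Sum>T\<in>?A m. ?c T * (sig_weight t (s \<circ> Suc) \<mu> * spin_sym t (s \<circ> Suc) \<mu> T))
        has_sum (\<Sum>T\<in>?A m. ?c T * G T)) (even_signatures (2 * (n - m)))"
    proof (intro has_sum_finite_sum has_sum_cmult_right)
      fix T assume "T \<in> ?A m"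
      then show "((\<lambda>\<mu>. sig_weight t (s \<circ> Suc) \<mu> * spin_sym t (s \<circ> Suc) \<mu> T) has_sum G T)
          (even_signatures (2 * (n - m)))"
        using G[of T] by auto
    qed
    ultimately show "((\<lambda>\<mu>. f (map Suc \<mu> @ replicate (2 * m) 0)) has_sum (\<Sum>T\<in>?A m. ?c T * G T))
        (even_signatures (2 * (n - m)))"
      by (subst has_sum_cong) auto
  qed
  also have "(\<Sum>m\<le>n. \<Sum>T\<in>?A m. ?c T * G T) = (\<Sum>T\<in>(\<Union>m\<le>n. ?A m). ?c T * G T)"
    by (rule sum.UNION_disjoint[symmetric]) (use U(1) in auto)
  also have "(\<Union>m\<le>n. ?A m) = {T. T \<subseteq> U \<and> even (card T)}"
  proof (intro equalityI subsetI)
    fix T assume "T \<in> {T. T \<subseteq> U \<and> even (card T)}"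
    then obtain k where "T \<subseteq> U" "card T = 2 * k" by (auto elim: evenE)
    moreover from this have "k \<le> n" using card_mono[OF U(1), of T] U(2) by simp
    ultimately show "T \<in> (\<Union>m\<le>n. ?A m)" by (intro UN_I[of "n - k"]) auto
  qed auto
  finally show ?thesis .
qed

text \<open>For \<open>\<gamma> = 1\<close>, that is \<open>p = t + s^2\<close>, each factor splits
  as \<open>(1 - t ^ (2 * j + 1)) * (1 - s^2 * t ^ (2 * j))\<close>. The odd powers cancel half of
  the Pochhammer symbol, so zero parts are weighted like all other parts.\<close>

lemma zweight_unrefined:
  assumes "\<And>k. t_pochhammer t t k \<noteq> 0"
  shows "zweight t s (t + s ^ 2) m / t_pochhammer t t (2 * m) = mult_weight t s (2 * m)"
proof (induction m)
  case 0
  then show ?case by (simp add: zweight_def t_pochhammer_def)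
next
  case (Suc m)
  have p: "t_pochhammer t t (2 * Suc m) = t_pochhammer t t (2 * m) * ((1 - t ^ (2 * m + 1)) * (1 - t ^ (2 * m + 2)))"
    by (simp add: t_pochhammer_def)
  then have nz: "1 - t ^ (2 * m + 1) \<noteq> 0" using assms[of "2 * Suc m"] by auto
  have w: "zweight t s (t + s ^ 2) (Suc m)
      = zweight t s (t + s ^ 2) m * ((1 - t ^ (2 * m + 1)) * (1 - s ^ 2 * t ^ (2 * m)))"
  proof -
    have "4 * m + 1 = Suc (2 * m + 2 * m)" by simp
    then have e: "t ^ (4 * m + 1) = t * (t ^ (2 * m) * t ^ (2 * m))" "t ^ (2 * m + 1) = t * t ^ (2 * m)"
      by (simp_all only: power_Suc power_add) simp
    have "1 - (t + s ^ 2) * t ^ (2 * m) + s ^ 2 * t ^ (4 * m + 1)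
        = (1 - t ^ (2 * m + 1)) * (1 - s ^ 2 * t ^ (2 * m))"
      unfolding e by algebra
    then show ?thesis by (simp add: zweight_def)
  qed
  have mw: "mult_weight t s (2 * Suc m) = mult_weight t s (2 * m) * ((1 - s ^ 2 * t ^ (2 * m)) / (1 - t ^ (2 * m + 2)))"
    by (simp add: mult_weight_def)
  have "X * (A * B) / (P * (A * C)) = X / P * (B / C)" if "A \<noteq> 0" for X A B P C :: complex
    using that by simp
  from this[OF nz] show ?case unfolding p w mw Suc.IH[symmetric] .
qed

text \<open>For \<open>\<gamma> = 1\<close> one has \<open>\<kappa> = 0\<close>, and
  \<open>hnum\<close> factors into \<open>1 - t\<close> and one factor \<open>1 - s * x\<close> per
  variable; every matching meets each variable once.\<close>

lemma Phi_scale: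
  "Phi t s 0 U = (\<Prod>x\<in>U. 1 - s * x) * Phi t 0 0 U"
proof -
  have "match_weight (hfac t s 0) (bfac t) xs = (\<Prod>x\<leftarrow>xs. 1 - s * x) * match_weight (hfac t 0 0) (bfac t) xs" for xs
  proof (induction xs rule: induct_list012)
    case (3 x y zs)
    have "hfac t s 0 x y = (1 - s * x) * (1 - s * y) * hfac t 0 0 x y"
      by (simp add: hfac_def hnum_def)
    then show ?case using 3(1) by simp
  qed simp_all
  moreover have "(\<Prod>x\<leftarrow>xs. 1 - s * x) = (\<Prod>x\<in>U. 1 - s * x)" if "xs \<in> permutations_of_set U" for xs
    using that prod.distinct_set_conv_list[of xs "\<lambda>x. 1 - s * x"] by (simp add: permutations_of_set_def)
  ultimately show ?thesis
    unfolding Phi_def matchsum_def by (simp add: sum_distrib_left cong: sum.cong)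
qed

section \<open>Convergence\<close>

text \<open>The condition \<open>1 - s i * x \<noteq> 0\<close> is stated separately because a
  quotient by zero would be 0 and satisfy the norm bound.\<close>

definition contracting :: "complex set \<Rightarrow> real \<Rightarrow> (nat \<Rightarrow> complex) \<Rightarrow> bool" where
  "contracting U \<rho> s \<longleftrightarrow>
     (\<forall>x\<in>U. \<forall>i. 1 - s i * x \<noteq> 0 \<and> cmod ((x - s i) / (1 - s i * x)) \<le> \<rho>)"

lemma contracting_subset: "contracting U \<rho> s \<Longrightarrow> T \<subseteq> U \<Longrightarrow> contracting T \<rho> s"
  by (auto simp: contracting_def)

lemma contracting_shift: "contracting U \<rho> s \<Longrightarrow> contracting U \<rho> (s \<circ> Suc)"
  by (auto simp: contracting_def)

text \<open>
  With \<open>y = (x - s) / (1 - s x)\<close> one has \<open>1 / (1 - s x) = (1 - x y) / (1 - x\<^sup>2)\<close> and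
  \<open>s / (1 - s x) = (x - y) / (1 - x\<^sup>2)\<close>, so both stay bounded uniformly in \<open>s\<close>, even when \<open>s\<close> is large.
\<close>

lemma bound_by_contraction:
  fixes s x :: complex
  assumes "1 - s * x \<noteq> 0" "x * x \<noteq> 1" "cmod ((x - s) / (1 - s * x)) \<le> 1"
  shows "(1 + cmod s) / cmod (1 - s * x) \<le> 2 * (1 + cmod x) / cmod (1 - x * x)"
proof -
  define y where "y = (x - s) / (1 - s * x)"
  have nz: "1 - x * x \<noteq> 0" using assms(2) by simp
  have y: "y * (1 - s * x) = x - s" using assms(1) by (simp add: y_def)
  have "(1 - x * y) * (1 - s * x) = 1 - x * x" using y by algebra
  then have e1: "1 / (1 - s * x) = (1 - x * y) / (1 - x * x)"
    using nz assms(1) by (simp add: field_simps)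
  have "(x - y) * (1 - s * x) = s * (1 - x * x)" using y by algebra
  then have e2: "s / (1 - s * x) = (x - y) / (1 - x * x)"
    using nz assms(1) by (simp add: field_simps)
  have ly: "cmod y \<le> 1" using assms(3) by (simp add: y_def)
  have "cmod (1 - x * y) \<le> 1 + cmod x * cmod y" using norm_triangle_ineq4[of 1 "x * y"] by (simp add: norm_mult)
  also have "\<dots> \<le> 1 + cmod x" using ly by (simp add: mult_left_le)
  finally have b1: "cmod (1 - x * y) \<le> 1 + cmod x" .
  have b2: "cmod (x - y) \<le> 1 + cmod x" using norm_triangle_ineq4[of x y] ly by linarith
  have "(1 + cmod s) / cmod (1 - s * x) = cmod (1 / (1 - s * x)) + cmod (s / (1 - s * x))"
    by (simp add: norm_divide add_divide_distrib)
  also have "\<dots> = (cmod (1 - x * y) + cmod (x - y)) / cmod (1 - x * x)"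
    unfolding e1 e2 by (simp add: norm_divide add_divide_distrib)
  also have "\<dots> \<le> 2 * (1 + cmod x) / cmod (1 - x * x)"
    using b1 b2 by (intro divide_right_mono) auto
  finally show ?thesis .
qed

lemma prod_list_conv_count:
  fixes f :: "'a \<Rightarrow> 'b::comm_monoid_mult"
  shows "(\<Prod>x\<leftarrow>xs. f x) = (\<Prod>x\<in>set xs. f x ^ count_list xs x)"
proof (induction xs)
  case (Cons a xs)
  have "(\<Prod>x\<in>set (a # xs). f x ^ count_list (a # xs) x)
      = f a ^ count_list (a # xs) a * (\<Prod>x\<in>set (a # xs) - {a}. f x ^ count_list (a # xs) x)"
    by (rule prod.remove) auto
  also have "(\<Prod>x\<in>set (a # xs) - {a}. f x ^ count_list (a # xs) x) = (\<Prod>x\<in>set xs - {a}. f x ^ count_list xs x)"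
    by (intro prod.cong) auto
  also have "f a ^ count_list (a # xs) a * \<dots>
      = f a * (f a ^ count_list xs a * (\<Prod>x\<in>set xs - {a}. f x ^ count_list xs x))"
    by (simp add: mult.assoc)
  also have "f a ^ count_list xs a * (\<Prod>x\<in>set xs - {a}. f x ^ count_list xs x) = (\<Prod>x\<in>set xs. f x ^ count_list xs x)"
    by (cases "a \<in> set xs") (auto simp: prod.remove count_notin)
  finally show ?case using Cons.IH by simp
qed simp

text \<open>Summing over lists of length \<open>N\<close> gives the \<open>N\<close>-th power of a
  convergent series; signatures are only a subset of these lists.\<close>

lemma summable_on_prod_list:
  fixes g :: "nat \<Rightarrow> real"
  assumes "\<And>l. g l \<ge> 0" "summable g"
  shows "(\<lambda>lam. \<Prod>l\<leftarrow>lam. g l) summable_on {lam. length lam = N}"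
proof (induction N)
  case 0
  have "{lam::nat list. length lam = 0} = {[]}" by auto
  then show ?case by simp
next
  case (Suc N)
  let ?L = "{lam::nat list. length lam = N}"
  have g: "g summable_on UNIV"
    using assms by (simp add: summable_on_UNIV_nonneg_real_iff)
  have "(\<lambda>(l, lam). g l * (\<Prod>l\<leftarrow>lam. g l)) summable_on (UNIV \<times> ?L)"
  proof (rule summable_on_SigmaI[where g = "\<lambda>l. g l * infsum (\<lambda>lam. \<Prod>l\<leftarrow>lam. g l) ?L"])
    show "((\<lambda>y. case (x, y) of (l, lam) \<Rightarrow> g l * (\<Prod>l\<leftarrow>lam. g l))
        has_sum g x * infsum (\<lambda>lam. \<Prod>l\<leftarrow>lam. g l) ?L) ?L" for x
      using Suc by (auto intro: has_sum_cmult_right)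
    show "(\<lambda>l. g l * infsum (\<lambda>lam. \<Prod>l\<leftarrow>lam. g l) ?L) summable_on UNIV"
      using g by (rule summable_on_cmult_left)
    show "0 \<le> (case (x, y) of (l, lam) \<Rightarrow> g l * (\<Prod>l\<leftarrow>lam. g l))" for x y
      using assms(1) by (auto intro!: mult_nonneg_nonneg prod_list_nonneg)
  qed
  also have "?this \<longleftrightarrow> (\<lambda>lam. \<Prod>l\<leftarrow>lam. g l) summable_on {lam. length lam = Suc N}"
    by (rule summable_on_reindex_bij_witness[of _ "\<lambda>lam. (hd lam, tl lam)" "\<lambda>(l, lam). l # lam"])
      (auto simp: length_Suc_conv)
  finally show ?case .
qed

lemma Rsum_even:
  assumes "finite U"
  shows "Rsum t s p U = (\<Sum>T | T \<subseteq> U \<and> even (card T).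
     zweight t s p (card (U - T) div 2) * (\<Prod>x\<in>T. x - s) * cross t T (U - T) * Phi t 0 0 T)"
  unfolding Rsum_def
  by (rule sum.mono_neutral_right) (use assms in \<open>auto simp: Phi_def matchsum_odd\<close>)

section \<open>Bounds uniform in the parameters\<close>

text \<open>The summand for \<open>\<gamma> = 1\<close> without the product of the
  \<open>1 - s 0 * x\<close>. In this normalisation the claimed value \<open>Phi t 0 0 U\<close> is
  the same for all parameter sequences.\<close>

definition level_term :: "complex \<Rightarrow> (nat \<Rightarrow> complex) \<Rightarrow> complex set \<Rightarrow> nat list \<Rightarrow> complex" where
  "level_term t s U lam = sig_weight t s lam * spin_sym t s lam U"

context
  fixes \<tau> :: real and t :: complex
  assumes tau: "0 < \<tau>" "\<tau> < 1" and t_def: "t = of_real \<tau>"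
begin

lemma one_minus_power_bound:
  assumes "j \<ge> 1"
  shows "1 - \<tau> \<le> cmod (1 - t ^ j)"
proof -
  have "\<tau> ^ j \<le> \<tau>" using tau assms power_decreasing[of 1 j \<tau>] by simp
  moreover have "1 - t ^ j = of_real (1 - \<tau> ^ j)" by (simp add: t_def)
  ultimately show ?thesis using tau by (simp only: norm_of_real)
qed

lemma t_pochhammer_nonzero: "t_pochhammer t t k \<noteq> 0"
proof -
  have "1 - t * t ^ i \<noteq> 0" for i
    using one_minus_power_bound[of "Suc i"] tau by auto
  then show ?thesis by (simp add: t_pochhammer_def)
qed

text \<open>The estimate is spread evenly over the \<open>c\<close> equal parts so that each factor
  \<open>1 + cmod a\<close> can be paired with the denominator \<open>1 - a * x\<close> of one row:
  their quotient is bounded uniformly in \<open>a\<close>, the weight alone is not.\<close>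

lemma mult_weight_bound:
  assumes "even c"
  shows "cmod (mult_weight t a c) \<le> ((1 + cmod a) / (1 - \<tau>)) ^ c"
proof -
  have "cmod ((1 - a ^ 2 * t ^ (2 * j - 2)) / (1 - t ^ (2 * j))) \<le> ((1 + cmod a) / (1 - \<tau>)) ^ 2"
    if j: "j \<ge> 1" for j
  proof -
    have "cmod (1 - a ^ 2 * t ^ (2 * j - 2)) \<le> 1 + cmod a ^ 2 * cmod t ^ (2 * j - 2)"
      using norm_triangle_ineq4[of 1 "a ^ 2 * t ^ (2 * j - 2)"] by (simp add: norm_mult norm_power)
    also have "\<dots> \<le> 1 + cmod a ^ 2"
      using tau by (simp add: t_def mult_left_le power_le_one)
    also have "\<dots> \<le> (1 + cmod a) ^ 2" by (simp add: power2_eq_square algebra_simps)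
    finally have "cmod (1 - a ^ 2 * t ^ (2 * j - 2)) \<le> (1 + cmod a) ^ 2" .
    moreover have "(1 - \<tau>) ^ 2 \<le> cmod (1 - t ^ (2 * j))"
    proof -
      have "(1 - \<tau>) ^ 2 \<le> 1 - \<tau>" using tau by (simp add: power2_eq_square mult_left_le)
      then show ?thesis using one_minus_power_bound[of "2 * j"] j by linarith
    qed
    ultimately show ?thesis
      using tau unfolding norm_divide power_divide by (intro frac_le) auto
  qed
  then have "cmod (mult_weight t a c) \<le> (\<Prod>j = 1..c div 2. ((1 + cmod a) / (1 - \<tau>)) ^ 2)"
    unfolding mult_weight_def prod_norm[symmetric] by (intro prod_mono) auto
  also have "\<dots> = ((1 + cmod a) / (1 - \<tau>)) ^ c"
    using assms by (simp flip: power_mult)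
  finally show ?thesis .
qed

lemma sig_weight_bound:
  assumes "\<forall>i. even (count_list lam i)"
  shows "cmod (sig_weight t s lam) \<le> (\<Prod>l\<leftarrow>lam. (1 + cmod (s l)) / (1 - \<tau>))"
  unfolding sig_weight_def prod_list_conv_count prod_norm[symmetric]
  by (intro prod_mono conjI norm_ge_zero mult_weight_bound) (use assms in auto)

text \<open>Each row pairs its share \<open>1 + cmod (s l)\<close> of the multiplicity weight with
  its denominator, at the cost of a constant \<open>K\<close> free of \<open>s\<close>; the
  \<open>l\<close> contraction factors give \<open>\<rho> ^ l\<close>.\<close>

lemma row_weights_bound:
  assumes "contracting U \<rho> s" "0 \<le> \<rho>" "\<rho> \<le> 1" "\<And>x. x \<in> U \<Longrightarrow> x * x \<noteq> 1"
    and K: "\<And>x. x \<in> U \<Longrightarrow> 2 * (1 + cmod x) / cmod (1 - x * x) \<le> K"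
    and "length lam = length xs" "set xs \<subseteq> U"
  shows "(\<Prod>l\<leftarrow>lam. (1 + cmod (s l)) / (1 - \<tau>)) * cmod (\<Prod>(l, x)\<leftarrow>zip lam xs. row_weight t s l x)
     \<le> (\<Prod>l\<leftarrow>lam. K / (1 - \<tau>) * \<rho> ^ l)"
  using assms(6,7)
proof (induction lam xs rule: list_induct2)
  case (Cons l lam x xs)
  then have x: "x \<in> U" by simp
  have c: "1 - s i * x \<noteq> 0" "cmod ((x - s i) / (1 - s i * x)) \<le> \<rho>" for i
    using assms(1) x by (auto simp: contracting_def)
  have "cmod (\<Prod>j<l. (x - s j) / (1 - s j * x)) \<le> \<rho> ^ l"
    using prod_mono[of "{..<l}" "\<lambda>j. cmod ((x - s j) / (1 - s j * x))" "\<lambda>_. \<rho>"] c(2)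
    by (simp add: prod_norm)
  moreover have "cmod (1 - t) \<le> 1"
  proof -
    have "1 - t = of_real (1 - \<tau>)" by (simp add: t_def)
    then show ?thesis using tau by (simp only: norm_of_real)
  qed
  ultimately have r: "cmod (row_weight t s l x) \<le> 1 / cmod (1 - s l * x) * \<rho> ^ l"
    unfolding row_weight_def norm_mult norm_divide
    by (intro mult_mono divide_right_mono) auto
  have "(1 + cmod (s l)) / (1 - \<tau>) * cmod (row_weight t s l x)
      \<le> (1 + cmod (s l)) / (1 - \<tau>) * (1 / cmod (1 - s l * x) * \<rho> ^ l)"
    using r tau by (intro mult_left_mono) auto
  also have "\<dots> = (1 + cmod (s l)) / cmod (1 - s l * x) * (1 / (1 - \<tau>) * \<rho> ^ l)"
    by (simp add: mult_ac)
  also have "\<dots> \<le> K * (1 / (1 - \<tau>) * \<rho> ^ l)"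
  proof (rule mult_right_mono)
    have "(1 + cmod (s l)) / cmod (1 - s l * x) \<le> 2 * (1 + cmod x) / cmod (1 - x * x)"
      by (rule bound_by_contraction[OF c(1) assms(4)[OF x] order_trans[OF c(2) assms(3)]])
    then show "(1 + cmod (s l)) / cmod (1 - s l * x) \<le> K" using K[OF x] by linarith
  qed (use tau assms(2) in simp)
  finally have head: "(1 + cmod (s l)) / (1 - \<tau>) * cmod (row_weight t s l x) \<le> K / (1 - \<tau>) * \<rho> ^ l"
    by simp
  have IH: "(\<Prod>l\<leftarrow>lam. (1 + cmod (s l)) / (1 - \<tau>)) * cmod (\<Prod>(l, x)\<leftarrow>zip lam xs. row_weight t s l x)
     \<le> (\<Prod>l\<leftarrow>lam. K / (1 - \<tau>) * \<rho> ^ l)"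
    using Cons by simp
  have "0 \<le> 2 * (1 + cmod x) / cmod (1 - x * x)" by simp
  then have K0: "K \<ge> 0" using K[OF x] by linarith
  have "(\<Prod>l\<leftarrow>l # lam. (1 + cmod (s l)) / (1 - \<tau>)) * cmod (\<Prod>(l, x)\<leftarrow>zip (l # lam) (x # xs). row_weight t s l x)
     = ((1 + cmod (s l)) / (1 - \<tau>) * cmod (row_weight t s l x)) *
       ((\<Prod>l\<leftarrow>lam. (1 + cmod (s l)) / (1 - \<tau>)) * cmod (\<Prod>(l, x)\<leftarrow>zip lam xs. row_weight t s l x))"
    by (simp add: norm_mult)
  also have "\<dots> \<le> (K / (1 - \<tau>) * \<rho> ^ l) * (\<Prod>l\<leftarrow>lam. K / (1 - \<tau>) * \<rho> ^ l)"
    by (rule mult_mono[OF head IH])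
      (use K0 tau assms(2) in \<open>auto intro!: mult_nonneg_nonneg prod_list_nonneg\<close>)
  finally show ?case by simp
qed simp

text \<open>The majorant is a multiple of a product of geometric terms and does not involve
  \<open>s\<close>. Hence one \<open>B\<close> serves all contracting sequences, in particular all
  shifts of a given one.\<close>

lemma level_term_bounded:
  assumes U: "finite U" "\<And>x. x \<in> U \<Longrightarrow> x * x \<noteq> 1" and rho: "0 \<le> \<rho>" "\<rho> < 1"
  shows "\<exists>B. \<forall>s. contracting U \<rho> s \<longrightarrow> level_term t s U summable_on even_signatures (card U)
           \<and> cmod (infsum (level_term t s U) (even_signatures (card U))) \<le> B"
proof -
  define K where "K = (\<Sum>x\<in>U. 2 * (1 + cmod x) / cmod (1 - x * x))"
  have K: "2 * (1 + cmod x) / cmod (1 - x * x) \<le> K" if "x \<in> U" for x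
    unfolding K_def by (rule member_le_sum) (use that U in auto)
  have K0: "K \<ge> 0" unfolding K_def by (intro sum_nonneg) auto
  define H where "H = (\<Sum>xs\<in>permutations_of_set U. cmod (pairprod (hlfac t) xs))"
  define g where "g = (\<lambda>l::nat. K / (1 - \<tau>) * \<rho> ^ l)"
  let ?E = "even_signatures (card U)"
  have g0: "g l \<ge> 0" for l using K0 tau rho by (simp add: g_def)
  have "summable g" unfolding g_def using rho by (intro summable_mult summable_geometric) simp
  then have "(\<lambda>lam. \<Prod>l\<leftarrow>lam. g l) summable_on {lam. length lam = card U}"
    using g0 by (intro summable_on_prod_list)
  then have "(\<lambda>lam. \<Prod>l\<leftarrow>lam. g l) summable_on ?E"
    by (rule summable_on_subset_banach) (auto simp: even_signatures_def signatures_def)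
  then have sum: "(\<lambda>lam. H * (\<Prod>l\<leftarrow>lam. g l)) summable_on ?E"
    by (rule summable_on_cmult_right)
  have bound: "cmod (level_term t s U lam) \<le> H * (\<Prod>l\<leftarrow>lam. g l)"
    if s: "contracting U \<rho> s" and lam: "lam \<in> ?E" for s lam
  proof -
    have ev: "\<forall>i. even (count_list lam i)" and len: "length lam = card U"
      using lam by (auto simp: even_signatures_def signatures_def)
    have "cmod (level_term t s U lam)
        \<le> (\<Prod>l\<leftarrow>lam. (1 + cmod (s l)) / (1 - \<tau>)) * cmod (spin_sym t s lam U)"
      unfolding level_term_def norm_mult by (intro mult_right_mono sig_weight_bound ev) auto
    also have "\<dots> \<le> (\<Prod>l\<leftarrow>lam. (1 + cmod (s l)) / (1 - \<tau>)) *
        (\<Sum>xs\<in>permutations_of_set U. cmod (spin_weight t s lam xs))"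
      unfolding spin_sym_def
      by (intro mult_left_mono norm_sum) (use tau in \<open>auto intro!: prod_list_nonneg\<close>)
    also have "\<dots> = (\<Sum>xs\<in>permutations_of_set U. cmod (pairprod (hlfac t) xs) *
        ((\<Prod>l\<leftarrow>lam. (1 + cmod (s l)) / (1 - \<tau>)) * cmod (\<Prod>(l, x)\<leftarrow>zip lam xs. row_weight t s l x)))"
      by (simp add: spin_weight_def norm_mult sum_distrib_left mult_ac)
    also have "\<dots> \<le> (\<Sum>xs\<in>permutations_of_set U. cmod (pairprod (hlfac t) xs) * (\<Prod>l\<leftarrow>lam. g l))"
    proof (intro sum_mono mult_left_mono norm_ge_zero)
      fix xs assume "xs \<in> permutations_of_set U"
      then have "length lam = length xs" "set xs \<subseteq> U"
        using len by (auto simp: length_finite_permutations_of_set permutations_of_setD)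
      then show "(\<Prod>l\<leftarrow>lam. (1 + cmod (s l)) / (1 - \<tau>)) * cmod (\<Prod>(l, x)\<leftarrow>zip lam xs. row_weight t s l x)
          \<le> (\<Prod>l\<leftarrow>lam. g l)"
        unfolding g_def using row_weights_bound[OF s] rho U K by simp
    qed
    also have "\<dots> = H * (\<Prod>l\<leftarrow>lam. g l)" by (simp add: H_def sum_distrib_right)
    finally show ?thesis .
  qed
  have "level_term t s U summable_on ?E \<and> cmod (infsum (level_term t s U) ?E) \<le> infsum (\<lambda>lam. H * (\<Prod>l\<leftarrow>lam. g l)) ?E"
    if s: "contracting U \<rho> s" for s
  proof
    show summ: "level_term t s U summable_on ?E"
      by (rule abs_summable_summable, rule Infinite_Sum.abs_summable_on_comparison_test'[OF sum bound[OF s]])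
    show "cmod (infsum (level_term t s U) ?E) \<le> infsum (\<lambda>lam. H * (\<Prod>l\<leftarrow>lam. g l)) ?E"
      by (rule norm_infsum_le[OF has_sum_infsum[OF summ] has_sum_infsum[OF sum] bound[OF s]])
  qed
  then show ?thesis by blast
qed

lemma level_term_shift:
  "level_term t s U (map Suc \<mu> @ replicate (2 * m) 0) = zweight t (s 0) (t + s 0 ^ 2) m / t_pochhammer t t (2 * m)
      * sig_weight t (s \<circ> Suc) \<mu> * spin_sym t s (map Suc \<mu> @ replicate (2 * m) 0) U"
  unfolding level_term_def sig_weight_shift zweight_unrefined[OF t_pochhammer_nonzero] ..

text \<open>
  The defect between the sum over signatures and its claimed value obeys
  \<open>E s = (\<Prod>x\<in>U. (x - s 0) / (1 - s 0 x)) * E (s \<circ> Suc)\<close>, and it is bounded uniformly in \<open>s\<close>, so it vanishes.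
\<close>

lemma level_sum:
  assumes "admissible t U" "even (card U)" "contracting U \<rho> s" "0 \<le> \<rho>" "\<rho> < 1"
  shows "(level_term t s U has_sum Phi t 0 0 U) (even_signatures (card U))"
  using assms(1-3)
proof (induction "card U" arbitrary: U s rule: less_induct)
  case less
  have fin: "finite U" by (rule admissible_finite[OF less.prems(1)])
  have sq: "x * x \<noteq> 1" if "x \<in> U" for x using less.prems(1) that by (auto simp: admissible_def)
  obtain B where B: "\<And>s. contracting U \<rho> s \<Longrightarrow> level_term t s U summable_on even_signatures (card U)"
    "\<And>s. contracting U \<rho> s \<Longrightarrow> cmod (infsum (level_term t s U) (even_signatures (card U))) \<le> B"
    using level_term_bounded[OF fin sq assms(4,5)] by blast
  define E where "E = (\<lambda>s. infsum (level_term t s U) (even_signatures (card U)) - Phi t 0 0 U)"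
  have t01: "t \<noteq> 0" "t \<noteq> 1" using tau by (auto simp: t_def)
  obtain n where n: "card U = 2 * n" using less.prems(2) by (auto elim: evenE)
  have E_bound: "cmod (E s) \<le> B + cmod (Phi t 0 0 U)" if "contracting U \<rho> s" for s
    unfolding E_def using B(2)[OF that] norm_triangle_ineq4 order_trans add_right_mono by meson
  have rec: "cmod (E s) \<le> \<rho> ^ card U * cmod (E (s \<circ> Suc))" if s: "contracting U \<rho> s" for s
  proof -
    let ?c = "\<lambda>T. zweight t (s 0) (t + s 0 ^ 2) (card (U - T) div 2) * (\<Prod>x\<in>T. x - s 0) * cross t T (U - T)"
    define G where "G = (\<lambda>T. infsum (level_term t (s \<circ> Suc) T) (even_signatures (card T)))"
    have nz: "1 - s 0 * x \<noteq> 0" if "x \<in> U" for x using s that by (auto simp: contracting_def)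
    have s': "contracting T \<rho> (s \<circ> Suc)" if "T \<subseteq> U" for T
      by (intro contracting_shift contracting_subset[OF s that])
    have eqG: "G T = Phi t 0 0 T" if "T \<subset> U" "even (card T)" for T
    proof -
      have "(level_term t (s \<circ> Suc) T has_sum Phi t 0 0 T) (even_signatures (card T))"
        using that fin s' less.prems(1)
        by (intro less.hyps psubset_card_mono) (auto intro: admissible_subset)
      then show ?thesis unfolding G_def by (rule infsumI)
    qed
    have "((\<lambda>lam. (\<Prod>x\<in>U. 1 - s 0 * x) * level_term t s U lam) has_sum
        (\<Sum>T | T \<subseteq> U \<and> even (card T). ?c T * G T)) (even_signatures (2 * n))"
    proof (rule has_sum_first_row[where s = s and z = "zweight t (s 0) (t + s 0 ^ 2)", OF fin n nz t_pochhammer_nonzero])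
      show "((\<lambda>\<mu>. sig_weight t (s \<circ> Suc) \<mu> * spin_sym t (s \<circ> Suc) \<mu> T) has_sum G T) (even_signatures (card T))"
        if T: "T \<subseteq> U" "even (card T)" for T
      proof (cases "T = U")
        case True
        then show ?thesis
          using has_sum_infsum[OF B(1)[OF s'[of U]]] by (simp add: G_def level_term_def[abs_def])
      next
        case False
        then have "(level_term t (s \<circ> Suc) T has_sum Phi t 0 0 T) (even_signatures (card T))"
          using T fin s' less.prems(1)
          by (intro less.hyps psubset_card_mono) (auto intro: admissible_subset)
        then show ?thesis using eqG[of T] T False by (simp add: level_term_def[abs_def] psubset_eq)
      qed
      show "(\<Prod>x\<in>U. 1 - s 0 * x) * level_term t s U (map Suc \<mu> @ replicate (2 * m) 0)
          = zweight t (s 0) (t + s 0 ^ 2) m / t_pochhammer t t (2 * m) * (\<Prod>x\<in>U. 1 - s 0 * x)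
            * sig_weight t (s \<circ> Suc) \<mu> * spin_sym t s (map Suc \<mu> @ replicate (2 * m) 0) U" for \<mu> m
        unfolding level_term_shift by simp
    qed
    moreover have "((\<lambda>lam. (\<Prod>x\<in>U. 1 - s 0 * x) * level_term t s U lam) has_sum
        (\<Prod>x\<in>U. 1 - s 0 * x) * infsum (level_term t s U) (even_signatures (card U))) (even_signatures (2 * n))"
      using has_sum_infsum[OF B(1)[OF s]] by (intro has_sum_cmult_right) (simp add: n)
    ultimately have 1: "(\<Prod>x\<in>U. 1 - s 0 * x) * infsum (level_term t s U) (even_signatures (card U))
        = (\<Sum>T | T \<subseteq> U \<and> even (card T). ?c T * G T)"
      by (rule has_sum_unique[rotated])
    have 2: "(\<Prod>x\<in>U. 1 - s 0 * x) * Phi t 0 0 U = (\<Sum>T | T \<subseteq> U \<and> even (card T). ?c T * Phi t 0 0 T)"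
      using one_step_identity[OF t01 less.prems(1,2), of "s 0" "t + s 0 ^ 2"] Phi_scale[of t "s 0" U]
      by (simp add: Rsum_even[OF fin])
    have "(\<Prod>x\<in>U. 1 - s 0 * x) * E s = (\<Sum>T | T \<subseteq> U \<and> even (card T). ?c T * (G T - Phi t 0 0 T))"
      unfolding E_def right_diff_distrib 1 2 by (simp add: sum_subtractf)
    \<comment> \<open>For proper subsets the induction hypothesis gives
      \<open>G T = Phi t 0 0 T\<close>, so only \<open>T = U\<close> is left.\<close>
    also have "\<dots> = (\<Sum>T\<in>{U}. ?c T * (G T - Phi t 0 0 T))"
      by (rule sum.mono_neutral_right) (use fin less.prems(2) eqG in auto)
    also have "\<dots> = (\<Prod>x\<in>U. x - s 0) * E (s \<circ> Suc)"
      by (simp add: zweight_def cross_def G_def E_def)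
    finally have "E s = (\<Prod>x\<in>U. (x - s 0) / (1 - s 0 * x)) * E (s \<circ> Suc)"
      using nz fin by (simp add: prod_dividef field_simps)
    moreover have "(\<Prod>x\<in>U. cmod ((x - s 0) / (1 - s 0 * x))) \<le> (\<Prod>x\<in>U. \<rho>)"
      by (intro prod_mono) (use s in \<open>auto simp: contracting_def\<close>)
    ultimately show ?thesis
      by (simp add: norm_mult mult_right_mono flip: prod_norm)
  qed
  have "E s = 0"
  \<comment> \<open>Without variables the factor \<open>\<rho> ^ card U\<close> is 1 and nothing
    contracts, but the sum then has the single term of the empty signature.\<close>
  proof (cases "card U = 0")
    case True
    then have U: "U = {}" using fin by simp
    have "even_signatures 0 = {[]}" by (auto simp: even_signatures_def signatures_def)
    then show ?thesis
      by (simp add: U E_def level_term_def sig_weight_def spin_sym_def spin_weight_def)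
  next
    case False
    define C where "C = B + cmod (Phi t 0 0 U)"
    have iter: "cmod (E s) \<le> (\<rho> ^ card U) ^ r * C" if "contracting U \<rho> s" for r s
      using that
    proof (induction r arbitrary: s)
      case 0
      then show ?case using E_bound by (simp add: C_def)
    next
      case (Suc r)
      have "cmod (E s) \<le> \<rho> ^ card U * cmod (E (s \<circ> Suc))" by (rule rec[OF Suc.prems])
      also have "\<dots> \<le> \<rho> ^ card U * ((\<rho> ^ card U) ^ r * C)"
        using assms(4) by (intro mult_left_mono Suc.IH contracting_shift Suc.prems) auto
      finally show ?case by (simp add: mult.assoc)
    qed
    have "\<rho> ^ card U < 1" using assms(4,5) False by (simp add: power_less_one_iff)
    then have "(\<lambda>r. (\<rho> ^ card U) ^ r * C) \<longlonglongrightarrow> 0 * C"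
      using assms(4) by (intro tendsto_mult LIMSEQ_power_zero tendsto_const) auto
    then have "cmod (E s) \<le> 0 * C"
      by (rule LIMSEQ_le_const) (use iter[OF less.prems(3)] in auto)
    then show ?thesis by simp
  qed
  then show ?case
    using has_sum_infsum[OF B(1)[OF less.prems(3)]] by (simp add: E_def)
qed

end

section \<open>The refined Littlewood identity\<close>

lemma prod_list_mult:
  fixes f g :: "'a \<Rightarrow> 'b::comm_monoid_mult"
  shows "(\<Prod>z\<leftarrow>zs. f z * g z) = (\<Prod>z\<leftarrow>zs. f z) * (\<Prod>z\<leftarrow>zs. g z)"
  by (induction zs) (simp_all add: mult_ac)

text \<open>Writing \<open>h\<close> as \<open>b * a\<close> on the matched pairs supplies exactly
  the factors \<open>b\<close> missing from the product over all pairs.\<close>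

lemma match_weight_map_upt:
  fixes a h b :: "'a \<Rightarrow> 'a \<Rightarrow> 'b::field_char_0"
  assumes "\<And>k. k < n \<Longrightarrow> h (v (2 * k)) (v (2 * k + 1)) = b (v (2 * k)) (v (2 * k + 1)) * a (v (2 * k)) (v (2 * k + 1))"
  shows "match_weight h b (map v [0..<2 * n])
     = pairprod b (map v [0..<2 * n]) * (\<Prod>k<n. a (v (2 * k)) (v (2 * k + 1)))"
  using assms
proof (induction n arbitrary: v)
  case (Suc n)
  let ?w = "\<lambda>i. v (Suc (Suc i))"
  have *: "map v [0..<2 * Suc n] = v 0 # v 1 # map ?w [0..<2 * n]"
    by (simp add: upt_conv_Cons del: upt_Suc flip: map_Suc_upt)
  have "match_weight h b (map ?w [0..<2 * n])
     = pairprod b (map ?w [0..<2 * n]) * (\<Prod>k<n. a (?w (2 * k)) (?w (2 * k + 1)))"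
  proof (rule Suc.IH)
    fix k assume "k < n"
    then show "h (?w (2 * k)) (?w (2 * k + 1)) = b (?w (2 * k)) (?w (2 * k + 1)) * a (?w (2 * k)) (?w (2 * k + 1))"
      using Suc.prems[of "Suc k"] by simp
  qed
  then show ?case
    unfolding * prod.lessThan_Suc_shift using Suc.prems[of 0]
    by (simp add: prod_list_mult o_def mult_ac)
qed simp

text \<open>Restoring the original order in the full product of \<open>b\<close> produces
  \<open>sign \<sigma>\<close>, which is the sign in the Pfaffian; both sides have the same
  normalisation.\<close>

lemma matchsum_eq_pfaffian:
  fixes u :: "nat \<Rightarrow> 'a" and a h b :: "'a \<Rightarrow> 'a \<Rightarrow> complex"
  assumes inj: "inj_on u {..<2 * n}" and b: "\<And>x y. b x y = - b y x"
    and h: "\<And>x y. x \<in> u ` {..<2 * n} \<Longrightarrow> y \<in> u ` {..<2 * n} \<Longrightarrow> x \<noteq> y \<Longrightarrow> h x y = b x y * a x y"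
  shows "matchsum h b (u ` {..<2 * n})
     = (\<Prod>j<2 * n. \<Prod>i<j. b (u i) (u j)) * pfaffian n (\<lambda>i j. a (u i) (u j))"
proof -
  let ?U = "u ` {..<2 * n}" and ?S = "{\<sigma>. \<sigma> permutes {..<2 * n}}"
  have "(\<Sum>xs\<in>permutations_of_set ?U. match_weight h b xs)
      = (\<Sum>\<sigma>\<in>?S. match_weight h b (map (u \<circ> \<sigma>) [0..<2 * n]))"
    by (rule sum.reindex_bij_betw[OF bij_betw_permutations_of_set[OF inj], symmetric])
  also have "\<dots> = (\<Sum>\<sigma>\<in>?S. (\<Prod>j<2 * n. \<Prod>i<j. b (u i) (u j))
      * (of_int (sign \<sigma>) * (\<Prod>k<n. a (u (\<sigma> (2 * k))) (u (\<sigma> (2 * k + 1))))))"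
  proof (rule sum.cong[OF refl])
    fix \<sigma> assume "\<sigma> \<in> ?S"
    then have s: "\<sigma> permutes {..<2 * n}" by simp
    have "match_weight h b (map (u \<circ> \<sigma>) [0..<2 * n])
       = pairprod b (map (u \<circ> \<sigma>) [0..<2 * n]) * (\<Prod>k<n. a ((u \<circ> \<sigma>) (2 * k)) ((u \<circ> \<sigma>) (2 * k + 1)))"
    proof (rule match_weight_map_upt)
      fix k assume "k < n"
      then have *: "\<sigma> (2 * k) \<in> {..<2 * n}" "\<sigma> (2 * k + 1) \<in> {..<2 * n}"
        using permutes_in_image[OF s] by auto
      have "\<sigma> (2 * k) \<noteq> \<sigma> (2 * k + 1)"
        using permutes_inj[OF s] by (metis injD n_not_Suc_n Suc_eq_plus1)
      then have "u (\<sigma> (2 * k)) \<noteq> u (\<sigma> (2 * k + 1))" using * inj by (meson inj_onD)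
      then show "h ((u \<circ> \<sigma>) (2 * k)) ((u \<circ> \<sigma>) (2 * k + 1))
          = b ((u \<circ> \<sigma>) (2 * k)) ((u \<circ> \<sigma>) (2 * k + 1)) * a ((u \<circ> \<sigma>) (2 * k)) ((u \<circ> \<sigma>) (2 * k + 1))"
        using * by (simp add: h)
    qed
    also have "pairprod b (map (u \<circ> \<sigma>) [0..<2 * n]) = of_int (sign \<sigma>) * (\<Prod>j<2 * n. \<Prod>i<j. b (u i) (u j))"
      unfolding pairprod_map_upt inversion_sign_eq_sign[OF s, symmetric] o_def
      by (rule prod_antisymmetric_permute[OF s, of "\<lambda>i j. b (u i) (u j)"]) (rule b)
    finally show "match_weight h b (map (u \<circ> \<sigma>) [0..<2 * n]) = (\<Prod>j<2 * n. \<Prod>i<j. b (u i) (u j))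
      * (of_int (sign \<sigma>) * (\<Prod>k<n. a (u (\<sigma> (2 * k))) (u (\<sigma> (2 * k + 1)))))"
      by (simp only: o_def mult_ac)
  qed
  finally have "(\<Sum>xs\<in>permutations_of_set ?U. match_weight h b xs)
      = (\<Prod>j<2 * n. \<Prod>i<j. b (u i) (u j)) *
        (\<Sum>\<sigma>\<in>?S. of_int (sign \<sigma>) * (\<Prod>k<n. a (u (\<sigma> (2 * k))) (u (\<sigma> (2 * k + 1)))))"
    by (simp only: sum_distrib_left)
  moreover have "card ?U div 2 = n" by (simp add: card_image[OF inj])
  ultimately show ?thesis
    unfolding matchsum_def pfaffian_def by simp
qed

lemma pfaffian_cong:
  assumes "\<And>i j. i < 2 * n \<Longrightarrow> j < 2 * n \<Longrightarrow> i \<noteq> j \<Longrightarrow> A i j = B i j"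
  shows "pfaffian n A = pfaffian n B"
  unfolding pfaffian_def
proof (intro arg_cong2[of _ _ _ _ "(/)"] sum.cong refl arg_cong2[of _ _ _ _ "(*)"] prod.cong)
  fix \<sigma> k assume "\<sigma> \<in> {\<sigma>. \<sigma> permutes {..<2 * n}}" and k: "k \<in> {..<n}"
  then have s: "\<sigma> permutes {..<2 * n}" by simp
  have "\<sigma> (2 * k) < 2 * n" "\<sigma> (2 * k + 1) < 2 * n" using k permutes_in_image[OF s] by auto
  moreover have "\<sigma> (2 * k) \<noteq> \<sigma> (2 * k + 1)"
    using permutes_inj[OF s] by (metis injD n_not_Suc_n Suc_eq_plus1)
  ultimately show "A (\<sigma> (2 * k)) (\<sigma> (2 * k + 1)) = B (\<sigma> (2 * k)) (\<sigma> (2 * k + 1))"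
    by (rule assms)
qed

section \<open>Refined weights and nondegeneracy\<close>

lemma zweight_refined:
  assumes "\<gamma> \<noteq> 0"
  shows "(\<Prod>j = 1..m. (1 - s ^ 2 * inverse \<gamma> * t ^ (2 * j - 2)) * (1 - \<gamma> * t ^ (2 * j - 1)))
     = zweight t s (\<gamma> * t + s ^ 2 * inverse \<gamma>) m"
proof -
  have "(\<Prod>j = 1..m. (1 - s ^ 2 * inverse \<gamma> * t ^ (2 * j - 2)) * (1 - \<gamma> * t ^ (2 * j - 1)))
      = (\<Prod>j<m. (1 - s ^ 2 * inverse \<gamma> * t ^ (2 * Suc j - 2)) * (1 - \<gamma> * t ^ (2 * Suc j - 1)))"
    by (rule prod.reindex_bij_witness[of _ Suc "\<lambda>j. j - 1"]) auto
  also have "\<dots> = zweight t s (\<gamma> * t + s ^ 2 * inverse \<gamma>) m"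
    unfolding zweight_def
  proof (rule prod.cong[OF refl])
    fix j
    have "4 * j + 1 = Suc (2 * j + 2 * j)" "2 * Suc j - 1 = Suc (2 * j)" "2 * Suc j - 2 = 2 * j" by simp_all
    then have e: "t ^ (4 * j + 1) = t * (t ^ (2 * j) * t ^ (2 * j))" "t ^ (2 * Suc j - 1) = t * t ^ (2 * j)"
      "t ^ (2 * Suc j - 2) = t ^ (2 * j)"
      by (simp_all only: power_Suc power_add)
    \<comment> \<open>Treating \<open>1 / \<gamma>\<close> as a separate \<open>\<delta>\<close>
      with \<open>\<gamma> * \<delta> = 1\<close> turns the claim into a polynomial
      identity.\<close>
    obtain \<delta> where \<delta>: "inverse \<gamma> = \<delta>" "\<gamma> * \<delta> = 1" using assms by simp
    obtain q where q: "t ^ (2 * j) = q" by simp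
    show "(1 - s ^ 2 * inverse \<gamma> * t ^ (2 * Suc j - 2)) * (1 - \<gamma> * t ^ (2 * Suc j - 1))
      = 1 - (\<gamma> * t + s ^ 2 * inverse \<gamma>) * t ^ (2 * j) + s ^ 2 * t ^ (4 * j + 1)"
      unfolding e \<delta>(1) q using \<delta>(2) by algebra
  qed
  finally show ?thesis .
qed

text \<open>If \<open>x * y = 1\<close>, then
  \<open>(x - s 0) * (y - s 0) = (1 - s 0 * x) * (1 - s 0 * y)\<close>. The two contraction factors
  would be inverse to each other, although both have norm below 1.\<close>

lemma contracting_product_ne_1:
  assumes "contracting U \<rho> s" "\<rho> < 1" "x \<in> U" "y \<in> U"
  shows "x * y \<noteq> 1"
proof
  assume xy: "x * y = 1"
  have c: "1 - s 0 * z \<noteq> 0 \<and> cmod ((z - s 0) / (1 - s 0 * z)) \<le> \<rho>" if "z \<in> U" for z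
    using assms(1) that by (auto simp: contracting_def)
  have x: "1 - s 0 * x \<noteq> 0" "cmod ((x - s 0) / (1 - s 0 * x)) < 1"
    and y: "1 - s 0 * y \<noteq> 0" "cmod ((y - s 0) / (1 - s 0 * y)) < 1"
    using c[OF assms(3)] c[OF assms(4)] assms(2) by auto
  have "(x - s 0) * (y - s 0) = (1 - s 0 * x) * (1 - s 0 * y)" using xy by algebra
  then have "(x - s 0) / (1 - s 0 * x) * ((y - s 0) / (1 - s 0 * y)) = 1"
    using x(1) y(1) by simp
  then have "cmod ((x - s 0) / (1 - s 0 * x)) * cmod ((y - s 0) / (1 - s 0 * y)) = 1"
    by (metis norm_mult norm_one)
  moreover have "cmod ((x - s 0) / (1 - s 0 * x)) * cmod ((y - s 0) / (1 - s 0 * y)) < 1 * 1"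
    by (rule mult_strict_mono') (use x y in auto)
  ultimately show False by simp
qed

theorem theorem1p1:
  fixes t \<epsilon> :: real and s u :: "nat \<Rightarrow> complex" and \<gamma> :: complex and n :: nat
  assumes "0 < t" and "t < 1"
    and "\<gamma> \<noteq> 0"
    and "n \<ge> 1"
    and "inj_on u {..<2 * n}"
    and "\<And>i x. i < 2 * n \<Longrightarrow> 1 - s x * u i \<noteq> 0"
    and "\<And>i j. i < j \<Longrightarrow> j < 2 * n \<Longrightarrow> 1 - complex_of_real t * u i * u j \<noteq> 0"
    and "\<epsilon> > 0"
    and "\<And>i x. i < 2 * n \<Longrightarrow> cmod ((u i - s x) / (1 - s x * u i)) \<le> 1 - \<epsilon>"
  shows
    "((\<lambda>lam.
        1 / t_pochhammer (complex_of_real t) (complex_of_real t) (count_list lam 0) *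
        (\<Prod>j = 1..count_list lam 0 div 2.
           (1 - (s 0)\<^sup>2 * inverse \<gamma> * complex_of_real t ^ (2 * j - 2)) *
           (1 - \<gamma> * complex_of_real t ^ (2 * j - 1))) *
        (\<Prod>j<2 * n. 1 - s 0 * u j) *
        (\<Prod>i. \<Prod>j = 1..count_list lam (Suc i) div 2.
           (1 - (s (Suc i))\<^sup>2 * complex_of_real t ^ (2 * j - 2)) /
           (1 - complex_of_real t ^ (2 * j))) *
        spin_HL (complex_of_real t) s lam u)
      has_sum
      (\<Prod>j<2 * n. \<Prod>i<j. (1 - complex_of_real t * u i * u j) / (u i - u j)) *
      pfaffian n (antisym_ext (\<lambda>i j.
        (u i - u j) *
        ((1 - complex_of_real t) * (1 - s 0 * u i) * (1 - s 0 * u j) +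
         (1 - \<gamma>) * (complex_of_real t - (s 0)\<^sup>2 * inverse \<gamma>) * (1 - u i * u j)) /
        ((1 - u i * u j) * (1 - complex_of_real t * u i * u j)))))
     {lam \<in> signatures (2 * n). \<forall>i. even (count_list lam i)}"
proof -
  define T where "T = complex_of_real t"
  define U where "U = u ` {..<2 * n}"
  define p where "p = \<gamma> * T + (s 0)\<^sup>2 * inverse \<gamma>"
  define \<kappa> where "\<kappa> = (1 - \<gamma>) * (T - (s 0)\<^sup>2 * inverse \<gamma>)"
  have \<kappa>: "\<kappa> = T + (s 0)\<^sup>2 - p"
  proof -
    obtain \<delta> where \<delta>: "inverse \<gamma> = \<delta>" "\<gamma> * \<delta> = 1" using assms(3) by simp
    show ?thesis unfolding \<kappa>_def p_def \<delta>(1) using \<delta>(2) by algebra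
  qed
  have T01: "T \<noteq> 0" "T \<noteq> 1" using assms(1,2) by (auto simp: T_def)
  have card: "card U = 2 * n" "finite U" by (simp_all add: U_def card_image assms(5))
  have contr: "contracting U (1 - \<epsilon>) s" using assms(6,9) by (auto simp: contracting_def U_def)
  \<comment> \<open>As \<open>n \<ge> 1\<close>, there is a variable \<open>u 0\<close>, and the
    norm bound for it shows that \<open>1 - \<epsilon>\<close> is nonnegative.\<close>
  have rho: "0 \<le> 1 - \<epsilon>" "1 - \<epsilon> < 1"
    using order_trans[OF norm_ge_zero assms(9)[of 0]] assms(4,8) by auto
  have nz1: "x * y \<noteq> 1" if "x \<in> U" "y \<in> U" for x y
    using contracting_product_ne_1[OF contr rho(2) that] .
  have nzT: "T * x * y \<noteq> 1" if xy: "x \<in> U" "y \<in> U" "x \<noteq> y" for x y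
  proof -
    from xy obtain i j where ij: "x = u i" "y = u j" "i < 2 * n" "j < 2 * n" "i \<noteq> j" by (auto simp: U_def)
    then show ?thesis
      using assms(7)[of i j] assms(7)[of j i] by (cases i j rule: linorder_cases) (auto simp: T_def mult_ac)
  qed
  have adm: "admissible T U" using card nz1 nzT by (simp add: admissible_def)
  note nzp = t_pochhammer_nonzero[OF assms(1,2) T_def]
  define f where "f = (\<lambda>lam. 1 / t_pochhammer T T (count_list lam 0) *
        (\<Prod>j = 1..count_list lam 0 div 2.
           (1 - (s 0)\<^sup>2 * inverse \<gamma> * T ^ (2 * j - 2)) * (1 - \<gamma> * T ^ (2 * j - 1))) *
        (\<Prod>j<2 * n. 1 - s 0 * u j) *
        (\<Prod>i. mult_weight T (s (Suc i)) (count_list lam (Suc i))) *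
        spin_sym T s lam U)"
  have f_shift: "f (map Suc \<mu> @ replicate (2 * m) 0) = zweight T (s 0) p m / t_pochhammer T T (2 * m)
      * (\<Prod>x\<in>U. 1 - s 0 * x) * sig_weight T (s \<circ> Suc) \<mu> * spin_sym T s (map Suc \<mu> @ replicate (2 * m) 0) U" for \<mu> m
  proof -
    have "(\<Prod>j<2 * n. 1 - s 0 * u j) = (\<Prod>x\<in>U. 1 - s 0 * x)"
      unfolding U_def by (simp add: prod.reindex[OF assms(5)])
    then show ?thesis
      unfolding f_def prodinf_mult_weight count_list_shift(1) nonzero_mult_div_cancel_left[OF zero_neq_numeral[symmetric]]
        zweight_refined[OF assms(3)] p_def by simp
  qed
  \<comment> \<open>The parameter \<open>\<gamma>\<close> affects the zero parts only. After their
    removal the sum is unrefined, with parameters \<open>s \<circ> Suc\<close>, and is evaluated by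
    \<open>level_sum\<close>.\<close>
  have "(f has_sum (\<Sum>S | S \<subseteq> U \<and> even (card S). zweight T (s 0) p (card (U - S) div 2)
      * (\<Prod>x\<in>S. x - s 0) * cross T S (U - S) * Phi T 0 0 S)) (even_signatures (2 * n))"
  proof (rule has_sum_first_row[OF card(2,1) _ nzp _ f_shift])
    show "1 - s 0 * x \<noteq> 0" if "x \<in> U" for x using contr that by (auto simp: contracting_def)
    show "((\<lambda>\<mu>. sig_weight T (s \<circ> Suc) \<mu> * spin_sym T (s \<circ> Suc) \<mu> S) has_sum Phi T 0 0 S) (even_signatures (card S))"
      if S: "S \<subseteq> U" "even (card S)" for S
    proof -
      have "contracting S (1 - \<epsilon>) (s \<circ> Suc)"
        by (intro contracting_shift contracting_subset[OF contr S(1)])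
      from level_sum[OF assms(1,2) T_def admissible_subset[OF adm S(1)] S(2) this rho] show ?thesis
        by (simp add: level_term_def[abs_def])
    qed
  qed
  also have "(\<Sum>S | S \<subseteq> U \<and> even (card S). zweight T (s 0) p (card (U - S) div 2)
      * (\<Prod>x\<in>S. x - s 0) * cross T S (U - S) * Phi T 0 0 S) = Phi T (s 0) \<kappa> U"
    using one_step_identity[OF T01 adm, of "s 0" p] card Rsum_even[OF card(2), of T "s 0" p]
    by (simp add: \<kappa>)
  also have "Phi T (s 0) \<kappa> U = (\<Prod>j<2 * n. \<Prod>i<j. (1 - T * u i * u j) / (u i - u j)) *
      pfaffian n (antisym_ext (\<lambda>i j. (u i - u j) * ((1 - T) * (1 - s 0 * u i) * (1 - s 0 * u j) + \<kappa> * (1 - u i * u j))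
        / ((1 - u i * u j) * (1 - T * u i * u j))))"
  proof -
    let ?a = "\<lambda>x y. (x - y) * ((1 - T) * (1 - s 0 * x) * (1 - s 0 * y) + \<kappa> * (1 - x * y))
        / ((1 - x * y) * (1 - T * x * y))"
    have "Phi T (s 0) \<kappa> U = (\<Prod>j<2 * n. \<Prod>i<j. bfac T (u i) (u j)) * pfaffian n (\<lambda>i j. ?a (u i) (u j))"
      unfolding Phi_def U_def
    proof (rule matchsum_eq_pfaffian[OF assms(5) bfac_anti])
      fix x y assume "x \<in> u ` {..<2 * n}" "y \<in> u ` {..<2 * n}" and xy: "x \<noteq> y"
      then have "1 - T * x * y \<noteq> 0" using nzT by (simp add: U_def)
      then show "hfac T (s 0) \<kappa> x y = bfac T x y * ?a x y"
        using xy by (simp add: hfac_def hnum_def bfac_def)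
    qed
    \<comment> \<open>The entry formula is itself antisymmetric, so extending it from above the
      diagonal changes no off-diagonal entry; the Pfaffian uses no diagonal entries.\<close>
    also have "pfaffian n (\<lambda>i j. ?a (u i) (u j)) = pfaffian n (antisym_ext (\<lambda>i j. ?a (u i) (u j)))"
    proof (rule pfaffian_cong)
      fix i j :: nat assume "i \<noteq> j"
      have "?a (u i) (u j) = - ?a (u j) (u i)"
        unfolding minus_divide_left minus_mult_left minus_diff_eq by (simp only: mult_ac add_ac)
      then show "?a (u i) (u j) = antisym_ext (\<lambda>i j. ?a (u i) (u j)) i j"
        using \<open>i \<noteq> j\<close> by (auto simp: antisym_ext_def)
    qed
    finally show ?thesis by (simp only: bfac_def)
  qed
  finally have main: "(f has_sum (\<Prod>j<2 * n. \<Prod>i<j. (1 - T * u i * u j) / (u i - u j)) *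
      pfaffian n (antisym_ext (\<lambda>i j. (u i - u j) * ((1 - T) * (1 - s 0 * u i) * (1 - s 0 * u j) + \<kappa> * (1 - u i * u j))
        / ((1 - u i * u j) * (1 - T * u i * u j))))) (even_signatures (2 * n))" .
  have HL: "spin_HL T s lam u = spin_sym T s lam U" if "lam \<in> even_signatures (2 * n)" for lam
  proof -
    have "length lam = 2 * n" using that by (simp add: even_signatures_def signatures_def)
    then show ?thesis using spin_HL_eq_spin_sym[of u lam T s] assms(5) by (simp add: U_def)
  qed
  show ?thesis
    unfolding T_def[symmetric] even_signatures_def[symmetric] \<kappa>_def[symmetric]
    by (rule has_sum_cong[THEN iffD1, OF _ main]) (simp add: f_def HL mult_weight_def)
qed

end
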